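(* Let $(\Lambda,\eta)$ be an isothermic surface in $S^{n}$, $\Lambda:\Sigma\to S^n$. Then locally, away from the zeros of $\eta$, $(\Lambda,\eta)$ always has a formal conserved quantity; that is, every point $x\in\Sigma$ with $\eta_x\neq 0$ has an open neighbourhood $U$ such that $(\Lambda|_U,\eta|_U)$ admits a formal conserved quantity.
   Context: Everything is smooth. $\mathbb{R}^{n+1,1}$ is the Lorentzian vector space with inner product $(\cdot,\cdot)$ of signature $(n+1,1)$, $\mathcal{L}$ is its light-cone (non-zero null vectors), and $S^n$ is identified, as a conformal manifold, with $\mathbb{P}(\mathcal{L})$, whose conformal class consists of the metrics $g_\sigma(X,Y)=(\mathrm{d}\sigma(X),\mathrm{d}\sigma(Y))$ for $\sigma$ never-zero sections of $\mathcal{L}\to\mathbb{P}(\mathcal{L})$. $\Sigma$ is a Riemann surface and $\Lambda:\Sigma\to S^n\cong\mathbb{P}(\mathcal{L})$ is a conformal immersion, viewed as a null line subbundle of the trivial bundle $\underline{\mathbb{R}}^{n+1,1}=\Sigma\times\mathbb{R}^{n+1,1}$; $\mathrm{d}$ denotes flat differentiation of sections of this bundle. Identify $\bigwedge^2\mathbb{R}^{n+1,1}\cong o(\mathbb{R}^{n+1,1})$ via $(u\wedge v)w=(u,w)v-(v,w)u$. An isothermic surface $(\Lambda,\eta)$ is such a $\Lambda$ together with a non-zero closed $1$-form $\eta\in\Omega^1\otimes o(\mathbb{R}^{n+1,1})$ on $\Sigma$ taking values in $\Lambda\wedge\Lambda^\perp$. The zero-set of $\eta$ is discrete. A formal conserved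 quantity of $(\Lambda,\eta)$ is a formal Laurent series $p(t)=\sum_{i\le 0}p_it^i$ with coefficients $p_i\in\Gamma(\underline{\mathbb{R}}^{n+1,1})$, $p_0\neq 0$, such that $(\mathrm{d}+t\eta)p(t)$ is the zero series.
   Formalization: The formal theorem assumes n ≥ 3: for n = 2 the claim fails for every isothermic surface, because ηp_0 = 0 forces p_0 = fσ and dp_0 = −ηp_{−1} then gives f = 0, so p_0 = 0; for n = 1 there is no immersion. *)

theory Defs
  imports "HOL-Analysis.Analysis"
begin

section \<open>Smooth functions on open subsets of a Euclidean space\<close>

text \<open>Only meaningful for open \<open>S\<close>. The domain is finite-dimensional, so iterated directional
  derivatives suffice.\<close>

primrec Ck_on :: "nat \<Rightarrow> 'a::euclidean_space set \<Rightarrow> ('a \<Rightarrow> 'b::real_normed_vector) \<Rightarrow> bool" where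
  "Ck_on 0 S f \<longleftrightarrow> continuous_on S f"
| "Ck_on (Suc k) S f \<longleftrightarrow>
     (\<forall>x\<in>S. f differentiable (at x)) \<and> (\<forall>v. Ck_on k S (\<lambda>x. frechet_derivative f (at x) v))"

definition smooth_on :: "'a::euclidean_space set \<Rightarrow> ('a \<Rightarrow> 'b::real_normed_vector) \<Rightarrow> bool" where
  "smooth_on S f \<longleftrightarrow> (\<forall>k. Ck_on k S f)"


section \<open>Riemann surfaces\<close>

text \<open>A chart is a pair of its domain and its coordinate function; values of the coordinate
  function outside the domain are irrelevant.\<close>

type_synonym 'a chart = "'a set \<times> ('a \<Rightarrow> complex)"

definition coord_rep :: "'a chart \<Rightarrow> ('a \<Rightarrow> 'b) \<Rightarrow> complex \<Rightarrow> 'b" where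
  "coord_rep c f = f \<circ> inv_into (fst c) (snd c)"

definition is_chart :: "'a topology \<Rightarrow> 'a chart \<Rightarrow> bool" where
  "is_chart X c \<longleftrightarrow> openin X (fst c) \<and> open (snd c ` fst c) \<and>
     homeomorphic_map (subtopology X (fst c)) (top_of_set (snd c ` fst c)) (snd c)"

text \<open>Second countability is not required: it is automatic by Rado's theorem.\<close>

locale riemann_surface =
  fixes X :: "'a topology" and A :: "'a chart set"
  assumes Hausdorff: "Hausdorff_space X"
    and connected: "connected_space X"
    and charts: "\<And>c. c \<in> A \<Longrightarrow> is_chart X c"
    and cover: "topspace X = (\<Union>c\<in>A. fst c)"
    and transition: "\<And>c d. \<lbrakk>c \<in> A; d \<in> A\<rbrakk> \<Longrightarrow>
      coord_rep c (snd d) holomorphic_on (snd c ` (fst c \<inter> fst d))"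

definition smooth_section ::
  "'a chart set \<Rightarrow> 'a set \<Rightarrow> ('a \<Rightarrow> 'b::real_normed_vector) \<Rightarrow> bool" where
  "smooth_section A U f \<longleftrightarrow> (\<forall>c\<in>A. smooth_on (snd c ` (fst c \<inter> U)) (coord_rep c f))"

text \<open>A chart \<open>c\<close> around \<open>x\<close> identifies the (real) tangent plane at \<open>x\<close> with \<open>\<complex>\<close>.
  \<open>dmap c f x v\<close> is the differential of \<open>f\<close> at \<open>x\<close> on the tangent vector with
  \<open>c\<close>-coordinates \<open>v\<close>.\<close>

definition dmap ::
  "'a chart \<Rightarrow> ('a \<Rightarrow> 'b::real_normed_vector) \<Rightarrow> 'a \<Rightarrow> complex \<Rightarrow> 'b" where
  "dmap c f x v = frechet_derivative (coord_rep c f) (at (snd c x)) v"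

text \<open>Vector-valued 1-forms are given by their expression in each chart of the atlas, subject to
  the usual transformation law.\<close>

type_synonym ('a, 'w) form1 = "'a chart \<Rightarrow> 'a \<Rightarrow> complex \<Rightarrow>\<^sub>L 'w"

definition one_form :: "'a chart set \<Rightarrow> ('a, 'w::real_normed_vector) form1 \<Rightarrow> bool" where
  "one_form A \<eta> \<longleftrightarrow>
     (\<forall>c\<in>A. smooth_section {c} (fst c) (\<eta> c)) \<and>
     (\<forall>c\<in>A. \<forall>d\<in>A. \<forall>x\<in>fst c \<inter> fst d. \<forall>v.
        blinfun_apply (\<eta> c x) v = blinfun_apply (\<eta> d x) (dmap c (snd d) x v))"

text \<open>For constant coordinate vector fields \<open>v\<close>, \<open>w\<close> one has
  \<open>d\<eta>(v, w) = \<partial>\<^sub>v (\<eta>(w)) - \<partial>\<^sub>w (\<eta>(v))\<close>.\<close>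

definition closed_form :: "'a chart set \<Rightarrow> ('a, 'w::real_normed_vector) form1 \<Rightarrow> bool" where
  "closed_form A \<eta> \<longleftrightarrow> (\<forall>c\<in>A. \<forall>x\<in>fst c. \<forall>v w.
     blinfun_apply (dmap c (\<eta> c) x v) w - blinfun_apply (dmap c (\<eta> c) x w) v = 0)"

definition form_nonzero_at ::
  "'a chart set \<Rightarrow> ('a, 'w::real_normed_vector) form1 \<Rightarrow> 'a \<Rightarrow> bool" where
  "form_nonzero_at A \<eta> x \<longleftrightarrow> (\<exists>c\<in>A. x \<in> fst c \<and> \<eta> c x \<noteq> 0)"


section \<open>The Lorentzian space and its light-cone\<close>

text \<open>With \<open>n = CARD('n)\<close>, this is \<open>\<real>\<^sup>n\<^sup>+\<^sup>1 \<times> \<real>\<close>; \<open>lor\<close> has signature \<open>(n+1, 1)\<close>.\<close>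

type_synonym 'n lorentz = "((real ^ 'n) \<times> real) \<times> real"

definition lor :: "'n::finite lorentz \<Rightarrow> 'n lorentz \<Rightarrow> real" where
  "lor u v = fst u \<bullet> fst v - snd u * snd v"

definition light_cone :: "'n::finite lorentz set" where
  "light_cone = {v. v \<noteq> 0 \<and> lor v v = 0}"

definition proj_light_cone :: "'n::finite lorentz set set" where
  "proj_light_cone = (\<lambda>v. span {v}) ` light_cone"

definition perp :: "'n::finite lorentz set \<Rightarrow> 'n lorentz set" where
  "perp L = {v. \<forall>u\<in>L. lor u v = 0}"

definition wedge :: "'n::finite lorentz \<Rightarrow> 'n lorentz \<Rightarrow> 'n lorentz \<Rightarrow>\<^sub>L 'n lorentz" where
  "wedge u v = Blinfun (\<lambda>w. lor u w *\<^sub>R v - lor v w *\<^sub>R u)"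

lemma linear_lor: "linear (lor u)"
  by (rule linearI) (simp_all add: lor_def inner_add_right algebra_simps)

lemma wedge_apply: "blinfun_apply (wedge u v) w = lor u w *\<^sub>R v - lor v w *\<^sub>R u"
proof -
  have "linear (\<lambda>w. lor u w *\<^sub>R v - lor v w *\<^sub>R u)"
    by (rule linearI)
      (simp_all add: linear_add[OF linear_lor] linear_scale[OF linear_lor] algebra_simps)
  then show ?thesis
    by (simp add: wedge_def bounded_linear_Blinfun_apply linear_conv_bounded_linear)
qed

lemma wedge_skew:
  "lor (blinfun_apply (wedge u v) w) w' + lor w (blinfun_apply (wedge u v) w') = 0"
  by (simp add: wedge_apply lor_def inner_diff_left inner_diff_right algebra_simps inner_commute)

definition wedge_space ::
  "'n::finite lorentz set \<Rightarrow> 'n lorentz set \<Rightarrow> ('n lorentz \<Rightarrow>\<^sub>L 'n lorentz) set" where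
  "wedge_space L M = span {wedge u v | u v. u \<in> L \<and> v \<in> M}"


section \<open>Isothermic surfaces\<close>

definition lift ::
  "'a chart set \<Rightarrow> ('a \<Rightarrow> 'n::finite lorentz set) \<Rightarrow> 'a set \<Rightarrow> ('a \<Rightarrow> 'n lorentz) \<Rightarrow> bool" where
  "lift A \<Lambda> U \<sigma> \<longleftrightarrow> smooth_section A U \<sigma> \<and> (\<forall>x\<in>U. \<sigma> x \<in> \<Lambda> x \<and> \<sigma> x \<noteq> 0)"

text \<open>A smooth map into the projectivised light-cone is the same as a smooth null line subbundle
  of the trivial bundle, i.e. one with local smooth never-zero sections.\<close>

definition null_line_bundle ::
  "'a topology \<Rightarrow> 'a chart set \<Rightarrow> ('a \<Rightarrow> 'n::finite lorentz set) \<Rightarrow> bool" where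
  "null_line_bundle X A \<Lambda> \<longleftrightarrow> (\<forall>x\<in>topspace X. \<Lambda> x \<in> proj_light_cone) \<and>
     (\<forall>x\<in>topspace X. \<exists>U \<sigma>. openin X U \<and> x \<in> U \<and> lift A \<Lambda> U \<sigma>)"

text \<open>The pull-back by \<open>\<Lambda>\<close> of a metric \<open>g\<^sub>s\<close>, for \<open>s\<close> a never-zero local section of the light-cone
  over its projectivisation, is \<open>(d\<sigma>, d\<sigma>)\<close> with \<open>\<sigma> = s \<circ> \<Lambda>\<close> a lift of \<open>\<Lambda>\<close>. It has to be a
  positive multiple of \<open>\<bar>dz\<bar>\<^sup>2\<close> in every holomorphic coordinate \<open>z\<close>; positivity makes \<open>\<Lambda>\<close> an
  immersion. Rescaling \<open>\<sigma>\<close> by a function \<open>f\<close> rescales the form by \<open>f\<^sup>2\<close>.\<close>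

definition conformal_immersion ::
  "'a topology \<Rightarrow> 'a chart set \<Rightarrow> ('a \<Rightarrow> 'n::finite lorentz set) \<Rightarrow> bool" where
  "conformal_immersion X A \<Lambda> \<longleftrightarrow> null_line_bundle X A \<Lambda> \<and>
     (\<forall>U \<sigma>. openin X U \<and> lift A \<Lambda> U \<sigma> \<longrightarrow>
        (\<forall>c\<in>A. \<forall>x\<in>fst c \<inter> U. \<exists>\<rho>>0. \<forall>v w.
           lor (dmap c \<sigma> x v) (dmap c \<sigma> x w) = \<rho> * (v \<bullet> w)))"

definition isothermic_surface ::
  "'a topology \<Rightarrow> 'a chart set \<Rightarrow> ('a \<Rightarrow> 'n::finite lorentz set) \<Rightarrow>
   ('a, 'n lorentz \<Rightarrow>\<^sub>L 'n lorentz) form1 \<Rightarrow> bool" where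
  "isothermic_surface X A \<Lambda> \<eta> \<longleftrightarrow>
     conformal_immersion X A \<Lambda> \<and> one_form A \<eta> \<and> closed_form A \<eta> \<and>
     (\<forall>c\<in>A. \<forall>x\<in>fst c. \<forall>v. blinfun_apply (\<eta> c x) v \<in> wedge_space (\<Lambda> x) (perp (\<Lambda> x))) \<and>
     (\<exists>x\<in>topspace X. form_nonzero_at A \<eta> x)"

text \<open>\<open>p i\<close> is the coefficient of \<open>t\<^sup>i\<close>, a section over the open set \<open>U\<close>; the coefficient of \<open>t\<^sup>i\<close>
  in \<open>(d + t \<eta>) p(t)\<close> is \<open>d p\<^sub>i + \<eta> p\<^sub>i\<^sub>-\<^sub>1\<close>. That \<open>p 0\<close> is non-zero means, as
  for any section, that it is not identically zero.\<close>

definition formal_conserved_quantity ::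
  "'a chart set \<Rightarrow> ('a, 'n::finite lorentz \<Rightarrow>\<^sub>L 'n lorentz) form1 \<Rightarrow> 'a set \<Rightarrow>
   (int \<Rightarrow> 'a \<Rightarrow> 'n lorentz) \<Rightarrow> bool" where
  "formal_conserved_quantity A \<eta> U p \<longleftrightarrow>
     (\<forall>i. smooth_section A U (p i)) \<and>
     (\<forall>i>0. \<forall>x\<in>U. p i x = 0) \<and>
     (\<exists>x\<in>U. p 0 x \<noteq> 0) \<and>
     (\<forall>i. \<forall>c\<in>A. \<forall>x\<in>fst c \<inter> U. \<forall>v.
        dmap c (p i) x v + blinfun_apply (blinfun_apply (\<eta> c x) v) (p (i - 1) x) = 0)"

end

theory Submission
  imports Defs "HOL-Complex_Analysis.Conformal_Mappings"
begin

text \<open>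
In a holomorphic coordinate \<open>z = x + \<i> y\<close>, with a lift \<open>\<sigma>\<close> of \<open>\<Lambda>\<close> scaled to induce the metric
\<open>\<bar>dz\<bar>\<^sup>2\<close>, closedness forces \<open>\<eta>(v) = \<sigma> \<and> d\<sigma>(cnj (q v))\<close> with \<open>q\<close> holomorphic
(\<open>hopf_differential\<close>). Near a point where \<open>\<eta>\<close> does not vanish, a primitive of a square root of \<open>q\<close>
is a new coordinate, in which \<open>q = 1\<close> (\<open>adapted_coordinate\<close>). Then
\<open>\<eta> = \<sigma> \<and> (\<sigma>\<^sub>x dx - \<sigma>\<^sub>y dy)\<close>, and closedness becomes the Moutard equation \<open>\<sigma>\<^sub>x\<^sub>y = u \<sigma>\<close>.

A conserved quantity is now a sequence of sections with \<open>dp = - \<eta> p'\<close> for consecutive terms \<open>p\<close>,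
\<open>p'\<close>. In terms of \<open>g = (\<sigma>, p')\<close> this reads \<open>p\<^sub>x = g\<^sub>x \<sigma> - g \<sigma>\<^sub>x\<close>,
\<open>p\<^sub>y = g \<sigma>\<^sub>y - g\<^sub>y \<sigma>\<close>, which is integrable precisely if \<open>g\<^sub>x\<^sub>y = u g\<close>. Given such a \<open>p\<close>, the
products of \<open>p'\<close> with \<open>\<sigma>\<close>, \<open>\<sigma>\<^sub>x\<close>, \<open>\<sigma>\<^sub>y\<close> are \<open>g\<close>, \<open>g\<^sub>x\<close>, \<open>g\<^sub>y\<close>, and \<open>p'\<close> has to
satisfy an equation of the same shape with a new function. The trace of this requirement fixes the
product of \<open>p'\<close> with \<open>\<sigma>\<^sub>x\<^sub>x + \<sigma>\<^sub>y\<^sub>y\<close>. What is left is the component \<open>\<nu>\<close> of \<open>p'\<close> in the normal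
bundle, the orthogonal complement of \<open>\<sigma>\<close>, \<open>\<sigma>\<^sub>x\<close>, \<open>\<sigma>\<^sub>y\<close>, \<open>\<sigma>\<^sub>x\<^sub>x + \<sigma>\<^sub>y\<^sub>y\<close>. The only further
condition is that \<open>dp'\<close> has no normal part, an inhomogeneous equation \<open>\<nabla>\<nu> = \<theta>\<close> for the normal
connection. Once it holds, the new function and its Moutard equation come from the equality of mixed
derivatives (\<open>potential_of_jet\<close>).

The equation \<open>\<nabla>\<nu> = \<theta>\<close> is solvable because \<open>\<nabla>\<close> is flat and \<open>\<theta>\<close> is closed; both follow from
\<open>\<sigma>\<^sub>x\<^sub>y = u \<sigma>\<close>. Flatness is proved for an extension of \<open>\<nabla>\<close> to the whole trivial bundle
(\<open>conn_flat\<close>), so that parallel transport becomes an overdetermined linear system for an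
operator-valued function; a Picard iteration along rays solves it on a small disc
(\<open>flat_linear_system_solvable\<close>). In parallel sections the equation for \<open>\<nu>\<close> then reduces to the
Poincare lemma on that fixed disc (\<open>jet_extension\<close>), and the recursion never leaves the disc. It
starts with a parallel normal section, which \<open>\<eta>\<close> annihilates and which can be chosen non-zero since
the normal bundle has rank \<open>n - 2 \<ge> 1\<close> (\<open>formal_solution\<close>).
\<close>

section \<open>Calculus of smooth functions\<close>

text \<open>The derivative as a function of the base point, so that it can be differentiated again.\<close>

definition pd :: "'a::real_normed_vector \<Rightarrow> ('a \<Rightarrow> 'b::real_normed_vector) \<Rightarrow> 'a \<Rightarrow> 'b" where
  "pd v f = (\<lambda>x. frechet_derivative f (at x) v)"

lemma has_derivative_pd:
  "(f has_derivative (\<lambda>v. pd v f x)) (at x)" if "f differentiable (at x)"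
  using that unfolding pd_def by (simp add: frechet_derivative_works)

lemma pd_eqI: "(f has_derivative f') (at x) \<Longrightarrow> pd v f x = f' v"
  unfolding pd_def using frechet_derivative_at by metis

lemma linear_pd: "linear (\<lambda>v. pd v f x)" if "f differentiable (at x)"
  using has_derivative_pd[OF that] has_derivative_linear by blast

lemma pd_cong:
  assumes "open S" "x \<in> S" "\<And>y. y \<in> S \<Longrightarrow> f y = g y"
  shows "pd v f x = pd v g x"
proof -
  have "frechet_derivative f (at x) = frechet_derivative g (at x)"
    unfolding frechet_derivative_def
    using has_derivative_transform_within_open[OF _ assms(1,2), of f _ UNIV g]
      has_derivative_transform_within_open[OF _ assms(1,2), of g _ UNIV f] assms(3)
    by (intro arg_cong[where f = Eps] ext) auto
  then show ?thesis by (simp add: pd_def)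
qed

lemma Ck_on_Suc:
  "Ck_on (Suc k) S f \<longleftrightarrow> (\<forall>x\<in>S. f differentiable (at x)) \<and> (\<forall>v. Ck_on k S (pd v f))"
  by (simp add: pd_def)

declare Ck_on.simps(2)[simp del]

lemma Ck_on_lower: "Ck_on (Suc k) S f \<Longrightarrow> Ck_on k S f"
proof (induction k arbitrary: f)
  case 0
  then show ?case
    by (auto simp: Ck_on_Suc intro: continuous_at_imp_continuous_on differentiable_imp_continuous_within)
next
  case (Suc k)
  then show ?case by (auto simp: Ck_on_Suc)
qed

lemma Ck_on_subset: "Ck_on k S f \<Longrightarrow> T \<subseteq> S \<Longrightarrow> Ck_on k T f"
  by (induction k arbitrary: f) (auto simp: Ck_on_Suc intro: continuous_on_subset)

lemma Ck_on_cong: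
  assumes "open S" "\<And>x. x \<in> S \<Longrightarrow> f x = g x" "Ck_on k S f"
  shows "Ck_on k S g"
  using assms(2,3)
proof (induction k arbitrary: f g)
  case 0
  then show ?case by (metis Ck_on.simps(1) continuous_on_cong)
next
  case (Suc k)
  have "g differentiable (at x)" if "x \<in> S" for x
    using Suc.prems that assms(1)
    unfolding Ck_on_Suc differentiable_def by (metis has_derivative_transform_within_open)
  moreover have "Ck_on k S (pd v g)" for v
  proof (rule Suc.IH[of "pd v f"])
    show "Ck_on k S (pd v f)" using Suc.prems by (simp add: Ck_on_Suc)
    show "pd v f x = pd v g x" if "x \<in> S" for x
      using pd_cong[OF assms(1) that] Suc.prems(1) by blast
  qed
  ultimately show ?case by (simp add: Ck_on_Suc)
qed

lemma smooth_on_cong: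
  "smooth_on S f \<Longrightarrow> open S \<Longrightarrow> (\<And>x. x \<in> S \<Longrightarrow> f x = g x) \<Longrightarrow> smooth_on S g"
  unfolding smooth_on_def using Ck_on_cong by blast

lemma smooth_on_subset: "smooth_on S f \<Longrightarrow> T \<subseteq> S \<Longrightarrow> smooth_on T f"
  unfolding smooth_on_def using Ck_on_subset by blast

lemma smooth_on_pd: "smooth_on S f \<Longrightarrow> smooth_on S (pd v f)"
  unfolding smooth_on_def by (meson Ck_on_Suc)

lemma smooth_on_imp_continuous_on: "smooth_on S f \<Longrightarrow> continuous_on S f"
  unfolding smooth_on_def by (metis Ck_on.simps(1))

lemma smooth_on_imp_differentiable: "smooth_on S f \<Longrightarrow> x \<in> S \<Longrightarrow> f differentiable (at x)"
  unfolding smooth_on_def by (meson Ck_on_Suc)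

lemma Ck_on_const: "Ck_on k S (\<lambda>x. c)"
  by (induction k arbitrary: c) (auto simp: Ck_on_Suc pd_def)

lemma smooth_on_const: "smooth_on S (\<lambda>x. c)"
  by (simp add: smooth_on_def Ck_on_const)

lemma Ck_on_add:
  assumes "open S"
  shows "Ck_on k S f \<Longrightarrow> Ck_on k S g \<Longrightarrow> Ck_on k S (\<lambda>x. f x + g x)"
proof (induction k arbitrary: f g)
  case 0
  then show ?case by (simp add: continuous_on_add)
next
  case (Suc k)
  have d: "((\<lambda>x. f x + g x) has_derivative (\<lambda>v. pd v f x + pd v g x)) (at x)" if "x \<in> S" for x
  proof -
    have "f differentiable (at x)" "g differentiable (at x)"
      using Suc.prems that by (simp_all add: Ck_on_Suc)
    then show ?thesis by (rule has_derivative_add[OF has_derivative_pd has_derivative_pd])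
  qed
  have "Ck_on k S (pd v (\<lambda>x. f x + g x))" for v
  proof (rule Ck_on_cong[OF assms])
    show "Ck_on k S (\<lambda>x. pd v f x + pd v g x)"
      using Suc by (simp add: Ck_on_Suc)
  qed (simp add: pd_eqI[OF d])
  then show ?case using d by (auto simp: Ck_on_Suc differentiable_def)
qed

text \<open>Closure under bounded linear and bilinear maps covers at once scalar multiples, the Lorentzian
product, the wedge product, evaluation of operators and their composition.\<close>

lemma (in bounded_linear) Ck_on:
  assumes "open S"
  shows "Ck_on k S g \<Longrightarrow> Ck_on k S (\<lambda>x. f (g x))"
proof (induction k arbitrary: g)
  case 0
  then show ?case by (auto intro: continuous_on)
next
  case (Suc k)
  have d: "((\<lambda>x. f (g x)) has_derivative (\<lambda>v. f (pd v g x))) (at x)" if "x \<in> S" for x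
  proof -
    have "g differentiable (at x)" using Suc.prems that by (simp add: Ck_on_Suc)
    then show ?thesis by (rule has_derivative[OF has_derivative_pd])
  qed
  have "Ck_on k S (pd v (\<lambda>x. f (g x)))" for v
  proof (rule Ck_on_cong[OF assms])
    show "Ck_on k S (\<lambda>x. f (pd v g x))" using Suc by (simp add: Ck_on_Suc)
  qed (simp add: pd_eqI[OF d])
  then show ?case using d by (auto simp: Ck_on_Suc differentiable_def)
qed

lemma (in bounded_bilinear) Ck_on:
  assumes "open S"
  shows "Ck_on k S f \<Longrightarrow> Ck_on k S g \<Longrightarrow> Ck_on k S (\<lambda>x. prod (f x) (g x))"
proof (induction k arbitrary: f g)
  case 0
  then show ?case by (auto intro: continuous_on)
next
  case (Suc k)
  have d: "((\<lambda>x. prod (f x) (g x)) has_derivative (\<lambda>v. prod (f x) (pd v g x) + prod (pd v f x) (g x))) (at x)"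
    if "x \<in> S" for x
  proof -
    have "f differentiable (at x)" "g differentiable (at x)"
      using Suc.prems that by (simp_all add: Ck_on_Suc)
    then show ?thesis by (rule FDERIV[OF has_derivative_pd has_derivative_pd])
  qed
  have "Ck_on k S (pd v (\<lambda>x. prod (f x) (g x)))" for v
  proof (rule Ck_on_cong[OF assms])
    show "Ck_on k S (\<lambda>x. prod (f x) (pd v g x) + prod (pd v f x) (g x))"
      using Suc.prems Suc.prems[THEN Ck_on_lower]
      by (intro Ck_on_add[OF assms] Suc.IH) (simp_all add: Ck_on_Suc)
  qed (simp add: pd_eqI[OF d])
  then show ?case using d by (auto simp: Ck_on_Suc differentiable_def)
qed

lemma smooth_on_add: "smooth_on S f \<Longrightarrow> smooth_on S g \<Longrightarrow> open S \<Longrightarrow> smooth_on S (\<lambda>x. f x + g x)"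
  by (simp add: smooth_on_def Ck_on_add)

lemma (in bounded_linear) smooth_on: "smooth_on S g \<Longrightarrow> open S \<Longrightarrow> smooth_on S (\<lambda>x. f (g x))"
  by (simp add: smooth_on_def Ck_on)

lemma (in bounded_bilinear) smooth_on:
  "smooth_on S f \<Longrightarrow> smooth_on S g \<Longrightarrow> open S \<Longrightarrow> smooth_on S (\<lambda>x. prod (f x) (g x))"
  by (simp add: smooth_on_def Ck_on)

lemma (in bounded_linear) pd:
  "g differentiable (at x) \<Longrightarrow> pd v (\<lambda>x. f (g x)) x = f (pd v g x)"
  by (rule pd_eqI[OF has_derivative[OF has_derivative_pd]])

lemma (in bounded_bilinear) pd:
  "f differentiable (at x) \<Longrightarrow> g differentiable (at x) \<Longrightarrow>
   pd v (\<lambda>x. prod (f x) (g x)) x = prod (f x) (pd v g x) + prod (pd v f x) (g x)"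
  by (rule pd_eqI[OF FDERIV[OF has_derivative_pd has_derivative_pd]])

lemma (in bounded_bilinear) differentiable_prod:
  "f differentiable (at x) \<Longrightarrow> g differentiable (at x) \<Longrightarrow> (\<lambda>x. prod (f x) (g x)) differentiable (at x)"
  by (rule differentiableI[OF FDERIV[OF has_derivative_pd has_derivative_pd]])

lemma pd_const: "pd v (\<lambda>x. c) x = 0"
  by (rule pd_eqI[OF has_derivative_const])

lemma pd_add:
  "f differentiable (at x) \<Longrightarrow> g differentiable (at x) \<Longrightarrow>
   pd v (\<lambda>x. f x + g x) x = pd v f x + pd v g x"
  by (rule pd_eqI[OF has_derivative_add[OF has_derivative_pd has_derivative_pd]])

lemma pd_minus: "f differentiable (at x) \<Longrightarrow> pd v (\<lambda>x. - f x) x = - pd v f x"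
  by (rule pd_eqI[OF has_derivative_minus[OF has_derivative_pd]])

lemma pd_diff:
  "f differentiable (at x) \<Longrightarrow> g differentiable (at x) \<Longrightarrow>
   pd v (\<lambda>x. f x - g x) x = pd v f x - pd v g x"
  by (rule pd_eqI[OF has_derivative_diff[OF has_derivative_pd has_derivative_pd]])

lemma smooth_on_minus: "smooth_on S f \<Longrightarrow> open S \<Longrightarrow> smooth_on S (\<lambda>x. - f x)"
  by (rule bounded_linear.smooth_on[OF bounded_linear_minus[OF bounded_linear_ident]])

lemma smooth_on_diff: "smooth_on S f \<Longrightarrow> smooth_on S g \<Longrightarrow> open S \<Longrightarrow> smooth_on S (\<lambda>x. f x - g x)"
  using smooth_on_add[of S f "\<lambda>x. - g x"] smooth_on_minus[of S g] by simp

lemma smooth_on_sum: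
  "open S \<Longrightarrow> (\<And>i. i \<in> I \<Longrightarrow> smooth_on S (f i)) \<Longrightarrow> smooth_on S (\<lambda>x. \<Sum>i\<in>I. f i x)"
  by (induction I rule: infinite_finite_induct) (auto intro!: smooth_on_add smooth_on_const)

lemma pd_sum:
  "(\<And>i. i \<in> I \<Longrightarrow> f i differentiable (at x)) \<Longrightarrow> pd v (\<lambda>x. \<Sum>i\<in>I. f i x) x = (\<Sum>i\<in>I. pd v (f i) x)"
  by (rule pd_eqI[OF has_derivative_sum]) (auto intro: has_derivative_pd)

lemma Ck_on_powr:
  fixes f :: "'a::euclidean_space \<Rightarrow> real"
  assumes "open S" "\<And>x. x \<in> S \<Longrightarrow> f x > 0"
  shows "Ck_on k S f \<Longrightarrow> Ck_on k S (\<lambda>x. f x powr a)"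
proof (induction k arbitrary: a)
  case 0
  then show ?case using assms(2) by (fastforce intro!: continuous_intros)
next
  case (Suc k)
  have d: "((\<lambda>x. f x powr a) has_derivative (\<lambda>v. (a * pd v f x) * f x powr (a - 1))) (at x)"
    if "x \<in> S" for x
  proof -
    have "(f has_derivative (\<lambda>v. pd v f x)) (at x)"
      using Suc.prems that unfolding Ck_on_Suc by (blast intro: has_derivative_pd)
    then have "((\<lambda>x. f x powr a) has_derivative
        (\<lambda>v. f x powr a * (0 * ln (f x) + pd v f x * a / f x))) (at x)"
      by (rule has_derivative_powr[OF _ has_derivative_const]) (use assms(2) that in auto)
    moreover have "f x powr a * (0 * ln (f x) + t * a / f x) = (a * t) * f x powr (a - 1)" for t
      using assms(2)[OF that] by (simp add: powr_diff)
    ultimately show ?thesis by simp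
  qed
  have "Ck_on k S (pd v (\<lambda>x. f x powr a))" for v
  proof (rule Ck_on_cong[OF assms(1)])
    show "Ck_on k S (\<lambda>x. (a * pd v f x) * f x powr (a - 1))"
      using Suc Ck_on_lower
      by (intro bounded_bilinear.Ck_on[OF bounded_bilinear_mult assms(1)] Ck_on_const)
        (auto simp: Ck_on_Suc)
  qed (simp add: pd_eqI[OF d])
  then show ?case using d by (auto simp: Ck_on_Suc differentiable_def)
qed

lemma smooth_on_powr:
  fixes f :: "'a::euclidean_space \<Rightarrow> real"
  shows "smooth_on S f \<Longrightarrow> open S \<Longrightarrow> (\<And>x. x \<in> S \<Longrightarrow> f x > 0) \<Longrightarrow> smooth_on S (\<lambda>x. f x powr a)"
  by (simp add: smooth_on_def Ck_on_powr)

lemma holomorphic_on_imp_Ck_on: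
  assumes "open S"
  shows "h holomorphic_on S \<Longrightarrow> Ck_on k S h"
proof (induction k arbitrary: h)
  case 0
  then show ?case by (simp add: holomorphic_on_imp_continuous_on)
next
  case (Suc k)
  have d: "(h has_derivative (\<lambda>v. deriv h x * v)) (at x)" if "x \<in> S" for x
    using holomorphic_derivI[OF Suc.prems assms that] by (simp add: has_field_derivative_def)
  have "Ck_on k S (pd v h)" for v
  proof (rule Ck_on_cong[OF assms])
    show "Ck_on k S (\<lambda>x. deriv h x * v)"
      by (intro Suc.IH holomorphic_intros holomorphic_deriv Suc.prems assms)
  qed (simp add: pd_eqI[OF d])
  then show ?case using d by (auto simp: Ck_on_Suc differentiable_def)
qed

text \<open>First-order equations in two variables prescribe the derivatives along \<open>1\<close> and \<open>\<i>\<close> only; this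
expansion turns them into statements about the full derivative.\<close>

lemma pd_complex_expand:
  "pd v f z = Re v *\<^sub>R pd 1 f z + Im v *\<^sub>R pd \<i> f z" if "f differentiable (at z)"
proof -
  interpret linear "\<lambda>v. pd v f z" by (rule linear_pd[OF that])
  have "v = Re v *\<^sub>R 1 + Im v *\<^sub>R \<i>" by (simp add: complex_eq_iff)
  then show ?thesis by (metis add scale)
qed

lemma has_derivative_compose_holomorphic:
  assumes "h holomorphic_on T" "open T" "z \<in> T" "f differentiable (at (h z))"
  shows "((\<lambda>z. f (h z)) has_derivative (\<lambda>v. pd (deriv h z * v) f (h z))) (at z)"
proof -
  have "(h has_derivative (\<lambda>v. deriv h z * v)) (at z)"
    using holomorphic_derivI[OF assms(1-3)] by (simp add: has_field_derivative_def)
  from has_derivative_compose[OF this has_derivative_pd[OF assms(4)]] show ?thesis .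
qed

text \<open>A holomorphic \<open>h\<close> acts on tangent vectors by multiplication with \<open>deriv h\<close>; hence each
derivative of \<open>f \<circ> h\<close> is a combination of derivatives of \<open>f\<close>, composed with \<open>h\<close>, with
holomorphic coefficients, and the induction goes through for all \<open>f\<close> at once.\<close>

lemma Ck_on_compose_holomorphic:
  assumes h: "h holomorphic_on T" "open T" "h ` T \<subseteq> S"
  shows "Ck_on k S f \<Longrightarrow> Ck_on k T (\<lambda>z. f (h z))"
proof (induction k arbitrary: f)
  case 0
  have "continuous_on T h" using h(1) by (rule holomorphic_on_imp_continuous_on)
  with 0 show ?case using continuous_on_compose2 h(3) by (metis Ck_on.simps(1))
next
  case (Suc k)
  have diff: "f differentiable (at (h z))" if "z \<in> T" for z
    using that Suc.prems h(3) by (auto simp: Ck_on_Suc)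
  note d = has_derivative_compose_holomorphic[OF h(1,2) _ diff]
  have "Ck_on k T (pd v (\<lambda>z. f (h z)))" for v
  proof (rule Ck_on_cong[OF h(2)])
    have hol: "Ck_on k T (\<lambda>z. deriv h z * v)"
      by (intro holomorphic_on_imp_Ck_on h holomorphic_intros holomorphic_deriv)
    have "Ck_on k T (\<lambda>z. pd u f (h z))" for u
      using Suc by (simp add: Ck_on_Suc)
    note bounded_bilinear.Ck_on[OF bounded_bilinear_scaleR h(2) _ this]
    from this[OF bounded_linear.Ck_on[OF bounded_linear_Re h(2) hol]]
      this[OF bounded_linear.Ck_on[OF bounded_linear_Im h(2) hol]]
    show "Ck_on k T (\<lambda>z. Re (deriv h z * v) *\<^sub>R pd 1 f (h z) + Im (deriv h z * v) *\<^sub>R pd \<i> f (h z))"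
      by (rule Ck_on_add[OF h(2)])
  qed (simp only: pd_eqI[OF d] pd_complex_expand[OF diff, symmetric])
  then show ?case using d by (auto simp: Ck_on_Suc differentiable_def)
qed

lemma smooth_on_compose_holomorphic:
  "smooth_on S f \<Longrightarrow> h holomorphic_on T \<Longrightarrow> open T \<Longrightarrow> h ` T \<subseteq> S \<Longrightarrow> smooth_on T (\<lambda>z. f (h z))"
  unfolding smooth_on_def using Ck_on_compose_holomorphic by blast

lemma pd_compose_holomorphic:
  "h holomorphic_on T \<Longrightarrow> open T \<Longrightarrow> z \<in> T \<Longrightarrow> f differentiable (at (h z)) \<Longrightarrow>
   pd v (\<lambda>z. f (h z)) z = pd (deriv h z * v) f (h z)"
  by (rule pd_eqI[OF has_derivative_compose_holomorphic])

section \<open>Closed one-forms and flat linear systems on a disc\<close>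

lemma smooth_on_Ck: "smooth_on S f \<Longrightarrow> Ck_on k S f"
  by (simp add: smooth_on_def)

lemma Ck_on_1D:
  assumes "Ck_on (Suc 0) S f"
  shows "x \<in> S \<Longrightarrow> f differentiable (at x)" "continuous_on S (pd v f)" "continuous_on S f"
  using assms Ck_on_lower[OF assms] by (auto simp: Ck_on_Suc)

lemma scaled_in_ball:
  fixes z :: "'a::real_normed_vector"
  assumes "z \<in> ball 0 r" "0 \<le> t" "t \<le> 1"
  shows "t *\<^sub>R z \<in> ball 0 r"
proof -
  have "t * norm z \<le> 1 * norm z" using assms by (intro mult_right_mono) auto
  then show ?thesis using assms by simp
qed

lemma continuous_on_along_rays:
  fixes g :: "complex \<Rightarrow> 'b::real_normed_vector"
  assumes "continuous_on (ball 0 r) g"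
  shows "continuous_on (ball 0 r \<times> cbox (0::real) 1) (\<lambda>p. g (snd p *\<^sub>R fst p))"
proof (rule continuous_on_compose2[OF assms])
  show "continuous_on (ball (0::complex) r \<times> cbox (0::real) 1) (\<lambda>p. snd p *\<^sub>R fst p)"
    by (intro continuous_intros)
  show "(\<lambda>p. snd p *\<^sub>R fst p) ` (ball 0 r \<times> cbox (0::real) 1) \<subseteq> ball (0::complex) r"
    by (auto simp del: mem_ball intro!: scaled_in_ball)
qed

lemma integral_along_ray_continuous:
  fixes g :: "complex \<Rightarrow> 'b::banach"
  assumes "continuous_on (ball 0 r) g"
  shows "continuous_on (ball 0 r) (\<lambda>z. integral {0..1::real} (\<lambda>t. t *\<^sub>R g (t *\<^sub>R z)))"
proof -
  have "continuous_on (ball 0 r \<times> cbox (0::real) 1) (\<lambda>p. snd p *\<^sub>R g (snd p *\<^sub>R fst p))"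
    by (intro continuous_intros continuous_on_along_rays assms)
  then show ?thesis
    using integral_continuous_on_param[of "ball 0 r" 0 1 "\<lambda>z t. t *\<^sub>R g (t *\<^sub>R z)"]
    by (simp add: case_prod_unfold)
qed

text \<open>The integral of the one-form \<open>a dx + b dy\<close> along the segment from \<open>0\<close> to \<open>z\<close>.\<close>

definition radial_integral :: "(complex \<Rightarrow> 'b) \<Rightarrow> (complex \<Rightarrow> 'b) \<Rightarrow> complex \<Rightarrow> 'b::banach" where
  "radial_integral a b z = integral {0..1} (\<lambda>t::real. Re z *\<^sub>R a (t *\<^sub>R z) + Im z *\<^sub>R b (t *\<^sub>R z))"

text \<open>The homotopy formula \<open>d(H\<theta>) = \<theta> - H(d\<theta>)\<close> for \<open>\<theta> = a dx + b dy\<close>. It is kept for forms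
that are not closed: in the Picard iteration below the curl term is what measures the failure of
an iterate to solve the differential equation.\<close>

lemma radial_integral_has_derivative:
  fixes a b :: "complex \<Rightarrow> 'b::banach"
  assumes a: "Ck_on (Suc 0) (ball 0 r) a" and b: "Ck_on (Suc 0) (ball 0 r) b"
    and z: "z \<in> ball 0 r"
  shows "(radial_integral a b has_derivative (\<lambda>v. Re v *\<^sub>R a z + Im v *\<^sub>R b z +
      (Re v * Im z - Im v * Re z) *\<^sub>R
        integral {0..1} (\<lambda>t::real. t *\<^sub>R (pd 1 b (t *\<^sub>R z) - pd \<i> a (t *\<^sub>R z))))) (at z)"
proof -
  note aD = Ck_on_1D[OF a] and bD = Ck_on_1D[OF b]
  define P where "P z t = a (t *\<^sub>R z) + Re z *\<^sub>R t *\<^sub>R pd 1 a (t *\<^sub>R z) + Im z *\<^sub>R t *\<^sub>R pd 1 b (t *\<^sub>R z)"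
    for z and t :: real
  define Q where "Q z t = b (t *\<^sub>R z) + Re z *\<^sub>R t *\<^sub>R pd \<i> a (t *\<^sub>R z) + Im z *\<^sub>R t *\<^sub>R pd \<i> b (t *\<^sub>R z)"
    for z and t :: real
  define D where "D z t = (blinfun_scaleR_left (P z t) o\<^sub>L Blinfun Re) + (blinfun_scaleR_left (Q z t) o\<^sub>L Blinfun Im)"
    for z and t :: real
  have D_apply: "blinfun_apply (D z t) v = Re v *\<^sub>R P z t + Im v *\<^sub>R Q z t" for z t v
    by (simp add: D_def blinfun.bilinear_simps bounded_linear_Blinfun_apply bounded_linear_Re bounded_linear_Im)
  note cont = continuous_on_along_rays[OF aD(3)] continuous_on_along_rays[OF bD(3)]
    continuous_on_along_rays[OF aD(2)] continuous_on_along_rays[OF bD(2)]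
  have contP: "continuous_on (ball 0 r \<times> cbox 0 1) (\<lambda>p. P (fst p) (snd p))"
    unfolding P_def by (intro continuous_intros cont)
  have contQ: "continuous_on (ball 0 r \<times> cbox 0 1) (\<lambda>p. Q (fst p) (snd p))"
    unfolding Q_def by (intro continuous_intros cont)
  have contD: "continuous_on (ball 0 r \<times> cbox 0 1) (\<lambda>(z, t). D z t)"
    unfolding D_def case_prod_unfold by (intro continuous_intros contP contQ)
  have ray: "t *\<^sub>R w \<in> ball 0 r" if "w \<in> ball 0 r" "t \<in> cbox 0 1" for w :: complex and t :: real
    using that by (intro scaled_in_ball) auto
  have deriv_ray: "((\<lambda>w. c (t *\<^sub>R w)) has_derivative (\<lambda>v. t *\<^sub>R (Re v *\<^sub>R pd 1 c (t *\<^sub>R w) + Im v *\<^sub>R pd \<i> c (t *\<^sub>R w)))) (at w)"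
    if "c differentiable (at (t *\<^sub>R w))" for c :: "complex \<Rightarrow> 'b" and t w
  proof -
    have "((\<lambda>w. c (t *\<^sub>R w)) has_derivative (\<lambda>v. pd (t *\<^sub>R v) c (t *\<^sub>R w))) (at w)"
      by (rule has_derivative_compose[where f = "\<lambda>w. t *\<^sub>R w", OF _ has_derivative_pd[OF that]])
        (intro derivative_intros)
    then show ?thesis
      by (simp only: linear_scale[OF linear_pd[OF that]] pd_complex_expand[OF that, symmetric])
  qed
  have deriv: "((\<lambda>z. Re z *\<^sub>R a (t *\<^sub>R z) + Im z *\<^sub>R b (t *\<^sub>R z)) has_derivative blinfun_apply (D w t)) (at w within ball 0 r)"
    if "w \<in> ball 0 r" "t \<in> cbox 0 1" for w t
  proof -
    have "((\<lambda>z. Re z *\<^sub>R a (t *\<^sub>R z) + Im z *\<^sub>R b (t *\<^sub>R z)) has_derivative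
      (\<lambda>v. (Re w *\<^sub>R (t *\<^sub>R (Re v *\<^sub>R pd 1 a (t *\<^sub>R w) + Im v *\<^sub>R pd \<i> a (t *\<^sub>R w))) + Re v *\<^sub>R a (t *\<^sub>R w))
        + (Im w *\<^sub>R (t *\<^sub>R (Re v *\<^sub>R pd 1 b (t *\<^sub>R w) + Im v *\<^sub>R pd \<i> b (t *\<^sub>R w))) + Im v *\<^sub>R b (t *\<^sub>R w)))) (at w)"
      by (intro derivative_intros deriv_ray aD(1) bD(1) ray that)
    moreover have "(\<lambda>v. (Re w *\<^sub>R (t *\<^sub>R (Re v *\<^sub>R pd 1 a (t *\<^sub>R w) + Im v *\<^sub>R pd \<i> a (t *\<^sub>R w))) + Re v *\<^sub>R a (t *\<^sub>R w))
        + (Im w *\<^sub>R (t *\<^sub>R (Re v *\<^sub>R pd 1 b (t *\<^sub>R w) + Im v *\<^sub>R pd \<i> b (t *\<^sub>R w))) + Im v *\<^sub>R b (t *\<^sub>R w)))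
      = blinfun_apply (D w t)"
      by (rule ext) (simp add: D_apply P_def Q_def algebra_simps)
    ultimately show ?thesis by (simp add: has_derivative_at_withinI)
  qed
  have slice: "continuous_on {0..1} (\<lambda>t. h w t)"
    if "continuous_on (ball 0 r \<times> cbox 0 1) (\<lambda>p. h (fst p) (snd p))" "w \<in> ball 0 r"
    for h :: "complex \<Rightarrow> real \<Rightarrow> 'c::topological_space" and w
  proof -
    have "continuous_on {0..1} (\<lambda>t::real. (w, t))" by (intro continuous_intros)
    moreover have "(\<lambda>t. (w, t)) ` {0..1} \<subseteq> ball 0 r \<times> cbox (0::real) 1" using that(2) by auto
    ultimately show ?thesis using continuous_on_compose2[OF that(1), of "{0..1}" "\<lambda>t. (w, t)"] by simp
  qed
  have int: "(\<lambda>t. Re w *\<^sub>R a (t *\<^sub>R w) + Im w *\<^sub>R b (t *\<^sub>R w)) integrable_on cbox 0 1"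
    if "w \<in> ball 0 r" for w
    unfolding box_real
    by (intro integrable_continuous_real slice[OF _ that, of "\<lambda>w t. Re w *\<^sub>R a (t *\<^sub>R w) + Im w *\<^sub>R b (t *\<^sub>R w)"]
        continuous_intros cont)
  have "((\<lambda>z. integral (cbox 0 1) (\<lambda>t. Re z *\<^sub>R a (t *\<^sub>R z) + Im z *\<^sub>R b (t *\<^sub>R z))) has_derivative
      blinfun_apply (integral (cbox 0 1) (D z))) (at z within ball 0 r)"
    by (rule leibniz_rule[OF deriv int contD z convex_ball])
  then have main: "(radial_integral a b has_derivative blinfun_apply (integral {0..1} (D z))) (at z)"
    using z unfolding radial_integral_def[abs_def] by (simp add: at_within_open[OF _ open_ball] del: mem_ball)
  have intP: "P z integrable_on {0..1}" and intQ: "Q z integrable_on {0..1}"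
    by (intro integrable_continuous_real slice contP contQ z)+
  have "continuous_on {0..1} (\<lambda>t. D z t)"
    by (rule slice[OF _ z]) (use contD in \<open>simp add: case_prod_unfold\<close>)
  then have intD: "D z integrable_on {0..1}"
    by (rule integrable_continuous_real)
  have "blinfun_apply (integral {0..1} (D z)) v = integral {0..1} (\<lambda>t. Re v *\<^sub>R P z t + Im v *\<^sub>R Q z t)" for v
    using integral_linear[OF intD blinfun.bounded_linear_left, of v]
    by (simp add: o_def D_apply)
  then have app: "blinfun_apply (integral {0..1} (D z)) v = Re v *\<^sub>R integral {0..1} (P z) + Im v *\<^sub>R integral {0..1} (Q z)" for v
    using intP intQ by (simp add: integral_add integrable_cmul)
  define I where "I = integral {0..1} (\<lambda>t::real. t *\<^sub>R (pd 1 b (t *\<^sub>R z) - pd \<i> a (t *\<^sub>R z)))"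
  have I: "((\<lambda>t::real. t *\<^sub>R (pd 1 b (t *\<^sub>R z) - pd \<i> a (t *\<^sub>R z))) has_integral I) {0..1}"
    unfolding I_def
    by (intro integrable_integral integrable_continuous_real
        slice[OF _ z, of "\<lambda>z t. t *\<^sub>R (pd 1 b (t *\<^sub>R z) - pd \<i> a (t *\<^sub>R z))"] continuous_intros cont)
  have ftc: "((\<lambda>t::real. c (t *\<^sub>R z) + t *\<^sub>R (Re z *\<^sub>R pd 1 c (t *\<^sub>R z) + Im z *\<^sub>R pd \<i> c (t *\<^sub>R z))) has_integral c z) {0..1}"
    if diff: "\<And>w. w \<in> ball 0 r \<Longrightarrow> c differentiable (at w)" for c :: "complex \<Rightarrow> 'b"
  proof -
    have "((\<lambda>t. t *\<^sub>R c (t *\<^sub>R z)) has_vector_derivative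
      c (t *\<^sub>R z) + t *\<^sub>R (Re z *\<^sub>R pd 1 c (t *\<^sub>R z) + Im z *\<^sub>R pd \<i> c (t *\<^sub>R z))) (at t within {0..1})"
      if t: "t \<in> {0..1}" for t
    proof -
      have d: "c differentiable (at (t *\<^sub>R z))"
        by (rule diff, rule ray) (use z t in auto)
      have "((\<lambda>t. c (t *\<^sub>R z)) has_derivative (\<lambda>h. pd (h *\<^sub>R z) c (t *\<^sub>R z))) (at t)"
        by (rule has_derivative_compose[where f = "\<lambda>t. t *\<^sub>R z", OF _ has_derivative_pd[OF d]])
          (intro derivative_intros)
      then have "((\<lambda>t. c (t *\<^sub>R z)) has_vector_derivative (Re z *\<^sub>R pd 1 c (t *\<^sub>R z) + Im z *\<^sub>R pd \<i> c (t *\<^sub>R z))) (at t)"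
        by (simp only: has_vector_derivative_def linear_scale[OF linear_pd[OF d]] pd_complex_expand[OF d, symmetric])
      then have "((\<lambda>t. t *\<^sub>R c (t *\<^sub>R z)) has_vector_derivative
        t *\<^sub>R (Re z *\<^sub>R pd 1 c (t *\<^sub>R z) + Im z *\<^sub>R pd \<i> c (t *\<^sub>R z)) + 1 *\<^sub>R c (t *\<^sub>R z)) (at t)"
        by (intro has_vector_derivative_scaleR derivative_intros)
      then show ?thesis by (simp add: add.commute has_vector_derivative_at_within)
    qed
    from fundamental_theorem_of_calculus[OF _ this] show ?thesis by simp
  qed
  have "(P z has_integral (a z + Im z *\<^sub>R I)) {0..1}"
  proof (rule has_integral_eq[OF _ has_integral_add[OF ftc[OF aD(1)] has_integral_cmul[OF I]]])
  qed (simp_all add: P_def algebra_simps)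
  moreover have "(Q z has_integral (b z + (- Re z) *\<^sub>R I)) {0..1}"
  proof (rule has_integral_eq[OF _ has_integral_add[OF ftc[OF bD(1)] has_integral_cmul[OF I]]])
  qed (simp_all add: Q_def algebra_simps)
  ultimately have eqs: "integral {0..1} (P z) = a z + Im z *\<^sub>R I" "integral {0..1} (Q z) = b z - Re z *\<^sub>R I"
    by (simp_all add: integral_unique)
  have "blinfun_apply (integral {0..1} (D z)) =
    (\<lambda>v. Re v *\<^sub>R a z + Im v *\<^sub>R b z + (Re v * Im z - Im v * Re z) *\<^sub>R I)"
    by (intro ext) (unfold app eqs, simp add: algebra_simps)
  with main show ?thesis by (simp add: I_def)
qed

text \<open>The regularity bootstrap for first-order systems: a function gains one derivative over its gradient.\<close>

lemma Ck_on_gradientI: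
  assumes "open S"
    and F: "\<And>z. z \<in> S \<Longrightarrow> (F has_derivative (\<lambda>v. Re v *\<^sub>R a z + Im v *\<^sub>R b z)) (at z)"
    and "Ck_on k S a" "Ck_on k S b"
  shows "Ck_on (Suc k) S F"
  unfolding Ck_on_Suc
proof (intro conjI ballI allI)
  show "F differentiable at z" if "z \<in> S" for z
    using F[OF that] by (auto simp: differentiable_def)
  fix v
  have "Ck_on k S (\<lambda>z. Re v *\<^sub>R a z + Im v *\<^sub>R b z)"
    by (intro Ck_on_add assms bounded_linear.Ck_on[OF bounded_linear_scaleR_right])
  then show "Ck_on k S (pd v F)"
    by (rule Ck_on_cong[OF assms(1), rotated]) (simp add: pd_eqI[OF F])
qed

lemma poincare_lemma_disc:
  fixes a b :: "complex \<Rightarrow> 'b::banach"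
  assumes a: "smooth_on (ball 0 r) a" and b: "smooth_on (ball 0 r) b"
    and closed: "\<And>z. z \<in> ball 0 r \<Longrightarrow> pd 1 b z = pd \<i> a z"
  obtains F where "smooth_on (ball 0 r) F"
    "\<And>z. z \<in> ball 0 r \<Longrightarrow> pd 1 F z = a z" "\<And>z. z \<in> ball 0 r \<Longrightarrow> pd \<i> F z = b z"
proof
  have D: "(radial_integral a b has_derivative (\<lambda>v. Re v *\<^sub>R a z + Im v *\<^sub>R b z)) (at z)"
    if z: "z \<in> ball 0 r" for z
  proof -
    have "pd 1 b (t *\<^sub>R z) - pd \<i> a (t *\<^sub>R z) = 0" if "t \<in> {0..1}" for t :: real
      using closed[OF scaled_in_ball[OF z, of t]] that by simp
    then have "integral {0..1} (\<lambda>t::real. t *\<^sub>R (pd 1 b (t *\<^sub>R z) - pd \<i> a (t *\<^sub>R z)))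
        = integral {0..1} (\<lambda>t::real. 0 :: 'b)"
      by (intro integral_cong) (simp only: scaleR_zero_right)
    then show ?thesis
      using radial_integral_has_derivative[OF smooth_on_Ck[OF a] smooth_on_Ck[OF b] z] by simp
  qed
  show "smooth_on (ball 0 r) (radial_integral a b)"
    unfolding smooth_on_def
    using Ck_on_lower[OF Ck_on_gradientI[OF open_ball D smooth_on_Ck[OF a] smooth_on_Ck[OF b]]] by blast
  show "pd 1 (radial_integral a b) z = a z" "pd \<i> (radial_integral a b) z = b z" if "z \<in> ball 0 r" for z
    by (simp_all add: pd_eqI[OF D[OF that]])
qed

lemma norm_radial_integral_diff_le:
  fixes a b a' b' :: "complex \<Rightarrow> 'b::banach"
  assumes cont: "continuous_on (ball 0 r) a" "continuous_on (ball 0 r) b"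
      "continuous_on (ball 0 r) a'" "continuous_on (ball 0 r) b'"
    and le: "\<And>w. w \<in> ball 0 r \<Longrightarrow> norm (a w - a' w) \<le> M" "\<And>w. w \<in> ball 0 r \<Longrightarrow> norm (b w - b' w) \<le> M"
    and z: "z \<in> ball 0 r"
  shows "norm (radial_integral a b z - radial_integral a' b' z) \<le> 2 * r * M"
proof -
  have M: "M \<ge> 0" using le(1)[OF z] norm_ge_zero order_trans by blast
  have ray: "t *\<^sub>R z \<in> ball 0 r" if "t \<in> {0..1}" for t :: real
    using that z by (intro scaled_in_ball) auto
  have "continuous_on {0..1} (\<lambda>t::real. t *\<^sub>R z)" by (intro continuous_intros)
  note rays = continuous_on_compose2[OF _ this]
  have c: "continuous_on {0..1} (\<lambda>t::real. h (t *\<^sub>R z))" if "continuous_on (ball 0 r) h" for h :: "complex \<Rightarrow> 'b"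
    by (rule rays[OF that]) (use ray in blast)
  have "radial_integral a b z - radial_integral a' b' z =
    integral {0..1} (\<lambda>t::real. (Re z *\<^sub>R a (t *\<^sub>R z) + Im z *\<^sub>R b (t *\<^sub>R z)) - (Re z *\<^sub>R a' (t *\<^sub>R z) + Im z *\<^sub>R b' (t *\<^sub>R z)))"
    unfolding radial_integral_def
    by (intro integral_diff[symmetric] integrable_continuous_real continuous_intros c cont)
  also have "norm \<dots> \<le> (2 * r * M) * (1 - 0)"
  proof (rule integral_bound)
    fix t :: real assume t: "t \<in> {0..1}"
    have "norm ((Re z *\<^sub>R a (t *\<^sub>R z) + Im z *\<^sub>R b (t *\<^sub>R z)) - (Re z *\<^sub>R a' (t *\<^sub>R z) + Im z *\<^sub>R b' (t *\<^sub>R z)))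
      = norm (Re z *\<^sub>R (a (t *\<^sub>R z) - a' (t *\<^sub>R z)) + Im z *\<^sub>R (b (t *\<^sub>R z) - b' (t *\<^sub>R z)))"
      by (simp add: algebra_simps)
    also have "\<dots> \<le> \<bar>Re z\<bar> * norm (a (t *\<^sub>R z) - a' (t *\<^sub>R z)) + \<bar>Im z\<bar> * norm (b (t *\<^sub>R z) - b' (t *\<^sub>R z))"
      using norm_triangle_ineq by (metis norm_scaleR)
    also have "\<dots> \<le> r * M + r * M"
      using z abs_Re_le_cmod[of z] abs_Im_le_cmod[of z] M
      by (intro add_mono mult_mono le ray t) auto
    finally show "norm ((Re z *\<^sub>R a (t *\<^sub>R z) + Im z *\<^sub>R b (t *\<^sub>R z)) - (Re z *\<^sub>R a' (t *\<^sub>R z) + Im z *\<^sub>R b' (t *\<^sub>R z))) \<le> 2 * r * M"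
      by (simp add: mult_ac)
  qed (auto intro!: continuous_intros c cont)
  finally show ?thesis by simp
qed

lemma norm_integral_ray_le:
  fixes h :: "complex \<Rightarrow> 'b::banach"
  assumes cont: "continuous_on (ball 0 r) h" and le: "\<And>w. w \<in> ball 0 r \<Longrightarrow> norm (h w) \<le> M"
    and z: "z \<in> ball 0 r"
  shows "norm (integral {0..1} (\<lambda>t::real. t *\<^sub>R h (t *\<^sub>R z))) \<le> M"
proof -
  have ray: "t *\<^sub>R z \<in> ball 0 r" if "t \<in> {0..1}" for t :: real
    using that z by (intro scaled_in_ball) auto
  have "continuous_on {0..1} (\<lambda>t::real. t *\<^sub>R z)" by (intro continuous_intros)
  then have c: "continuous_on {0..1} (\<lambda>t::real. h (t *\<^sub>R z))"
    by (rule continuous_on_compose2[OF cont]) (use ray in blast)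
  have "norm (integral {0..1} (\<lambda>t::real. t *\<^sub>R h (t *\<^sub>R z))) \<le> M * (1 - 0)"
  proof (rule integral_bound)
    fix t :: real assume t: "t \<in> {0..1}"
    have "\<bar>t\<bar> * norm (h (t *\<^sub>R z)) \<le> 1 * M"
      using t by (intro mult_mono le ray) auto
    then show "norm (t *\<^sub>R h (t *\<^sub>R z)) \<le> M" by simp
  qed (auto intro!: continuous_intros c)
  then show ?thesis by simp
qed

text \<open>A linear system \<open>d\<Phi> = (A dx + B dy) \<Phi>\<close> in two variables is overdetermined; flatness is its
compatibility condition. The iteration \<open>F\<^sub>k\<^sub>+\<^sub>1 = id + H((A dx + B dy) F\<^sub>k)\<close> integrates only along
rays, so its limit solves the radial part of the system for any \<open>A\<close>, \<open>B\<close>. To obtain the full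
system one follows the error \<open>E\<^sub>k = dF\<^sub>k - (A dx + B dy) F\<^sub>k\<close>. By flatness the curl of
\<open>(A dx + B dy) F\<^sub>k\<close> is linear in \<open>E\<^sub>k\<close> without any term in \<open>F\<^sub>k\<close> itself, so the homotopy
formula bounds \<open>E\<^sub>k\<^sub>+\<^sub>1\<close> by a fraction of \<open>E\<^sub>k\<close> plus a multiple of \<open>F\<^sub>k\<^sub>+\<^sub>1 - F\<^sub>k\<close>. Both go to zero
geometrically on a small disc, which gives convergence of the derivatives as well.\<close>

lemma flat_linear_system_solvable:
  fixes A B :: "complex \<Rightarrow> 'v::banach \<Rightarrow>\<^sub>L 'v"
  assumes R: "0 < R" and A: "smooth_on (ball 0 R) A" and B: "smooth_on (ball 0 R) B"
    and flat: "\<And>z. z \<in> ball 0 R \<Longrightarrow> pd 1 B z + (B z o\<^sub>L A z) = pd \<i> A z + (A z o\<^sub>L B z)"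
  obtains r \<Phi> where "0 < r" "r \<le> R" "smooth_on (ball 0 r) \<Phi>" "\<Phi> 0 = id_blinfun"
    "\<And>z. z \<in> ball 0 r \<Longrightarrow> pd 1 \<Phi> z = A z o\<^sub>L \<Phi> z" "\<And>z. z \<in> ball 0 r \<Longrightarrow> pd \<i> \<Phi> z = B z o\<^sub>L \<Phi> z"
proof -
  have sub: "cball (0::complex) (R/2) \<subseteq> ball 0 R" using R by auto
  have "compact (A ` cball 0 (R/2))" "compact (B ` cball 0 (R/2))"
    by (intro compact_continuous_image compact_cball
        continuous_on_subset[OF smooth_on_imp_continuous_on sub] A B)+
  then have "bounded (A ` cball 0 (R/2) \<union> B ` cball 0 (R/2))"
    by (intro bounded_Un[THEN iffD2] conjI compact_imp_bounded)
  then obtain K where K: "0 < K" and KAB: "\<And>X. X \<in> A ` cball 0 (R/2) \<union> B ` cball 0 (R/2) \<Longrightarrow> norm X \<le> K"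
    unfolding bounded_pos by blast
  \<comment> \<open>The radius makes \<open>r K \<le> 1/4\<close>, so that one integration
    over the two coordinates contracts by the factor \<open>2 r K \<le> 1/2\<close>.\<close>
  define r where "r = min (R/2) (1 / (4 * K))"
  define S where "S = ball (0::complex) r"
  have r: "0 < r" "r \<le> R" "r \<le> R / 2" using R K by (auto simp: r_def)
  have "r \<le> 1 / (4 * K)" by (simp add: r_def)
  then have rK: "r * K \<le> 1 / 4" using K by (simp add: field_simps)
  have SR: "S \<subseteq> ball 0 R" and "S \<subseteq> cball 0 (R/2)" using r by (auto simp: S_def)
  then have KA: "norm (A z) \<le> K" and KB: "norm (B z) \<le> K" if "z \<in> S" for z
    using that KAB by auto
  have opS: "open S" by (simp add: S_def)
  have AS: "Ck_on k S A" "Ck_on k S B" for k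
    using A B SR by (auto simp: smooth_on_def intro: Ck_on_subset)
  have comp_bound: "norm (X o\<^sub>L Y) \<le> K * M" if "norm X \<le> K" "norm Y \<le> M" for X Y :: "'v \<Rightarrow>\<^sub>L 'v" and M
    using norm_blinfun_compose[of X Y] mult_mono[OF that] K by (meson norm_ge_zero order_trans less_imp_le)
  have id: "X o\<^sub>L id_blinfun = X" for X :: "'v \<Rightarrow>\<^sub>L 'v"
    by (rule blinfun_eqI) simp
  have assoc: "((X o\<^sub>L Y) o\<^sub>L Z) = (X o\<^sub>L (Y o\<^sub>L Z))" for X Y Z :: "'v \<Rightarrow>\<^sub>L 'v"
    by (rule blinfun_eqI) simp
  define F where "F = rec_nat (\<lambda>z. id_blinfun)
    (\<lambda>k G z. id_blinfun + radial_integral (\<lambda>w. A w o\<^sub>L G w) (\<lambda>w. B w o\<^sub>L G w) z)"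
  have F0: "F 0 = (\<lambda>z. id_blinfun)" by (simp add: F_def)
  have FSuc: "F (Suc k) = (\<lambda>z. id_blinfun + radial_integral (\<lambda>w. A w o\<^sub>L F k w) (\<lambda>w. B w o\<^sub>L F k w) z)" for k
    by (simp add: F_def)
  define I where "I k z = integral {0..1} (\<lambda>t::real. t *\<^sub>R
    (pd 1 (\<lambda>w. B w o\<^sub>L F k w) (t *\<^sub>R z) - pd \<i> (\<lambda>w. A w o\<^sub>L F k w) (t *\<^sub>R z)))" for k z
  note comp_Ck = bounded_bilinear.Ck_on[OF bounded_bilinear_blinfun_compose opS]
  have derivI: "(F (Suc k) has_derivative (\<lambda>v. Re v *\<^sub>R ((A z o\<^sub>L F k z) + Im z *\<^sub>R I k z) +
      Im v *\<^sub>R ((B z o\<^sub>L F k z) - Re z *\<^sub>R I k z))) (at z)"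
    if "Ck_on (Suc 0) S (F k)" "z \<in> S" for k z
  proof -
    have "(radial_integral (\<lambda>w. A w o\<^sub>L F k w) (\<lambda>w. B w o\<^sub>L F k w) has_derivative
      (\<lambda>v. Re v *\<^sub>R (A z o\<^sub>L F k z) + Im v *\<^sub>R (B z o\<^sub>L F k z) + (Re v * Im z - Im v * Re z) *\<^sub>R I k z)) (at z)"
      unfolding I_def
      by (rule radial_integral_has_derivative[OF comp_Ck[OF AS(1) that(1), unfolded S_def]
            comp_Ck[OF AS(2) that(1), unfolded S_def] that(2)[unfolded S_def]])
    from has_derivative_add[OF has_derivative_const this, of id_blinfun]
    show ?thesis unfolding FSuc by (simp add: algebra_simps)
  qed
  have curl_cont: "continuous_on S (\<lambda>w. pd 1 (\<lambda>w. B w o\<^sub>L F k w) w - pd \<i> (\<lambda>w. A w o\<^sub>L F k w) w)"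
    if "Ck_on (Suc 0) S (F k)" for k
    by (intro continuous_on_diff Ck_on_1D(2)[OF comp_Ck] AS that)
  have C1: "Ck_on (Suc 0) S (F k)" for k
  proof (induction k)
    case 0
    show ?case by (simp only: F0 Ck_on_const)
  next
    case (Suc k)
    have "continuous_on S (I k)"
      using curl_cont[OF Suc] unfolding I_def S_def by (rule integral_along_ray_continuous)
    moreover have "continuous_on S (\<lambda>w. A w o\<^sub>L F k w)" "continuous_on S (\<lambda>w. B w o\<^sub>L F k w)"
      by (intro Ck_on_1D(3)[OF comp_Ck] AS Suc)+
    ultimately have "continuous_on S (\<lambda>z. (A z o\<^sub>L F k z) + Im z *\<^sub>R I k z)"
      "continuous_on S (\<lambda>z. (B z o\<^sub>L F k z) - Re z *\<^sub>R I k z)"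
      by (auto intro!: continuous_on_add continuous_on_diff continuous_on_scaleR
          continuous_on_Re continuous_on_Im continuous_on_id)
    then show ?case
      using Ck_on_gradientI[OF opS derivI[OF Suc], of 0] by simp
  qed
  note contAF = Ck_on_1D(3)[OF comp_Ck[OF AS(1) C1]] and contBF = Ck_on_1D(3)[OF comp_Ck[OF AS(2) C1]]
  have step: "norm (F (Suc k) z - F k z) \<le> (1/2) ^ Suc k" if "z \<in> S" for k z
    using that
  proof (induction k arbitrary: z)
    case 0
    have "norm (radial_integral (\<lambda>w. A w o\<^sub>L F 0 w) (\<lambda>w. B w o\<^sub>L F 0 w) z - radial_integral (\<lambda>w. 0) (\<lambda>w. 0) z) \<le> 2 * r * K"
      using 0 contAF[of 0] contBF[of 0] KA KB unfolding S_def
      by (intro norm_radial_integral_diff_le) (auto simp: F0 id)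
    moreover have "F (Suc 0) z - F 0 z = radial_integral (\<lambda>w. A w o\<^sub>L F 0 w) (\<lambda>w. B w o\<^sub>L F 0 w) z - radial_integral (\<lambda>w. 0) (\<lambda>w. 0) z"
      by (simp add: FSuc F0 radial_integral_def)
    ultimately show ?case using rK by simp
  next
    case (Suc k)
    have le: "norm ((X o\<^sub>L F (Suc k) w) - (X o\<^sub>L F k w)) \<le> K * (1/2) ^ Suc k" if "w \<in> S" "norm X \<le> K" for w and X :: "'v \<Rightarrow>\<^sub>L 'v"
      using comp_bound[OF that(2) Suc.IH[OF that(1)]] by (simp add: bounded_bilinear.diff_right[OF bounded_bilinear_blinfun_compose])
    have "norm (radial_integral (\<lambda>w. A w o\<^sub>L F (Suc k) w) (\<lambda>w. B w o\<^sub>L F (Suc k) w) z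
        - radial_integral (\<lambda>w. A w o\<^sub>L F k w) (\<lambda>w. B w o\<^sub>L F k w) z) \<le> 2 * r * (K * (1/2) ^ Suc k)"
      using Suc.prems contAF contBF le KA KB unfolding S_def
      by (intro norm_radial_integral_diff_le) auto
    also have "\<dots> = 2 * (r * K) * (1/2) ^ Suc k" by simp
    also have "\<dots> \<le> (1/2) * (1/2) ^ Suc k" using rK by (intro mult_right_mono) auto
    finally show ?case unfolding FSuc[of "Suc k"] by (simp add: FSuc[of k])
  qed
  \<comment> \<open>The rate \<open>3/4\<close> lies strictly above the rate \<open>1/2\<close> of \<open>step\<close>, so the
    inhomogeneous term in the recursive estimate is absorbed without a factor \<open>k\<close>; the constant
    \<open>4 K\<close> is the smallest one for which the induction step closes.\<close>
  have error: "norm (pd 1 (F k) z - (A z o\<^sub>L F k z)) \<le> 4 * K * (3/4) ^ k \<and>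
      norm (pd \<i> (F k) z - (B z o\<^sub>L F k z)) \<le> 4 * K * (3/4) ^ k" if "z \<in> S" for k z
    using that
  proof (induction k arbitrary: z)
    case 0
    then show ?case using KA[OF 0] KB[OF 0] K by (simp add: F0 pd_const id)
  next
    case (Suc k)
    define E where "E = 4 * K * (3/4) ^ k"
    have curl: "norm (pd 1 (\<lambda>w. B w o\<^sub>L F k w) w - pd \<i> (\<lambda>w. A w o\<^sub>L F k w) w) \<le> 2 * (K * E)"
      if w: "w \<in> S" for w
    proof -
      note c = bounded_bilinear.pd[OF bounded_bilinear_blinfun_compose]
      note alg = bounded_bilinear.diff_right[OF bounded_bilinear_blinfun_compose]
        bounded_bilinear.add_left[OF bounded_bilinear_blinfun_compose] assoc
      have "pd 1 (\<lambda>w. B w o\<^sub>L F k w) w - pd \<i> (\<lambda>w. A w o\<^sub>L F k w) w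
        = ((B w o\<^sub>L pd 1 (F k) w) + (pd 1 B w o\<^sub>L F k w)) - ((A w o\<^sub>L pd \<i> (F k) w) + (pd \<i> A w o\<^sub>L F k w))"
        by (simp only: c Ck_on_1D(1)[OF AS(1) w] Ck_on_1D(1)[OF AS(2) w] Ck_on_1D(1)[OF C1 w])
      \<comment> \<open>The last two summands cancel by flatness; what remains is linear in the errors.\<close>
      also have "\<dots> = ((B w o\<^sub>L (pd 1 (F k) w - (A w o\<^sub>L F k w))) - (A w o\<^sub>L (pd \<i> (F k) w - (B w o\<^sub>L F k w))))
        + ((pd 1 B w + (B w o\<^sub>L A w)) o\<^sub>L F k w) - ((pd \<i> A w + (A w o\<^sub>L B w)) o\<^sub>L F k w)"
        by (simp add: alg)
      also have "\<dots> = (B w o\<^sub>L (pd 1 (F k) w - (A w o\<^sub>L F k w))) - (A w o\<^sub>L (pd \<i> (F k) w - (B w o\<^sub>L F k w)))"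
        using flat w SR by auto
      also have "norm \<dots> \<le> K * E + K * E"
        using Suc.IH[OF w, folded E_def] KA[OF w] KB[OF w]
        by (intro order_trans[OF norm_triangle_ineq4 add_mono[OF comp_bound comp_bound]]) auto
      finally show ?thesis by (simp add: mult_ac)
    qed
    have "norm (I k z) \<le> 2 * (K * E)"
      unfolding I_def
      by (rule norm_integral_ray_le[OF curl_cont[OF C1, unfolded S_def] curl[unfolded S_def]
            Suc.prems[unfolded S_def]])
    then have Ik: "s * norm (I k z) \<le> E / 2" if "s \<le> r" "0 \<le> s" for s
    proof -
      have "s * norm (I k z) \<le> r * (2 * (K * E))"
        using that \<open>norm (I k z) \<le> 2 * (K * E)\<close> by (intro mult_mono) auto
      also have "\<dots> = 2 * (r * K) * E" by simp
      also have "\<dots> \<le> (1/2) * E"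
        using rK K by (intro mult_right_mono) (auto simp: E_def)
      finally show ?thesis by simp
    qed
    have ReIm: "\<bar>Re z\<bar> \<le> r" "\<bar>Im z\<bar> \<le> r"
      using Suc.prems abs_Re_le_cmod[of z] abs_Im_le_cmod[of z] by (auto simp: S_def)
    have small: "norm ((X o\<^sub>L F k z) - (X o\<^sub>L F (Suc k) z)) \<le> E / 4" if "norm X \<le> K" for X :: "'v \<Rightarrow>\<^sub>L 'v"
    proof -
      have "norm (F k z - F (Suc k) z) \<le> (3/4) ^ k"
      proof -
        have "(1/2::real) ^ Suc k \<le> (1/2) ^ k" by simp
        also have "\<dots> \<le> (3/4) ^ k" by (intro power_mono) auto
        finally show ?thesis using step[OF Suc.prems, of k] by (simp add: norm_minus_commute)
      qed
      from comp_bound[OF that this] show ?thesis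
        by (simp add: bounded_bilinear.diff_right[OF bounded_bilinear_blinfun_compose] E_def)
    qed
    note d = pd_eqI[OF derivI[OF C1 Suc.prems]]
    have "norm (pd 1 (F (Suc k)) z - (A z o\<^sub>L F (Suc k) z)) =
      norm (((A z o\<^sub>L F k z) - (A z o\<^sub>L F (Suc k) z)) + Im z *\<^sub>R I k z)"
      by (simp add: d algebra_simps)
    also have "\<dots> \<le> E / 4 + E / 2"
      using small[OF KA[OF Suc.prems]] Ik[OF ReIm(2)] by (intro norm_triangle_le) simp
    finally have 1: "norm (pd 1 (F (Suc k)) z - (A z o\<^sub>L F (Suc k) z)) \<le> 4 * K * (3/4) ^ Suc k"
      by (simp add: E_def)
    have "norm (pd \<i> (F (Suc k)) z - (B z o\<^sub>L F (Suc k) z)) =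
      norm (((B z o\<^sub>L F k z) - (B z o\<^sub>L F (Suc k) z)) + (- Re z) *\<^sub>R I k z)"
      by (simp add: d algebra_simps)
    also have "\<dots> \<le> E / 4 + E / 2"
      using small[OF KB[OF Suc.prems]] Ik[OF ReIm(1)] by (intro norm_triangle_le) simp
    finally show ?case using 1 by (simp add: E_def)
  qed
  have tail: "norm (F m z - F k z) \<le> (1/2) ^ k - (1/2) ^ m" if "z \<in> S" "k \<le> m" for z k m
    using that(2)
  proof (induction rule: dec_induct)
    case base
    show ?case by simp
  next
    case (step m)
    have "norm (F (Suc m) z - F k z) \<le> norm (F (Suc m) z - F m z) + norm (F m z - F k z)"
      using norm_triangle_ineq[of "F (Suc m) z - F m z" "F m z - F k z"] by simp
    then show ?case using step.IH \<open>\<And>k z. z \<in> S \<Longrightarrow> norm (F (Suc k) z - F k z) \<le> (1/2) ^ Suc k\<close>[OF that(1), of m]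
      by simp
  qed
  have half: "(\<lambda>k. (1/2::real) ^ k) \<longlonglongrightarrow> 0" and threeq: "(\<lambda>k. (3/4::real) ^ k) \<longlonglongrightarrow> 0"
    by (rule LIMSEQ_realpow_zero; simp)+
  have "convergent (\<lambda>k. F k z)" if z: "z \<in> S" for z
  proof (rule Cauchy_convergent, rule CauchyI')
    fix e :: real assume "e > 0"
    from order_tendstoD(2)[OF half this] obtain N where N: "\<And>m. m \<ge> N \<Longrightarrow> (1/2::real) ^ m < e"
      by (auto simp: eventually_sequentially)
    have "dist (F m z) (F n z) < e" if "m \<ge> N" "n > m" for m n
    proof -
      have "norm (F n z - F m z) \<le> (1/2) ^ m - (1/2) ^ n" using tail[OF z] that by simp
      also have "\<dots> \<le> (1/2) ^ m" by simp
      also have "\<dots> < e" using N that by simp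
      finally show ?thesis by (simp add: dist_norm norm_minus_commute)
    qed
    then show "\<exists>M. \<forall>m\<ge>M. \<forall>n>m. dist (F m z) (F n z) < e" by blast
  qed
  then obtain \<Phi> where lim: "\<And>z. z \<in> S \<Longrightarrow> (\<lambda>k. F k z) \<longlonglongrightarrow> \<Phi> z"
    unfolding convergent_def by metis
  have dist: "norm (F k z - \<Phi> z) \<le> (1/2) ^ k" if "z \<in> S" for k z
  proof (rule tendsto_upperbound)
    show "(\<lambda>m. norm (F k z - F m z)) \<longlonglongrightarrow> norm (F k z - \<Phi> z)"
      by (intro tendsto_intros lim that)
    show "\<forall>\<^sub>F m in sequentially. norm (F k z - F m z) \<le> (1/2) ^ k"
    proof (rule eventually_sequentiallyI[of k])
      fix m assume "k \<le> m"
      from tail[OF that this] have "norm (F m z - F k z) \<le> (1/2) ^ k"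
        by (rule order_trans) simp
      then show "norm (F k z - F m z) \<le> (1/2) ^ k" by (simp add: norm_minus_commute)
    qed
  qed simp
  define G where "G z v = Re v *\<^sub>R (A z o\<^sub>L \<Phi> z) + Im v *\<^sub>R (B z o\<^sub>L \<Phi> z)" for z v
  have conv: "norm (pd v (F k) z - G z v) \<le> (10 * K * (3/4) ^ k) * norm v" if z: "z \<in> S" for k z v
  proof -
    have q: "(1/2::real) ^ k \<le> (3/4) ^ k" by (intro power_mono) auto
    have comp: "norm (P - (X o\<^sub>L \<Phi> z)) \<le> 5 * K * (3/4) ^ k"
      if "norm (P - (X o\<^sub>L F k z)) \<le> 4 * K * (3/4) ^ k" "norm X \<le> K" for P X :: "'v \<Rightarrow>\<^sub>L 'v"
    proof -
      have "norm ((X o\<^sub>L F k z) - (X o\<^sub>L \<Phi> z)) \<le> K * (3/4) ^ k"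
        using comp_bound[OF that(2) order_trans[OF dist[OF z] q]]
        by (simp add: bounded_bilinear.diff_right[OF bounded_bilinear_blinfun_compose])
      with that(1) show ?thesis
        using norm_triangle_ineq[of "P - (X o\<^sub>L F k z)" "(X o\<^sub>L F k z) - (X o\<^sub>L \<Phi> z)"] by simp
    qed
    have "pd v (F k) z - G z v = Re v *\<^sub>R (pd 1 (F k) z - (A z o\<^sub>L \<Phi> z)) + Im v *\<^sub>R (pd \<i> (F k) z - (B z o\<^sub>L \<Phi> z))"
      by (subst pd_complex_expand[OF Ck_on_1D(1)[OF C1 z]]) (simp add: G_def algebra_simps)
    also have "norm \<dots> \<le> norm v * (5 * K * (3/4) ^ k) + norm v * (5 * K * (3/4) ^ k)"
      using comp[OF conjunct1[OF error[OF z]] KA[OF z]] comp[OF conjunct2[OF error[OF z]] KB[OF z]]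
        abs_Re_le_cmod[of v] abs_Im_le_cmod[of v]
      by (intro norm_triangle_le add_mono) (simp_all only: norm_scaleR mult_mono norm_ge_zero)
    finally show ?thesis by (simp add: algebra_simps)
  qed
  have "\<exists>g. \<forall>z\<in>S. (\<lambda>k. F k z) \<longlonglongrightarrow> g z \<and> (g has_derivative G z) (at z within S)"
  proof (rule has_derivative_sequence)
    show "convex S" by (simp add: S_def)
    show "(F k has_derivative (\<lambda>v. pd v (F k) z)) (at z within S)" if "z \<in> S" for k z
      by (rule has_derivative_at_withinI[OF has_derivative_pd[OF Ck_on_1D(1)[OF C1 that]]])
    show "\<forall>\<^sub>F k in sequentially. \<forall>z\<in>S. \<forall>v. norm (pd v (F k) z - G z v) \<le> e * norm v" if "e > 0" for e
    proof -
      have "(\<lambda>k. 10 * K * (3/4) ^ k) \<longlonglongrightarrow> 10 * K * 0" by (intro tendsto_intros threeq)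
      from order_tendstoD(2)[OF this, of e] that
      have "\<forall>\<^sub>F k in sequentially. 10 * K * (3/4) ^ k < e" by simp
      then show ?thesis
      proof eventually_elim
        case (elim k)
        then have "(10 * K * (3/4) ^ k) * norm v \<le> e * norm v" for v :: complex
          by (intro mult_right_mono) auto
        then show ?case using conv order_trans by blast
      qed
    qed
    show "0 \<in> S" using r by (simp add: S_def)
    then show "(\<lambda>k. F k 0) \<longlonglongrightarrow> \<Phi> 0" by (rule lim)
  qed
  then obtain g where g: "\<And>z. z \<in> S \<Longrightarrow> (\<lambda>k. F k z) \<longlonglongrightarrow> g z"
      "\<And>z. z \<in> S \<Longrightarrow> (g has_derivative G z) (at z within S)" by blast
  have gPhi: "g z = \<Phi> z" if "z \<in> S" for z
    using LIMSEQ_unique[OF g(1)[OF that] lim[OF that]] .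
  have D: "(g has_derivative (\<lambda>v. Re v *\<^sub>R (A z o\<^sub>L g z) + Im v *\<^sub>R (B z o\<^sub>L g z))) (at z)" if "z \<in> S" for z
    using g(2)[OF that] at_within_open[OF that opS] by (simp add: G_def[abs_def] gPhi[OF that])
  have "Ck_on k S g" for k
  proof (induction k)
    case 0
    show ?case using g(2) by (auto intro: has_derivative_continuous_on)
  next
    case (Suc k)
    show ?case by (intro Ck_on_gradientI[OF opS D] comp_Ck AS Suc)
  qed
  then have "smooth_on (ball 0 r) g" by (simp add: smooth_on_def S_def)
  moreover have "g 0 = id_blinfun"
  proof -
    have "F k 0 = id_blinfun" for k by (cases k) (simp_all add: F0 FSuc radial_integral_def)
    with g(1)[of 0] r show ?thesis by (simp add: S_def LIMSEQ_const_iff)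
  qed
  ultimately show ?thesis
    using r(1,2) that[of r g] pd_eqI[OF D] by (simp add: S_def)
qed

text \<open>After a translation to \<open>z = 0\<close>, integrating \<open>dg\<close> along rays recovers \<open>g - g(0)\<close>. Comparing the
derivative of this integral, given by the homotopy formula, with \<open>dg\<close> shows that the radial mean of
the curl \<open>\<kappa>\<close> of \<open>dg\<close> vanishes along rays; letting the ray shrink gives \<open>\<kappa> 0 / 2 = 0\<close>.\<close>

lemma pd_commute:
  fixes f :: "complex \<Rightarrow> 'b::banach"
  assumes f: "smooth_on S f" and S: "open S" and z: "z \<in> S"
  shows "pd 1 (pd \<i> f) z = pd \<i> (pd 1 f) z"
proof -
  obtain r where r: "r > 0" "ball z r \<subseteq> S" using S z openE by blast
  define g where "g w = f (z + w)" for w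
  define B where "B = ball (0::complex) r"
  have opB: "open B" by (simp add: B_def)
  have zB: "z + w \<in> S" if "w \<in> B" for w
    using that r(2) by (auto simp: B_def dist_norm subset_iff)
  have shift: "smooth_on B (\<lambda>w. h (z + w))" "\<And>v w. w \<in> B \<Longrightarrow> pd v (\<lambda>w. h (z + w)) w = pd v h (z + w)"
    if h: "smooth_on S h" for h :: "complex \<Rightarrow> 'b"
  proof -
    have hol: "(\<lambda>w. z + w) holomorphic_on B" by (intro holomorphic_intros)
    show "smooth_on B (\<lambda>w. h (z + w))"
      by (rule smooth_on_compose_holomorphic[OF h hol]) (use zB in \<open>blast intro: opB\<close>)+
    show "pd v (\<lambda>w. h (z + w)) w = pd v h (z + w)" if w: "w \<in> B" for v w
    proof -
      have "deriv (\<lambda>w. z + w) w = 1" by (rule DERIV_imp_deriv) (auto intro!: derivative_eq_intros)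
      with pd_compose_holomorphic[OF hol _ w smooth_on_imp_differentiable[OF h zB[OF w]]]
      show ?thesis by (simp add: B_def)
    qed
  qed
  have g: "smooth_on B g" unfolding g_def[abs_def] by (rule shift[OF f])
  define a where "a = pd 1 g"
  define b where "b = pd \<i> g"
  define \<kappa> where "\<kappa> w = pd 1 b w - pd \<i> a w" for w
  define I where "I w = integral {0..1} (\<lambda>t::real. t *\<^sub>R \<kappa> (t *\<^sub>R w))" for w
  have ab: "smooth_on B a" "smooth_on B b" unfolding a_def b_def by (intro smooth_on_pd g)+
  have B0: "0 \<in> B" using r by (simp add: B_def)
  have radial: "radial_integral a b w = g w - g 0" if w: "w \<in> B" for w
  proof -
    have "((\<lambda>t::real. Re w *\<^sub>R a (t *\<^sub>R w) + Im w *\<^sub>R b (t *\<^sub>R w)) has_integral (g (1 *\<^sub>R w) - g (0 *\<^sub>R w))) {0..1}"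
    proof (rule fundamental_theorem_of_calculus)
      fix t :: real assume "t \<in> {0..1}"
      then have "t *\<^sub>R w \<in> B" using w scaled_in_ball unfolding B_def by auto
      then have d: "g differentiable (at (t *\<^sub>R w))" by (rule smooth_on_imp_differentiable[OF g])
      have "((\<lambda>t. g (t *\<^sub>R w)) has_derivative (\<lambda>h. pd (h *\<^sub>R w) g (t *\<^sub>R w))) (at t)"
        by (rule has_derivative_compose[where f = "\<lambda>t. t *\<^sub>R w", OF _ has_derivative_pd[OF d]])
          (intro derivative_intros)
      then have "((\<lambda>t. g (t *\<^sub>R w)) has_vector_derivative (Re w *\<^sub>R a (t *\<^sub>R w) + Im w *\<^sub>R b (t *\<^sub>R w))) (at t)"
        by (simp only: has_vector_derivative_def linear_scale[OF linear_pd[OF d]] pd_complex_expand[OF d, symmetric] a_def b_def)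
      then show "((\<lambda>t. g (t *\<^sub>R w)) has_vector_derivative (Re w *\<^sub>R a (t *\<^sub>R w) + Im w *\<^sub>R b (t *\<^sub>R w))) (at t within {0..1})"
        by (rule has_vector_derivative_at_within)
    qed simp
    then show ?thesis unfolding radial_integral_def by (simp add: integral_unique)
  qed
  have I0: "I (of_real s) = 0" if s: "0 < s" "s < r" for s
  proof -
    let ?w = "of_real s :: complex"
    have w: "?w \<in> B" using s by (simp add: B_def)
    have "(radial_integral a b has_derivative (\<lambda>v. Re v *\<^sub>R a ?w + Im v *\<^sub>R b ?w +
      (Re v * Im ?w - Im v * Re ?w) *\<^sub>R I ?w)) (at ?w)"
      unfolding I_def \<kappa>_def
      by (rule radial_integral_has_derivative) (use ab w in \<open>auto simp: B_def intro: smooth_on_Ck\<close>)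
    then have "pd \<i> (radial_integral a b) ?w = b ?w - s *\<^sub>R I ?w"
      by (simp add: pd_eqI)
    moreover have "pd \<i> (radial_integral a b) ?w = pd \<i> (\<lambda>w. g w - g 0) ?w"
      by (rule pd_cong[OF _ w]) (auto simp: radial B_def)
    moreover have "\<dots> = b ?w"
      by (simp add: pd_diff[OF smooth_on_imp_differentiable[OF g w]] pd_const b_def)
    ultimately show ?thesis using s by simp
  qed
  have "continuous_on B \<kappa>"
    unfolding \<kappa>_def by (intro continuous_on_diff smooth_on_imp_continuous_on smooth_on_pd ab)
  then have "continuous_on B I"
    unfolding I_def B_def by (rule integral_along_ray_continuous)
  moreover have "(\<lambda>n. of_real (r / (real n + 2)) :: complex) \<longlonglongrightarrow> of_real 0"
  proof (rule tendsto_of_real)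
    have "(\<lambda>n. r * inverse (real (n + 2))) \<longlonglongrightarrow> r * 0"
      by (intro tendsto_mult_left LIMSEQ_ignore_initial_segment lim_inverse_n)
    then show "(\<lambda>n. r / (real n + 2)) \<longlonglongrightarrow> 0" by (simp add: divide_inverse add.commute)
  qed
  moreover have small: "0 < r / (real n + 2)" "r / (real n + 2) < r" for n
    using r(1) by (auto simp: field_simps add_pos_nonneg)
  ultimately have "(\<lambda>n. I (of_real (r / (real n + 2)))) \<longlonglongrightarrow> I (of_real 0)"
  proof (intro continuous_on_tendsto_compose[of B I])
    show "\<forall>\<^sub>F n in sequentially. of_real (r / (real n + 2)) \<in> B"
      using small r by (intro always_eventually allI) (simp add: B_def del: of_real_divide)
  qed (use B0 in auto)
  then have "I 0 = 0"
    using I0[OF small] LIMSEQ_unique[OF _ tendsto_const] by (simp del: of_real_divide)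
  moreover have "I 0 = (1/2) *\<^sub>R \<kappa> 0"
  proof -
    have "((\<lambda>t::real. t *\<^sub>R \<kappa> 0) has_integral ((1\<^sup>2 / 2) *\<^sub>R \<kappa> 0 - (0\<^sup>2 / 2) *\<^sub>R \<kappa> 0)) {0..1}"
      by (rule fundamental_theorem_of_calculus)
        (auto intro!: derivative_eq_intros simp: has_vector_derivative_def)
    then show ?thesis by (simp add: I_def integral_unique)
  qed
  ultimately have "\<kappa> 0 = 0" by simp
  moreover have "pd e (pd e' g) 0 = pd e (pd e' f) z" for e e'
  proof -
    have "pd e (pd e' g) 0 = pd e (\<lambda>w. pd e' f (z + w)) 0"
      by (rule pd_cong[OF _ B0]) (auto simp: B_def g_def[abs_def] intro!: shift(2)[OF f, unfolded B_def])
    then show ?thesis using shift(2)[OF smooth_on_pd[OF f] B0] by simp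
  qed
  ultimately show ?thesis by (simp add: \<kappa>_def a_def b_def)
qed

lemma smooth_on_zero_pd_const:
  fixes f :: "complex \<Rightarrow> 'b::real_normed_vector"
  assumes "smooth_on S f" "open S" "convex S" "x \<in> S" "y \<in> S"
    and "\<And>z. z \<in> S \<Longrightarrow> pd 1 f z = 0" "\<And>z. z \<in> S \<Longrightarrow> pd \<i> f z = 0"
  shows "f x = f y"
proof (rule has_derivative_zero_unique[OF assms(3) _ assms(4,5)])
  show "(f has_derivative (\<lambda>h. 0)) (at z within S)" if z: "z \<in> S" for z
  proof -
    have d: "f differentiable (at z)" by (rule smooth_on_imp_differentiable[OF assms(1) z])
    have "(f has_derivative (\<lambda>v. 0)) (at z)"
      using has_derivative_pd[OF d] assms(6,7)[OF z]
      by (simp add: pd_complex_expand[OF d, THEN ext, of "\<lambda>v. v"])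
    then show ?thesis by (rule has_derivative_at_withinI)
  qed
qed

section \<open>Lorentzian linear algebra\<close>

lemma bounded_bilinear_lor: "bounded_bilinear (lor :: 'n::finite lorentz \<Rightarrow> _)"
proof (rule bilinear_conv_bounded_bilinear[THEN iffD1])
  show "bilinear (lor :: 'n lorentz \<Rightarrow> _)"
    unfolding bilinear_def
    by (auto intro!: linearI simp: lor_def inner_add_left inner_add_right algebra_simps)
qed

interpretation lor: bounded_bilinear lor by (rule bounded_bilinear_lor)

lemmas lor_simps = lor.add_left lor.add_right lor.diff_left lor.diff_right lor.minus_left
  lor.minus_right lor.scaleR_left lor.scaleR_right lor.zero_left lor.zero_right

lemma lor_commute: "lor u v = lor v u"
  by (simp add: lor_def inner_commute)

text \<open>The isometry \<open>flip\<close> converts \<open>lor\<close> into the Euclidean inner product, so that the standard basis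
\<open>b\<close> and the vectors \<open>flip b\<close> are dual to each other with respect to \<open>lor\<close>.\<close>

definition flip :: "'n::finite lorentz \<Rightarrow> 'n lorentz" where
  "flip v = (fst v, - snd v)"

lemma lor_eq_inner_flip: "lor u v = u \<bullet> flip v"
  by (simp add: lor_def flip_def inner_prod_def)

lemma flip_flip [simp]: "flip (flip v) = v"
  by (simp add: flip_def)

lemma lor_nondegenerate: "(\<And>v. lor u v = 0) \<Longrightarrow> u = 0"
  by (metis flip_flip inner_eq_zero_iff lor_eq_inner_flip)

lemma sum_Basis_lor_flip: "(\<Sum>b\<in>Basis. lor (flip b) w *\<^sub>R b) = w"
proof -
  have "lor (flip b) w = w \<bullet> b" for b :: "'a lorentz"
    by (subst lor_commute) (simp add: lor_eq_inner_flip)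
  then show ?thesis by (simp add: euclidean_representation)
qed

lemma bounded_bilinear_wedge:
  "bounded_bilinear (wedge :: 'n::finite lorentz \<Rightarrow> 'n lorentz \<Rightarrow> 'n lorentz \<Rightarrow>\<^sub>L 'n lorentz)"
proof (rule bilinear_conv_bounded_bilinear[THEN iffD1])
  show "bilinear (wedge :: 'n lorentz \<Rightarrow> _)"
    unfolding bilinear_def
    by (intro conjI allI linearI blinfun_eqI)
      (simp_all add: wedge_apply lor_simps blinfun.bilinear_simps algebra_simps)
qed

interpretation wedge: bounded_bilinear wedge by (rule bounded_bilinear_wedge)

text \<open>The source of all structure equations below: differentiating a constant product moves a derivative
from one factor to the other.\<close>

lemma pd_lor_eq_const:
  assumes "open S" "z \<in> S" "f differentiable (at z)" "g differentiable (at z)"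
    and "\<And>w. w \<in> S \<Longrightarrow> lor (f w) (g w) = c"
  shows "lor (pd v f z) (g z) = - lor (f z) (pd v g z)"
proof -
  have "pd v (\<lambda>w. lor (f w) (g w)) z = pd v (\<lambda>w. c) z"
    by (rule pd_cong[OF assms(1,2,5)])
  then show ?thesis using lor.pd[OF assms(3,4), of v] by (simp add: pd_const)
qed

section \<open>Lifts with flat induced metric\<close>

text \<open>Statements about both coordinate directions are quantified over this set, so that each is proved once.\<close>

definition dirs :: "complex set" where "dirs = {1, \<i>}"

lemma one_in_dirs [simp]: "1 \<in> dirs" "\<i> \<in> dirs" by (auto simp: dirs_def)

lemma one_neq_i [simp]: "(1::complex) \<noteq> \<i>" "\<i> \<noteq> (1::complex)" by (auto simp: complex_eq_iff)

lemma pd_commute_dirs: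
  fixes f :: "complex \<Rightarrow> 'b::banach"
  assumes "smooth_on S f" "open S" "z \<in> S" "e \<in> dirs" "f' \<in> dirs"
  shows "pd e (pd f' f) z = pd f' (pd e f) z"
  using assms pd_commute[OF assms(1-3)] by (auto simp: dirs_def)

text \<open>A lift of a conformal immersion scaled so that the induced metric is \<open>\<bar>dz\<bar>\<^sup>2\<close>.\<close>

locale flat_lift =
  fixes S :: "complex set" and \<sigma> :: "complex \<Rightarrow> 'n::finite lorentz"
  assumes open_S: "open S"
    and smooth: "smooth_on S \<sigma>"
    and null: "\<And>z. z \<in> S \<Longrightarrow> lor (\<sigma> z) (\<sigma> z) = 0"
    and flat_metric: "\<And>z e f. z \<in> S \<Longrightarrow> e \<in> dirs \<Longrightarrow> f \<in> dirs \<Longrightarrow>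
      lor (pd e \<sigma> z) (pd f \<sigma> z) = (if e = f then 1 else 0)"
begin

abbreviation "lap \<equiv> (\<lambda>z. pd 1 (pd 1 \<sigma>) z + pd \<i> (pd \<i> \<sigma>) z)"

text \<open>The null vector completing \<open>\<sigma>\<close>, \<open>pd 1 \<sigma>\<close>, \<open>pd \<i> \<sigma>\<close> to a frame with constant Gram matrix.
Built from the Laplacian, it makes the complement of the frame the normal bundle of the mean curvature
sphere congruence; then the component along \<open>\<sigma>\<close> of a section is governed by a Laplacian alone.\<close>

definition "dual = (\<lambda>z. (1/2) *\<^sub>R lap z + (lor (lap z) (lap z) / 8) *\<^sub>R \<sigma> z)"

lemma lor_dual: "lor (dual z) v = (1/2) * lor (lap z) v + (lor (lap z) (lap z) / 8) * lor (\<sigma> z) v"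
  unfolding dual_def by (simp only: lor.add_left[of "_ *\<^sub>R (_ + _)"] lor.scaleR_left real_scaleR_def)

lemma smooth_pd: "smooth_on S (pd e \<sigma>)" "smooth_on S (pd e (pd f \<sigma>))"
  by (intro smooth_on_pd smooth)+

lemma smooth_dual: "smooth_on S dual"
proof -
  have l: "smooth_on S lap" by (intro smooth_on_add smooth_pd open_S)
  have "smooth_on S (\<lambda>z. lor (lap z) (lap z) *\<^sub>R ((1/8) *\<^sub>R \<sigma> z))"
    by (intro bounded_bilinear.smooth_on[OF bounded_bilinear_scaleR] lor.smooth_on l open_S
        bounded_linear.smooth_on[OF bounded_linear_scaleR_right] smooth)
  then show ?thesis
    unfolding dual_def
    by (intro smooth_on_add bounded_linear.smooth_on[OF bounded_linear_scaleR_right] l open_S) simp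
qed

lemma diffs:
  assumes "z \<in> S"
  shows "\<sigma> differentiable (at z)" "pd e \<sigma> differentiable (at z)"
    "pd e (pd f \<sigma>) differentiable (at z)" "dual differentiable (at z)" "pd e dual differentiable (at z)"
  using smooth_on_imp_differentiable[OF smooth assms] smooth_on_imp_differentiable[OF smooth_dual assms]
    smooth_on_imp_differentiable[OF smooth_pd(1) assms] smooth_on_imp_differentiable[OF smooth_pd(2) assms]
    smooth_on_imp_differentiable[OF smooth_on_pd[OF smooth_dual] assms]
  by simp_all

lemma lor_\<sigma>_pd: "lor (\<sigma> z) (pd e \<sigma> z) = 0" if "z \<in> S"
proof -
  have "lor (pd e \<sigma> z) (\<sigma> z) = - lor (\<sigma> z) (pd e \<sigma> z)"
    by (rule pd_lor_eq_const[OF open_S that diffs(1)[OF that] diffs(1)[OF that] null])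
  then show ?thesis by (simp add: lor_commute)
qed

lemma lor_\<sigma>_pd2: "lor (\<sigma> z) (pd e (pd f \<sigma>) z) = (if e = f then -1 else 0)"
  if "z \<in> S" "e \<in> dirs" "f \<in> dirs"
  using pd_lor_eq_const[OF open_S that(1) diffs(1)[OF that(1)] diffs(2)[OF that(1)] lor_\<sigma>_pd, of e f]
    flat_metric[OF that] by auto

lemma pd_commute_\<sigma>: "pd e (pd f \<sigma>) z = pd f (pd e \<sigma>) z" if "z \<in> S" "e \<in> dirs" "f \<in> dirs"
  by (rule pd_commute_dirs[OF smooth open_S that])

text \<open>The induced metric is flat in the coordinate \<open>z\<close>: its Christoffel symbols vanish.\<close>

lemma lor_pd_pd2: "lor (pd e \<sigma> z) (pd f (pd g \<sigma>) z) = 0"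
  if z: "z \<in> S" and dirs: "e \<in> dirs" "f \<in> dirs" "g \<in> dirs"
proof -
  have c: "lor (pd a (pd b \<sigma>) z) (pd c \<sigma> z) = - lor (pd b \<sigma> z) (pd a (pd c \<sigma>) z)"
    if "a \<in> dirs" "b \<in> dirs" "c \<in> dirs" for a b c
    by (rule pd_lor_eq_const[OF open_S z diffs(2)[OF z] diffs(2)[OF z] flat_metric[OF _ that(2,3)]])
  have sq: "lor (pd b \<sigma> z) (pd a (pd b \<sigma>) z) = 0" if "a \<in> dirs" "b \<in> dirs" for a b
    using c[OF that that(2)] by (simp add: lor_commute)
  show ?thesis
  proof (cases "e = g")
    case True
    then show ?thesis using sq dirs by simp
  next
    case False
    then consider "f = e" | "f = g" using dirs by (auto simp: dirs_def)
    then show ?thesis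
    proof cases
      case 1
      then show ?thesis using sq dirs pd_commute_\<sigma>[OF z dirs(2,3)] by simp
    next
      case 2
      then have "lor (pd e \<sigma> z) (pd f (pd g \<sigma>) z) = - lor (pd g (pd e \<sigma>) z) (pd g \<sigma> z)"
        using c[of g e g] dirs by simp
      also have "\<dots> = 0"
        using sq[of e g] dirs pd_commute_\<sigma>[OF z, of g e] by (simp add: lor_commute)
      finally show ?thesis .
    qed
  qed
qed

lemma lap_products:
  assumes "z \<in> S"
  shows "lor (\<sigma> z) (lap z) = -2" "e \<in> dirs \<Longrightarrow> lor (pd e \<sigma> z) (lap z) = 0"
  using assms by (simp_all add: lor.add_right lor_\<sigma>_pd2 lor_pd_pd2)

lemma dual_products:
  assumes z: "z \<in> S"
  shows "lor (\<sigma> z) (dual z) = -1" "e \<in> dirs \<Longrightarrow> lor (pd e \<sigma> z) (dual z) = 0"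
    "lor (dual z) (dual z) = 0"
proof -
  note l = lap_products[OF z, unfolded lor.add_right]
  show "lor (\<sigma> z) (dual z) = -1" "e \<in> dirs \<Longrightarrow> lor (pd e \<sigma> z) (dual z) = 0"
    using l null[OF z] lor_\<sigma>_pd[OF z] lor_commute[of "pd e \<sigma> z" "\<sigma> z"]
    by (simp_all only: dual_def lor_simps) simp_all
  have "lor ((1/2) *\<^sub>R l + (lor l l / 8) *\<^sub>R s) ((1/2) *\<^sub>R l + (lor l l / 8) *\<^sub>R s) = 0"
    if "lor s l = -2" "lor s s = 0" for l s :: "'n lorentz"
    using that lor_commute[of l s] by (simp add: lor_simps)
  from this[OF lap_products(1)[OF z] null[OF z]] show "lor (dual z) (dual z) = 0"
    by (simp only: dual_def)
qed

lemma pd_dual_products: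
  assumes z: "z \<in> S" and e: "e \<in> dirs"
  shows "lor (pd e dual z) (\<sigma> z) = 0"
    "f \<in> dirs \<Longrightarrow> lor (pd e dual z) (pd f \<sigma> z) = - lor (dual z) (pd e (pd f \<sigma>) z)"
    "lor (pd e dual z) (dual z) = 0"
proof -
  have "lor (pd e dual z) (\<sigma> z) = - lor (dual z) (pd e \<sigma> z)"
    by (rule pd_lor_eq_const[OF open_S z diffs(4,1)[OF z], of "-1"]) (metis dual_products(1) lor_commute)
  then show "lor (pd e dual z) (\<sigma> z) = 0" using dual_products(2)[OF z e] by (simp add: lor_commute)
  show "lor (pd e dual z) (pd f \<sigma> z) = - lor (dual z) (pd e (pd f \<sigma>) z)" if "f \<in> dirs"
    by (rule pd_lor_eq_const[OF open_S z diffs(4,2)[OF z], where c = 0]) (metis dual_products(2) that lor_commute)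
  have "lor (pd e dual z) (dual z) = - lor (dual z) (pd e dual z)"
    by (rule pd_lor_eq_const[OF open_S z diffs(4,4)[OF z] dual_products(3)])
  then show "lor (pd e dual z) (dual z) = 0" by (simp add: lor_commute)
qed

text \<open>The normal bundle is the orthogonal complement of the frame, and \<open>proj\<close> the orthogonal projection to
it; the signs in \<open>proj\<close> come from \<open>lor (\<sigma> z) (dual z) = -1\<close>.\<close>

definition "normal z \<nu> \<longleftrightarrow> lor (\<sigma> z) \<nu> = 0 \<and> (\<forall>e\<in>dirs. lor (pd e \<sigma> z) \<nu> = 0) \<and> lor (dual z) \<nu> = 0"

definition "proj z v = v - lor (pd 1 \<sigma> z) v *\<^sub>R pd 1 \<sigma> z - lor (pd \<i> \<sigma> z) v *\<^sub>R pd \<i> \<sigma> z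
    + lor (dual z) v *\<^sub>R \<sigma> z + lor (\<sigma> z) v *\<^sub>R dual z"

lemma frame_products:
  assumes z: "z \<in> S"
  shows "lor (\<sigma> z) (\<sigma> z) = 0" "lor (\<sigma> z) (pd 1 \<sigma> z) = 0" "lor (\<sigma> z) (pd \<i> \<sigma> z) = 0" "lor (\<sigma> z) (dual z) = -1"
    "lor (pd 1 \<sigma> z) (\<sigma> z) = 0" "lor (pd 1 \<sigma> z) (pd 1 \<sigma> z) = 1" "lor (pd 1 \<sigma> z) (pd \<i> \<sigma> z) = 0" "lor (pd 1 \<sigma> z) (dual z) = 0"
    "lor (pd \<i> \<sigma> z) (\<sigma> z) = 0" "lor (pd \<i> \<sigma> z) (pd 1 \<sigma> z) = 0" "lor (pd \<i> \<sigma> z) (pd \<i> \<sigma> z) = 1" "lor (pd \<i> \<sigma> z) (dual z) = 0"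
    "lor (dual z) (\<sigma> z) = -1" "lor (dual z) (pd 1 \<sigma> z) = 0" "lor (dual z) (pd \<i> \<sigma> z) = 0" "lor (dual z) (dual z) = 0"
  using null[OF z] lor_\<sigma>_pd[OF z] flat_metric[OF z] dual_products[OF z]
  by (simp_all add: lor_commute[of "pd 1 \<sigma> z" "\<sigma> z"] lor_commute[of "pd \<i> \<sigma> z" "\<sigma> z"]
      lor_commute[of "dual z" "\<sigma> z"] lor_commute[of "dual z" "pd _ _ z"])

lemma lor_pd_pd: "lor (pd v \<sigma> z) (pd w \<sigma> z) = v \<bullet> w" if z: "z \<in> S"
  by (subst (1 2) pd_complex_expand[OF diffs(1)[OF z]])
    (simp add: lor_simps frame_products[OF z] inner_complex_def)

lemma normal_proj: "normal z (proj z v)" if "z \<in> S"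
  using frame_products[OF that] by (simp add: normal_def proj_def dirs_def lor_simps)

lemma proj_normal: "normal z v \<Longrightarrow> proj z v = v"
  by (simp add: normal_def proj_def)

lemma lor_proj: "normal z w \<Longrightarrow> lor (proj z v) w = lor v w"
  by (simp add: normal_def proj_def lor_simps)

lemma linear_proj: "linear (proj z)"
  by (rule linearI) (simp_all add: proj_def lor_simps algebra_simps)

text \<open>The normal bundle has rank \<open>n - 2\<close>, with \<open>n = CARD('n)\<close>.\<close>

lemma exists_normal_vector:
  assumes "CARD('n) \<ge> 3" "z \<in> S"
  obtains w where "normal z w" "w \<noteq> 0"
proof -
  let ?F = "flip ` {\<sigma> z, pd 1 \<sigma> z, pd \<i> \<sigma> z, dual z}"
  have "dim (span ?F) \<le> card ?F" by (simp add: dim_le_card' del: image_insert)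
  also have "\<dots> \<le> card {\<sigma> z, pd 1 \<sigma> z, pd \<i> \<sigma> z, dual z}" by (rule card_image_le) simp
  also have "\<dots> \<le> 4" by (simp add: card_insert_if)
  also have "4 < DIM('n lorentz)" using assms(1) by simp
  finally obtain w where "w \<noteq> 0" "\<And>y. y \<in> span ?F \<Longrightarrow> orthogonal w y"
    using orthogonal_to_subspace_exists by (metis dim_span)
  then have o: "\<And>y. y \<in> ?F \<Longrightarrow> w \<bullet> y = 0" by (auto simp: orthogonal_def intro: span_base)
  have "lor v w = 0" if "v \<in> {\<sigma> z, pd 1 \<sigma> z, pd \<i> \<sigma> z, dual z}" for v
    using o[of "flip v"] that lor_commute[of v w] lor_eq_inner_flip[of w v] by auto
  then have "normal z w" by (simp add: normal_def dirs_def)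
  then show ?thesis using \<open>w \<noteq> 0\<close> by (rule that)
qed

text \<open>A vector that is orthogonal to \<open>\<sigma>\<close> and to the normal bundle has neither a normal component nor one
along \<open>dual\<close>. Derivatives of the coefficients are computed in this form.\<close>

lemma tangential_expand:
  assumes z: "z \<in> S" and X: "lor X (\<sigma> z) = 0" "\<And>\<nu>. normal z \<nu> \<Longrightarrow> lor X \<nu> = 0"
  shows "X = lor X (pd 1 \<sigma> z) *\<^sub>R pd 1 \<sigma> z + lor X (pd \<i> \<sigma> z) *\<^sub>R pd \<i> \<sigma> z - lor X (dual z) *\<^sub>R \<sigma> z"
proof -
  have "proj z X = 0"
  proof (rule lor_nondegenerate)
    fix v
    have "lor (proj z X) v = lor v (proj z X)" by (rule lor_commute)
    also have "\<dots> = lor (proj z v) (proj z X)" by (rule lor_proj[OF normal_proj[OF z], symmetric])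
    also have "\<dots> = lor (proj z X) (proj z v)" by (rule lor_commute)
    also have "\<dots> = lor X (proj z v)" by (rule lor_proj[OF normal_proj[OF z]])
    finally show "lor (proj z X) v = 0" using X(2)[OF normal_proj[OF z]] by simp
  qed
  then show ?thesis using X(1) by (simp add: proj_def lor_commute[of X] algebra_simps)
qed

end

section \<open>Isothermic lifts and the flatness of the normal connection\<close>

text \<open>The Moutard equation \<open>\<sigma>\<^sub>x\<^sub>y = u \<sigma>\<close> says that \<open>z\<close> is a curvature-line coordinate. It is the only
property of an isothermic surface that the construction of the conserved quantity uses.\<close>

locale isothermic_lift = flat_lift S \<sigma> for S :: "complex set" and \<sigma> :: "complex \<Rightarrow> 'n::finite lorentz" +
  assumes moutard: "\<And>z. z \<in> S \<Longrightarrow> \<exists>u. pd 1 (pd \<i> \<sigma>) z = u *\<^sub>R \<sigma> z"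
begin

definition "u = (\<lambda>z. - lor (pd 1 (pd \<i> \<sigma>) z) (dual z))"

lemma pd_1_i: "pd e (pd f \<sigma>) z = u z *\<^sub>R \<sigma> z" if z: "z \<in> S" and "e \<in> dirs" "f \<in> dirs" "e \<noteq> f"
proof -
  obtain k where k: "pd 1 (pd \<i> \<sigma>) z = k *\<^sub>R \<sigma> z" using moutard[OF z] by blast
  then have "u z = k" using dual_products(1)[OF z] by (simp add: u_def lor_simps)
  with k have "pd 1 (pd \<i> \<sigma>) z = u z *\<^sub>R \<sigma> z" by simp
  with pd_commute_\<sigma>[OF z, of 1 \<i>] that show ?thesis by (auto simp: dirs_def)
qed

text \<open>The normal connection, which lives on the normal bundle, is
extended to the whole trivial bundle by declaring the frame \<open>\<sigma>\<close>, \<open>pd 1 \<sigma>\<close>, \<open>pd \<i> \<sigma>\<close>, \<open>dual\<close>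
parallel. The difference to flat differentiation is skew, hence a sum of wedges: \<open>conn e\<close> is the skew
operator that maps each frame vector to its derivative in direction \<open>e\<close> and whose normal-to-normal part
vanishes. A section \<open>\<nu>\<close> is parallel if \<open>pd e \<nu> z = conn e z (\<nu> z)\<close>.\<close>

definition "conn e = (\<lambda>z. wedge (pd e \<sigma> z) (pd e (pd e \<sigma>) z)
    + wedge (pd e dual z + lor (pd e (pd e \<sigma>) z) (dual z) *\<^sub>R pd e \<sigma> z) (\<sigma> z))"

lemma smooth_conn: "smooth_on S (conn e)"
  unfolding conn_def
  by (intro smooth_on_add wedge.smooth_on bounded_bilinear.smooth_on[OF bounded_bilinear_scaleR]
      lor.smooth_on smooth_on_pd smooth smooth_dual open_S)

lemma conn_skew: "lor (conn e z v) w = - lor v (conn e z w)"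
  using wedge_skew[of _ _ v w] by (simp add: conn_def blinfun.bilinear_simps lor_simps add_eq_0_iff)

lemma conn_frame:
  assumes z: "z \<in> S" and e: "e \<in> dirs"
  shows "conn e z (\<sigma> z) = pd e \<sigma> z"
    "f \<in> dirs \<Longrightarrow> conn e z (pd f \<sigma> z) = pd e (pd f \<sigma>) z"
    "conn e z (dual z) = pd e dual z"
proof -
  note fp = null[OF z] lor_\<sigma>_pd[OF z] flat_metric[OF z] dual_products[OF z] lor_pd_pd2[OF z] lor_\<sigma>_pd2[OF z]
    pd_dual_products[OF z e]
  note sym = lor_commute[of "pd _ _ z" "\<sigma> z"] lor_commute[of "pd _ (pd _ \<sigma>) z" "pd _ \<sigma> z"]
  show "conn e z (\<sigma> z) = pd e \<sigma> z"
    using e fp pd_dual_products(1)[OF z e, unfolded sym]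
    by (simp add: conn_def blinfun.bilinear_simps wedge_apply lor_simps sym)
  show "conn e z (pd f \<sigma> z) = pd e (pd f \<sigma>) z" if f: "f \<in> dirs"
  proof (cases "f = e")
    case True
    then show ?thesis using e fp
      by (simp add: conn_def blinfun.bilinear_simps wedge_apply lor_simps sym lor_commute[of "dual z" "pd _ _ z"])
  next
    case False
    then have *: "pd e (pd f \<sigma>) z = u z *\<^sub>R \<sigma> z" using pd_1_i z e f by simp
    have "lor (dual z) (pd e (pd f \<sigma>) z) = - u z" unfolding * using fp(4) by (simp add: lor_simps lor_commute[of "dual z" "\<sigma> z"])
    then show ?thesis using e f False fp
      by (simp add: * conn_def blinfun.bilinear_simps wedge_apply lor_simps sym)
  qed
  show "conn e z (dual z) = pd e dual z"
    using e fp by (simp add: conn_def blinfun.bilinear_simps wedge_apply lor_simps)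
qed

lemma conn_normal:
  assumes "normal z \<nu>" "e \<in> dirs"
  shows "conn e z \<nu> = lor (pd e dual z) \<nu> *\<^sub>R \<sigma> z - lor (pd e (pd e \<sigma>) z) \<nu> *\<^sub>R pd e \<sigma> z"
  using assms by (simp add: normal_def conn_def blinfun.bilinear_simps wedge_apply lor_simps)

text \<open>The curvature \<open>R\<close> is skew, and it annihilates the frame because the frame is parallel. So only its
normal-to-normal part has to be computed. There the derivatives of \<open>conn\<close> contribute only through
\<open>\<sigma>\<^sub>x\<^sub>y = u \<sigma>\<close>, which is orthogonal to all normal vectors, and the products only through pairings
of \<open>\<sigma>\<close>, \<open>\<sigma>\<^sub>x\<close> with \<open>\<sigma>\<close>, \<open>\<sigma>\<^sub>y\<close>, which vanish. This is the Ricci equation for simultaneously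
diagonal second fundamental forms.\<close>

lemma conn_flat:
  assumes z: "z \<in> S"
  shows "pd 1 (conn \<i>) z + (conn \<i> z o\<^sub>L conn 1 z) = pd \<i> (conn 1) z + (conn 1 z o\<^sub>L conn \<i> z)"
proof -
  define R where "R = pd 1 (conn \<i>) z + (conn \<i> z o\<^sub>L conn 1 z) - (pd \<i> (conn 1) z + (conn 1 z o\<^sub>L conn \<i> z))"
  have R_apply: "blinfun_apply R v = pd 1 (conn \<i>) z v + conn \<i> z (conn 1 z v) - (pd \<i> (conn 1) z v + conn 1 z (conn \<i> z v))" for v
    by (simp add: R_def blinfun.bilinear_simps)
  have dconn: "conn e differentiable (at z)" for e
    by (rule smooth_on_imp_differentiable[OF smooth_conn z])
  note pd_apply = bounded_bilinear.pd[OF bounded_bilinear_blinfun_apply, OF dconn]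
  have skew_pd: "lor (pd e (conn f) z v) w = - lor v (pd e (conn f) z w)" for e f v w
  proof -
    have c: "pd e (\<lambda>y. conn f y x) z = pd e (conn f) z x" "(\<lambda>y. blinfun_apply (conn f y) x) differentiable (at z)" for x
      by (rule bounded_linear.pd[OF blinfun.bounded_linear_left dconn])
        (rule differentiableI[OF bounded_linear.has_derivative[OF blinfun.bounded_linear_left has_derivative_pd[OF dconn]]])
    have "lor (pd e (\<lambda>y. conn f y v) z) w = pd e (\<lambda>y. lor (conn f y v) w) z"
      by (simp add: lor.pd[OF c(2) differentiable_const] pd_const lor_simps)
    also have "\<dots> = pd e (\<lambda>y. - lor v (conn f y w)) z" by (simp add: conn_skew)
    also have "\<dots> = - pd e (\<lambda>y. lor v (conn f y w)) z"
      by (rule pd_minus) (intro lor.differentiable_prod c differentiable_const)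
    also have "\<dots> = - lor v (pd e (\<lambda>y. conn f y w) z)"
      by (simp add: lor.pd[OF differentiable_const c(2)] pd_const lor_simps)
    finally show ?thesis by (simp add: c)
  qed
  have R_skew: "lor (R v) w = - lor v (R w)" for v w
    unfolding R_apply lor_simps skew_pd[of _ _ v] conn_skew[of _ _ _ w] conn_skew[of _ _ v]
    by (simp add: conn_skew)
  have kill: "R (g z) = 0" if g: "smooth_on S g" and eq: "\<And>e w. e \<in> dirs \<Longrightarrow> w \<in> S \<Longrightarrow> conn e w (g w) = pd e g w"
    for g
  proof -
    have d: "conn f z (pd e g z) + pd e (conn f) z (g z) = pd e (pd f g) z" if "f \<in> dirs" for e f
    proof -
      have "pd e (\<lambda>w. conn f w (g w)) z = pd e (pd f g) z"
        by (rule pd_cong[OF open_S z]) (rule eq[OF that])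
      then show ?thesis by (simp add: pd_apply[OF smooth_on_imp_differentiable[OF g z]])
    qed
    show ?thesis
      using d[of \<i> 1] d[of 1 \<i>] pd_commute[OF g open_S z] by (simp add: R_apply eq z algebra_simps)
  qed
  have R_proj: "R (proj z v) = R v" for v
    using kill[OF smooth conn_frame(1)] kill[OF smooth_pd(1)[of 1] conn_frame(2)] kill[OF smooth_pd(1)[of \<i>] conn_frame(2)]
      kill[OF smooth_dual conn_frame(3)]
    by (simp add: proj_def blinfun.bilinear_simps)
  have pd_conn_normal: "lor (pd e (conn f) z \<nu>) \<nu>' = 0"
    if n: "normal z \<nu>" "normal z \<nu>'" and ef: "e \<in> dirs" "f \<in> dirs" "e \<noteq> f" for e f \<nu> \<nu>'
  proof -
    define X where "X = (\<lambda>z. pd f dual z + lor (pd f (pd f \<sigma>) z) (dual z) *\<^sub>R pd f \<sigma> z)"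
    have "smooth_on S X" unfolding X_def
      by (intro smooth_on_add bounded_bilinear.smooth_on[OF bounded_bilinear_scaleR]
          lor.smooth_on smooth_on_pd smooth smooth_dual open_S)
    then have dX: "X differentiable (at z)" by (rule smooth_on_imp_differentiable[OF _ z])
    have "pd e (conn f) z = pd e (\<lambda>w. wedge (pd f \<sigma> w) (pd f (pd f \<sigma>) w) + wedge (X w) (\<sigma> w)) z"
      by (simp add: conn_def X_def)
    also have "\<dots> = (wedge (pd f \<sigma> z) (pd e (pd f (pd f \<sigma>)) z) + wedge (pd e (pd f \<sigma>) z) (pd f (pd f \<sigma>) z))
      + (wedge (X z) (pd e \<sigma> z) + wedge (pd e X z) (\<sigma> z))"
      using smooth_on_imp_differentiable[OF smooth_on_pd[OF smooth_pd(2)] z]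
      by (simp add: pd_add wedge.differentiable_prod wedge.pd diffs[OF z] dX)
    finally show ?thesis
      using n ef by (simp add: blinfun.bilinear_simps wedge_apply lor_simps normal_def pd_1_i[OF z ef])
  qed
  have conn2_normal: "lor (conn e z (conn f z \<nu>)) \<nu>' = 0"
    if n: "normal z \<nu>" "normal z \<nu>'" and ef: "e \<in> dirs" "f \<in> dirs" "e \<noteq> f" for e f \<nu> \<nu>'
    unfolding conn_skew conn_normal[OF n(1) ef(2)] conn_normal[OF n(2) ef(1)]
    using ef(3) null[OF z] lor_\<sigma>_pd[OF z] flat_metric[OF z ef(2,1)] lor_commute[of "pd f \<sigma> z" "\<sigma> z"]
    by (simp add: lor_simps)
  have R_normal: "lor (R \<nu>) \<nu>' = 0" if "normal z \<nu>" "normal z \<nu>'" for \<nu> \<nu>'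
    using that by (simp add: R_apply lor_simps pd_conn_normal conn2_normal)
  have "R v = 0" for v
  proof (rule lor_nondegenerate)
    fix w
    have "lor (R v) w = lor (R (proj z v)) w" by (simp only: R_proj)
    also have "\<dots> = - lor (proj z v) (R (proj z w))" by (subst R_skew) (simp only: R_proj)
    also have "\<dots> = lor (R (proj z v)) (proj z w)" by (simp only: R_skew[of "proj z v"] minus_minus)
    also have "\<dots> = 0" by (rule R_normal[OF normal_proj[OF z] normal_proj[OF z]])
    finally show "lor (R v) w = 0" .
  qed
  then have "R = 0" by (intro blinfun_eqI) simp
  then show ?thesis by (simp add: R_def)
qed

lemma isothermic_lift_subset: "open T \<Longrightarrow> T \<subseteq> S \<Longrightarrow> isothermic_lift T \<sigma>"
  using smooth_on_subset[OF smooth] null flat_metric moutard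
  by unfold_locales (auto simp: subset_iff)

end

section \<open>Parallel normal frames\<close>

text \<open>\<open>\<Phi> z\<close> is the parallel transport of the extended normal connection from \<open>0\<close> to \<open>z\<close>.\<close>

locale isothermic_frame = isothermic_lift S \<sigma> for S :: "complex set" and \<sigma> :: "complex \<Rightarrow> 'n::finite lorentz" +
  fixes r :: real and \<Phi> :: "complex \<Rightarrow> 'n lorentz \<Rightarrow>\<^sub>L 'n lorentz"
  assumes S_ball: "S = ball 0 r" and r_pos: "0 < r"
    and smooth_\<Phi>: "smooth_on S \<Phi>" and \<Phi>_0: "\<Phi> 0 = id_blinfun"
    and pd_\<Phi>: "\<And>e z. e \<in> dirs \<Longrightarrow> z \<in> S \<Longrightarrow> pd e \<Phi> z = conn e z o\<^sub>L \<Phi> z"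

lemma (in isothermic_lift) obtain_isothermic_frame:
  assumes "0 \<in> S"
  obtains r \<Phi> where "ball 0 r \<subseteq> S" "isothermic_frame (ball 0 r) \<sigma> r \<Phi>"
proof -
  obtain R where R: "0 < R" "ball 0 R \<subseteq> S" using open_S assms openE by blast
  obtain r \<Phi> where r: "0 < r" "r \<le> R" and \<Phi>: "smooth_on (ball 0 r) \<Phi>" "\<Phi> 0 = id_blinfun"
    "\<And>z. z \<in> ball 0 r \<Longrightarrow> pd 1 \<Phi> z = conn 1 z o\<^sub>L \<Phi> z" "\<And>z. z \<in> ball 0 r \<Longrightarrow> pd \<i> \<Phi> z = conn \<i> z o\<^sub>L \<Phi> z"
  proof (rule flat_linear_system_solvable[OF R(1)])
    show "smooth_on (ball 0 R) (conn 1)" "smooth_on (ball 0 R) (conn \<i>)"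
      by (rule smooth_on_subset[OF smooth_conn R(2)])+
    show "pd 1 (conn \<i>) z + (conn \<i> z o\<^sub>L conn 1 z) = pd \<i> (conn 1) z + (conn 1 z o\<^sub>L conn \<i> z)"
      if "z \<in> ball 0 R" for z
      using conn_flat R(2) that by blast
  qed blast
  have sub: "ball 0 r \<subseteq> S" using r R(2) by (meson order_trans subset_ball)
  interpret restr: isothermic_lift "ball 0 r" \<sigma> by (rule isothermic_lift_subset[OF open_ball sub])
  have "isothermic_frame (ball 0 r) \<sigma> r \<Phi>"
    by unfold_locales (use r \<Phi> in \<open>auto simp: dirs_def\<close>)
  with sub show ?thesis by (rule that)
qed

context isothermic_frame
begin

lemma convex_S: "convex S" and zero_in_S: "0 \<in> S"
  using r_pos by (simp_all add: S_ball)

lemma smooth_\<Phi>_apply: "smooth_on S (\<lambda>z. \<Phi> z w)"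
  by (rule bounded_linear.smooth_on[OF blinfun.bounded_linear_left smooth_\<Phi> open_S])

lemma pd_\<Phi>_apply: "pd e (\<lambda>z. \<Phi> z w) z = conn e z (\<Phi> z w)" if "e \<in> dirs" "z \<in> S"
  using bounded_linear.pd[OF blinfun.bounded_linear_left smooth_on_imp_differentiable[OF smooth_\<Phi> that(2)]]
  by (simp add: pd_\<Phi>[OF that])

text \<open>The connection is metric, so products of parallel sections are constant. Applied to the frame and to
\<open>\<Phi>\<close> itself, this shows that \<open>\<Phi> z\<close> is an isometry which respects the normal bundles.\<close>

lemma lor_\<Phi>_parallel:
  assumes g: "smooth_on S g" "\<And>e z. e \<in> dirs \<Longrightarrow> z \<in> S \<Longrightarrow> pd e g z = conn e z (g z)" and z: "z \<in> S"
  shows "lor (\<Phi> z w) (g z) = lor w (g 0)"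
proof -
  have "pd e (\<lambda>z. lor (\<Phi> z w) (g z)) y = 0" if "e \<in> dirs" "y \<in> S" for e y
    using smooth_on_imp_differentiable[OF smooth_\<Phi>_apply that(2)] smooth_on_imp_differentiable[OF g(1) that(2)]
    by (simp add: lor.pd pd_\<Phi>_apply that g(2) conn_skew[of _ _ "\<Phi> y w"])
  then have "lor (\<Phi> z w) (g z) = lor (\<Phi> 0 w) (g 0)"
    by (intro smooth_on_zero_pd_const[OF _ open_S convex_S z zero_in_S] lor.smooth_on smooth_\<Phi>_apply g open_S) auto
  then show ?thesis by (simp add: \<Phi>_0)
qed

lemma lor_\<Phi>_\<Phi>: "lor (\<Phi> z v) (\<Phi> z w) = lor v w" if "z \<in> S"
  using lor_\<Phi>_parallel[OF smooth_\<Phi>_apply pd_\<Phi>_apply that] by (simp add: \<Phi>_0)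

lemma lor_\<Phi>_frame:
  assumes "z \<in> S"
  shows "lor (\<Phi> z w) (\<sigma> z) = lor w (\<sigma> 0)" "e \<in> dirs \<Longrightarrow> lor (\<Phi> z w) (pd e \<sigma> z) = lor w (pd e \<sigma> 0)"
    "lor (\<Phi> z w) (dual z) = lor w (dual 0)"
  using lor_\<Phi>_parallel[OF smooth conn_frame(1)[symmetric] assms]
    lor_\<Phi>_parallel[OF smooth_pd(1) conn_frame(2)[symmetric] assms]
    lor_\<Phi>_parallel[OF smooth_dual conn_frame(3)[symmetric] assms] by auto

lemma normal_\<Phi>: "normal z (\<Phi> z w) \<longleftrightarrow> normal 0 w" if "z \<in> S"
  using lor_\<Phi>_frame[OF that] by (simp add: normal_def lor_commute[of _ "\<Phi> z w"] lor_commute[of _ w])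

lemma surj_\<Phi>: "surj (blinfun_apply (\<Phi> z))" if z: "z \<in> S"
proof (rule linear_injective_imp_surjective)
  show "linear (blinfun_apply (\<Phi> z))" by (rule bounded_linear.linear[OF blinfun.bounded_linear_right])
  show "inj (blinfun_apply (\<Phi> z))"
  proof (rule injI)
    fix x y assume eq: "\<Phi> z x = \<Phi> z y"
    have "x - y = 0"
    proof (rule lor_nondegenerate)
      show "lor (x - y) v = 0" for v
        using lor_\<Phi>_\<Phi>[OF z, of "x - y" v] eq by (simp add: blinfun.diff_right lor.zero_left)
    qed
    then show "x = y" by simp
  qed
qed (rule refl)

text \<open>Projecting the initial value makes \<open>parallel b\<close> a parallel section of the normal bundle for every \<open>b\<close>,
so the standard basis can be used in place of a basis of the normal space at \<open>0\<close>.\<close>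

definition "parallel b = (\<lambda>z. \<Phi> z (proj 0 b))"

lemma smooth_parallel: "smooth_on S (parallel b)"
  unfolding parallel_def by (rule smooth_\<Phi>_apply)

lemma pd_parallel: "e \<in> dirs \<Longrightarrow> z \<in> S \<Longrightarrow> pd e (parallel b) z = conn e z (parallel b z)"
  unfolding parallel_def by (rule pd_\<Phi>_apply)

lemma normal_parallel: "z \<in> S \<Longrightarrow> normal z (parallel b z)"
  by (simp add: parallel_def normal_\<Phi> normal_proj zero_in_S)

lemma normal_obtain_parallel:
  assumes "z \<in> S" "normal z \<nu>"
  obtains b where "\<nu> = parallel b z"
proof -
  obtain b where b: "\<nu> = \<Phi> z b" using surj_\<Phi>[OF assms(1)] by blast
  then have "normal 0 b" using assms normal_\<Phi> by simp
  then show ?thesis using b that[of b] by (simp add: parallel_def proj_normal)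
qed

lemma linear_parallel: "linear (\<lambda>b. parallel b z)"
  unfolding parallel_def
  using linear_compose[OF linear_proj bounded_linear.linear[OF blinfun.bounded_linear_right]]
  by (simp add: o_def)

text \<open>The sections \<open>parallel b\<close> and \<open>parallel (flip b)\<close>, for \<open>b\<close> in the standard basis, behave like dual bases
of the normal bundle although they are linearly dependent.\<close>

lemma sum_parallel_dual_basis:
  assumes z: "z \<in> S"
  shows "(\<Sum>b\<in>Basis. lor X (parallel b z) * lor (parallel (flip b) z) (parallel c z)) = lor X (parallel c z)"
proof -
  have "lor (parallel (flip b) z) (parallel c z) = lor (flip b) (proj 0 c)" for b
    by (simp add: parallel_def lor_\<Phi>_\<Phi>[OF z] lor_proj normal_proj zero_in_S)
  then have "(\<Sum>b\<in>Basis. lor X (parallel b z) * lor (parallel (flip b) z) (parallel c z))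
    = lor X (\<Sum>b\<in>Basis. lor (flip b) (proj 0 c) *\<^sub>R parallel b z)"
    by (simp add: lor.sum_right lor_simps mult.commute)
  also have "(\<Sum>b\<in>Basis. lor (flip b) (proj 0 c) *\<^sub>R parallel b z) = parallel (\<Sum>b\<in>Basis. lor (flip b) (proj 0 c) *\<^sub>R b) z"
    by (simp add: linear_sum[OF linear_parallel] linear_scale[OF linear_parallel])
  also have "\<dots> = parallel c z"
    by (simp add: sum_Basis_lor_flip) (simp add: parallel_def proj_normal normal_proj zero_in_S)
  finally show ?thesis .
qed

text \<open>The derivative of a parallel normal section in direction \<open>e\<close> is a combination of \<open>\<sigma>\<close> and \<open>pd e \<sigma>\<close>.\<close>

lemma pd_parallel_tangential:
  assumes "z \<in> S" "e \<in> dirs"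
  shows "normal z \<nu> \<Longrightarrow> lor (pd e (parallel b) z) \<nu> = 0"
    "lor X (\<sigma> z) = 0 \<Longrightarrow> lor X (pd e \<sigma> z) = 0 \<Longrightarrow> lor X (pd e (parallel b) z) = 0"
  using assms(2)
  by (simp_all add: pd_parallel[OF assms(2,1)] conn_normal[OF normal_parallel[OF assms(1)] assms(2)] lor_simps normal_def)

section \<open>The recursion for the coefficients\<close>

text \<open>With \<open>\<eta> = \<sigma> \<and> (\<sigma>\<^sub>x dx - \<sigma>\<^sub>y dy)\<close>, the equation \<open>dp = - \<eta> p'\<close> for consecutive coefficients
\<open>p\<close>, \<open>p'\<close> sees of \<open>p'\<close> only the function \<open>g = (\<sigma>, p')\<close> and the products \<open>(\<sigma>\<^sub>x, p')\<close>, \<open>(\<sigma>\<^sub>y, p')\<close>,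
which are necessarily \<open>g\<^sub>x\<close> and \<open>g\<^sub>y\<close>. So it splits into \<open>potential p g\<close> and \<open>jet p' g\<close>, and the
integrability condition of \<open>potential p g\<close> is that \<open>g\<close> solves the Moutard equation of \<open>\<sigma>\<close>.\<close>

definition "moutard_solution f \<longleftrightarrow> smooth_on S f \<and> (\<forall>z\<in>S. pd 1 (pd \<i> f) z = u z * f z)"

definition "potential p g \<longleftrightarrow> (\<forall>z\<in>S.
  pd 1 p z = pd 1 g z *\<^sub>R \<sigma> z - g z *\<^sub>R pd 1 \<sigma> z \<and>
  pd \<i> p z = g z *\<^sub>R pd \<i> \<sigma> z - pd \<i> g z *\<^sub>R \<sigma> z)"

definition "jet p f \<longleftrightarrow> (\<forall>z\<in>S. lor (\<sigma> z) (p z) = f z \<and> (\<forall>e\<in>dirs. lor (pd e \<sigma> z) (p z) = pd e f z))"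

text \<open>The jet of \<open>p\<close> fixes the products of its derivatives with \<open>\<sigma>\<close>, \<open>\<sigma>\<^sub>x\<close>, \<open>\<sigma>\<^sub>y\<close>. The mixed ones
vanish because \<open>f\<close> and \<open>\<sigma>\<close> solve the same Moutard equation.\<close>

lemma jet_pd:
  assumes p: "smooth_on S p" and f: "moutard_solution f" and "jet p f" and z: "z \<in> S" and e: "e \<in> dirs"
  shows "lor (\<sigma> z) (pd e p z) = 0"
    "lor (pd e \<sigma> z) (pd e p z) = pd e (pd e f) z - lor (pd e (pd e \<sigma>) z) (p z)"
    "d \<in> dirs \<Longrightarrow> d \<noteq> e \<Longrightarrow> lor (pd d \<sigma> z) (pd e p z) = 0"
proof -
  have dp: "p differentiable (at z)" by (rule smooth_on_imp_differentiable[OF p z])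
  have j: "\<And>w. w \<in> S \<Longrightarrow> lor (\<sigma> w) (p w) = f w" "\<And>w d. w \<in> S \<Longrightarrow> d \<in> dirs \<Longrightarrow> lor (pd d \<sigma> w) (p w) = pd d f w"
    using \<open>jet p f\<close> by (auto simp: jet_def)
  have "pd e (\<lambda>w. lor (\<sigma> w) (p w)) z = pd e f z" by (rule pd_cong[OF open_S z j(1)])
  then show "lor (\<sigma> z) (pd e p z) = 0"
    using j(2)[OF z e] by (simp add: lor.pd[OF diffs(1)[OF z] dp])
  have jd: "lor (pd d \<sigma> z) (pd e p z) = pd e (pd d f) z - lor (pd e (pd d \<sigma>) z) (p z)" if "d \<in> dirs" for d
  proof -
    have "pd e (\<lambda>w. lor (pd d \<sigma> w) (p w)) z = pd e (pd d f) z"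
      by (rule pd_cong[OF open_S z]) (rule j(2)[OF _ that])
    then show ?thesis by (simp add: lor.pd[OF diffs(2)[OF z] dp])
  qed
  show "lor (pd e \<sigma> z) (pd e p z) = pd e (pd e f) z - lor (pd e (pd e \<sigma>) z) (p z)" by (rule jd[OF e])
  show "lor (pd d \<sigma> z) (pd e p z) = 0" if d: "d \<in> dirs" "d \<noteq> e"
  proof -
    have "pd 1 (pd \<i> f) z = u z * f z" "pd \<i> (pd 1 f) z = u z * f z"
      using f z pd_commute[OF _ open_S z, of f] by (auto simp: moutard_solution_def)
    then have "pd e (pd d f) z = u z * f z" using d e by (auto simp: dirs_def)
    then show ?thesis
      using jd[OF d(1)] d(2) by (simp add: pd_1_i[OF z e d(1)] lor_simps j(1)[OF z])
  qed
qed

lemma smooth_scaleR: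
  "smooth_on S a \<Longrightarrow> smooth_on S b \<Longrightarrow> smooth_on S (\<lambda>z. a z *\<^sub>R b z)" for a :: "complex \<Rightarrow> real"
  by (rule bounded_bilinear.smooth_on[OF bounded_bilinear_scaleR _ _ open_S])

text \<open>Suppose \<open>p\<close> has the jet of \<open>f\<close>, the product with the Laplacian of \<open>\<sigma>\<close> matches, and the derivatives
of \<open>p\<close> have no normal component. Then \<open>p\<^sub>x\<close> and \<open>p\<^sub>y\<close> are combinations of \<open>\<sigma>\<^sub>x\<close>, \<open>\<sigma>\<close> and of
\<open>\<sigma>\<^sub>y\<close>, \<open>\<sigma>\<close>, and the Laplacian condition makes the coefficients of \<open>\<sigma>\<^sub>x\<close> and \<open>\<sigma>\<^sub>y\<close> opposite: they
are \<open>- g\<close> and \<open>g\<close>. Equality of the mixed derivatives of \<open>p\<close> does the rest: it identifies the two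
remaining coefficients with derivatives of \<open>g\<close> and yields the Moutard equation for \<open>g\<close>.\<close>

lemma potential_of_jet:
  assumes p: "smooth_on S p" and f: "moutard_solution f" and j: "jet p f"
    and lapl: "\<And>z. z \<in> S \<Longrightarrow> lor (lap z) (p z) = pd 1 (pd 1 f) z + pd \<i> (pd \<i> f) z"
    and tang: "\<And>z e \<nu>. z \<in> S \<Longrightarrow> e \<in> dirs \<Longrightarrow> normal z \<nu> \<Longrightarrow> lor (pd e p z) \<nu> = 0"
  obtains g where "moutard_solution g" "potential p g"
proof -
  define g where "g = (\<lambda>z. lor (pd 1 (pd 1 \<sigma>) z) (p z) - pd 1 (pd 1 f) z)"
  define a where "a e = (\<lambda>z. lor (pd e p z) (dual z))" for e
  have sf: "smooth_on S f" using f by (simp add: moutard_solution_def)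
  have sg: "smooth_on S g" unfolding g_def
    by (intro smooth_on_diff lor.smooth_on smooth_pd smooth_on_pd sf p open_S)
  have sa: "smooth_on S (a e)" for e unfolding a_def
    by (intro lor.smooth_on smooth_on_pd smooth_dual p open_S)
  note jp = jet_pd[OF p f j]
  have X: "pd 1 p z = - (g z *\<^sub>R pd 1 \<sigma> z) - a 1 z *\<^sub>R \<sigma> z" "pd \<i> p z = g z *\<^sub>R pd \<i> \<sigma> z - a \<i> z *\<^sub>R \<sigma> z"
    if z: "z \<in> S" for z
  proof -
    have gi: "pd \<i> (pd \<i> f) z - lor (pd \<i> (pd \<i> \<sigma>) z) (p z) = g z"
      using lapl[OF z] by (simp add: g_def lor_simps)
    have exp: "pd e p z = lor (pd 1 \<sigma> z) (pd e p z) *\<^sub>R pd 1 \<sigma> z + lor (pd \<i> \<sigma> z) (pd e p z) *\<^sub>R pd \<i> \<sigma> z - a e z *\<^sub>R \<sigma> z"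
      if "e \<in> dirs" for e
      using tangential_expand[OF z _ tang[OF z that]] jp(1)[OF z that]
      by (simp add: lor_commute[of "pd e p z" "\<sigma> z"] lor_commute[of "pd e p z" "pd _ \<sigma> z"] a_def)
    show "pd 1 p z = - (g z *\<^sub>R pd 1 \<sigma> z) - a 1 z *\<^sub>R \<sigma> z"
      by (subst exp) (simp_all add: jp[OF z] g_def algebra_simps)
    show "pd \<i> p z = g z *\<^sub>R pd \<i> \<sigma> z - a \<i> z *\<^sub>R \<sigma> z"
      by (subst exp) (simp_all add: jp[OF z] gi)
  qed
  have eq: "- (g z *\<^sub>R pd \<i> (pd 1 \<sigma>) z + pd \<i> g z *\<^sub>R pd 1 \<sigma> z) - (a 1 z *\<^sub>R pd \<i> \<sigma> z + pd \<i> (a 1) z *\<^sub>R \<sigma> z)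
    = (g z *\<^sub>R pd 1 (pd \<i> \<sigma>) z + pd 1 g z *\<^sub>R pd \<i> \<sigma> z) - (a \<i> z *\<^sub>R pd 1 \<sigma> z + pd 1 (a \<i>) z *\<^sub>R \<sigma> z)"
    if z: "z \<in> S" for z
  proof -
    note D = smooth_on_imp_differentiable[OF sg z] smooth_on_imp_differentiable[OF sa z]
    note sD = smooth_on_imp_differentiable[OF smooth_scaleR z]
    note pr = bounded_bilinear.pd[OF bounded_bilinear_scaleR]
    have "pd \<i> (pd 1 p) z = pd \<i> (\<lambda>z. - (g z *\<^sub>R pd 1 \<sigma> z) - a 1 z *\<^sub>R \<sigma> z) z"
      by (rule pd_cong[OF open_S z X(1)])
    also have "\<dots> = - (g z *\<^sub>R pd \<i> (pd 1 \<sigma>) z + pd \<i> g z *\<^sub>R pd 1 \<sigma> z) - (a 1 z *\<^sub>R pd \<i> \<sigma> z + pd \<i> (a 1) z *\<^sub>R \<sigma> z)"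
      by (subst pd_diff) (auto intro!: sD smooth_on_imp_differentiable[OF smooth_on_minus[OF smooth_scaleR open_S] z]
          simp: pd_minus[OF sD] pr[OF D(1) diffs(2)[OF z]] pr[OF D(2) diffs(1)[OF z]] sg sa smooth smooth_pd)
    finally have 1: "pd \<i> (pd 1 p) z = \<dots>" .
    have "pd 1 (pd \<i> p) z = pd 1 (\<lambda>z. g z *\<^sub>R pd \<i> \<sigma> z - a \<i> z *\<^sub>R \<sigma> z) z"
      by (rule pd_cong[OF open_S z X(2)])
    also have "\<dots> = (g z *\<^sub>R pd 1 (pd \<i> \<sigma>) z + pd 1 g z *\<^sub>R pd \<i> \<sigma> z) - (a \<i> z *\<^sub>R pd 1 \<sigma> z + pd 1 (a \<i>) z *\<^sub>R \<sigma> z)"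
      by (subst pd_diff) (auto intro!: sD simp: pr[OF D(1) diffs(2)[OF z]] pr[OF D(2) diffs(1)[OF z]] sg sa smooth smooth_pd)
    finally show ?thesis using 1 pd_commute[OF p open_S z] by simp
  qed
  \<comment> \<open>Pairing the integrability condition with the frame isolates its components.\<close>
  have a: "a \<i> z = pd \<i> g z" "a 1 z = - pd 1 g z" "2 * (u z * g z) = pd 1 (a \<i>) z - pd \<i> (a 1) z"
    if z: "z \<in> S" for z
  proof -
    note fp = frame_products[OF z] pd_1_i[OF z]
    show "a \<i> z = pd \<i> g z"
      using arg_cong[OF eq[OF z], of "\<lambda>X. lor X (pd 1 \<sigma> z)"] by (simp add: lor_simps fp)
    show "a 1 z = - pd 1 g z"
      using arg_cong[OF eq[OF z], of "\<lambda>X. lor X (pd \<i> \<sigma> z)"] by (simp add: lor_simps fp)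
    show "2 * (u z * g z) = pd 1 (a \<i>) z - pd \<i> (a 1) z"
      using arg_cong[OF eq[OF z], of "\<lambda>X. lor X (dual z)"] by (simp add: lor_simps fp mult.commute[of "u z"])
  qed
  show ?thesis
  proof
    show "potential p g" using X a(1,2) by (simp add: potential_def algebra_simps)
    have "pd 1 (pd \<i> g) z = u z * g z" if z: "z \<in> S" for z
    proof -
      have "pd 1 (a \<i>) z = pd 1 (pd \<i> g) z" by (rule pd_cong[OF open_S z a(1)])
      moreover have "pd \<i> (a 1) z = pd \<i> (\<lambda>z. - pd 1 g z) z" by (rule pd_cong[OF open_S z a(2)])
      moreover have "\<dots> = - pd \<i> (pd 1 g) z"
        by (rule pd_minus[OF smooth_on_imp_differentiable[OF smooth_on_pd[OF sg] z]])
      ultimately show ?thesis using a(3)[OF z] pd_commute[OF sg open_S z] by simp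
    qed
    then show "moutard_solution g" using sg by (simp add: moutard_solution_def)
  qed
qed

text \<open>One step of the recursion. The jet of \<open>f\<close> and the Laplacian condition prescribe the frame components of
\<open>p\<close>, collected in \<open>q\<close>. A normal section \<open>\<nu>\<close> has to be added that cancels the normal part of \<open>dq\<close>. In
terms of the parallel sections this is \<open>dy\<^sub>b = - (dq, parallel b)\<close>, a closed form because \<open>q\<^sub>x\<close> is
orthogonal to \<open>\<sigma>\<close>, \<open>\<sigma>\<^sub>y\<close> and \<open>q\<^sub>y\<close> to \<open>\<sigma>\<close>, \<open>\<sigma>\<^sub>x\<close>. The potentials \<open>y\<^sub>b\<close> exist on the whole
disc, so that the domain does not shrink as the recursion proceeds.\<close>

lemma jet_extension:
  assumes f: "moutard_solution f"
  obtains p g where "smooth_on S p" "jet p f" "moutard_solution g" "potential p g"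
proof -
  have sf: "smooth_on S f" using f by (simp add: moutard_solution_def)
  \<comment> \<open>The value of \<open>(dual, p)\<close> for which \<open>(\<sigma>\<^sub>x\<^sub>x + \<sigma>\<^sub>y\<^sub>y, p) = f\<^sub>x\<^sub>x + f\<^sub>y\<^sub>y\<close>.\<close>
  define c where "c = (\<lambda>z. (1/2) *\<^sub>R (pd 1 (pd 1 f) z + pd \<i> (pd \<i> f) z) + (1/8) *\<^sub>R (lor (lap z) (lap z) *\<^sub>R f z))"
  define q where "q = (\<lambda>z. pd 1 f z *\<^sub>R pd 1 \<sigma> z + pd \<i> f z *\<^sub>R pd \<i> \<sigma> z - f z *\<^sub>R dual z - c z *\<^sub>R \<sigma> z)"
  have sc: "smooth_on S c" unfolding c_def
    by (intro smooth_on_add bounded_linear.smooth_on[OF bounded_linear_scaleR_right] smooth_scaleR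
        lor.smooth_on smooth_pd smooth_on_pd sf open_S)
  have sq: "smooth_on S q" unfolding q_def
    by (intro smooth_on_diff smooth_on_add smooth_scaleR smooth_on_pd sf sc smooth_dual smooth open_S)
  have jq: "jet q f"
    unfolding jet_def q_def using frame_products by (auto simp: lor_simps dirs_def)
  have dual_q: "lor (dual z) (q z) = c z" if "z \<in> S" for z
    using frame_products[OF that] by (simp add: q_def lor_simps)
  have closed: "pd 1 (\<lambda>z. - lor (pd \<i> q z) (parallel b z)) z = pd \<i> (\<lambda>z. - lor (pd 1 q z) (parallel b z)) z"
    if z: "z \<in> S" for z b
  proof -
    have d: "pd e q differentiable (at z)" "parallel b differentiable (at z)" for e
      by (rule smooth_on_imp_differentiable[OF smooth_on_pd[OF sq] z],
          rule smooth_on_imp_differentiable[OF smooth_parallel z])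
    have cross: "lor (pd e q z) (pd d (parallel b) z) = 0" if "e \<in> dirs" "d \<in> dirs" "d \<noteq> e" for e d
      using jet_pd[OF sq f jq z that(1)] that
      by (intro pd_parallel_tangential(2)[OF z that(2)]) (simp_all add: lor_commute[of "pd e q z"])
    have "pd d (\<lambda>z. - lor (pd e q z) (parallel b z)) z = - lor (pd d (pd e q) z) (parallel b z)"
      if "e \<in> dirs" "d \<in> dirs" "d \<noteq> e" for e d
      using cross[OF that] by (simp add: pd_minus[OF lor.differentiable_prod[OF d]] lor.pd[OF d])
    then show ?thesis using pd_commute[OF sq open_S z] by simp
  qed
  have "\<exists>y. smooth_on S y \<and> (\<forall>e\<in>dirs. \<forall>z\<in>S. pd e y z = - lor (pd e q z) (parallel b z))" for b
  proof (rule poincare_lemma_disc[of r "\<lambda>z. - lor (pd 1 q z) (parallel b z)" "\<lambda>z. - lor (pd \<i> q z) (parallel b z)", folded S_ball])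
    show "smooth_on S (\<lambda>z. - lor (pd 1 q z) (parallel b z))" "smooth_on S (\<lambda>z. - lor (pd \<i> q z) (parallel b z))"
      by (intro smooth_on_minus lor.smooth_on smooth_on_pd sq smooth_parallel open_S)+
  qed (use closed in \<open>auto simp: dirs_def\<close>)
  then obtain y where y: "\<And>b. smooth_on S (y b)"
    "\<And>b e z. e \<in> dirs \<Longrightarrow> z \<in> S \<Longrightarrow> pd e (y b) z = - lor (pd e q z) (parallel b z)"
    by metis
  define \<nu> where "\<nu> = (\<lambda>z. \<Sum>b\<in>Basis. y b z *\<^sub>R parallel (flip b) z)"
  have s\<nu>: "smooth_on S \<nu>" unfolding \<nu>_def
    by (intro smooth_on_sum smooth_scaleR y smooth_parallel open_S)
  have n\<nu>: "normal z (\<nu> z)" if z: "z \<in> S" for z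
    using normal_parallel[OF z] by (simp add: normal_def \<nu>_def lor.sum_right lor_simps)
  define p where "p = (\<lambda>z. q z + \<nu> z)"
  have sp: "smooth_on S p" unfolding p_def by (intro smooth_on_add sq s\<nu> open_S)
  have jp: "jet p f"
    using jq n\<nu> by (auto simp: jet_def p_def lor_simps normal_def)
  have lapl: "lor (lap z) (p z) = pd 1 (pd 1 f) z + pd \<i> (pd \<i> f) z" if z: "z \<in> S" for z
  proof -
    have "lor (dual z) (p z) = c z" using dual_q[OF z] n\<nu>[OF z] by (simp add: p_def lor_simps normal_def)
    moreover have "lor (\<sigma> z) (p z) = f z" using jp z by (simp add: jet_def)
    ultimately show ?thesis using lor_dual[of z "p z"] by (simp add: c_def)
  qed
  have tang: "lor (pd e p z) \<nu>' = 0" if z: "z \<in> S" and e: "e \<in> dirs" and \<nu>': "normal z \<nu>'" for z e \<nu>'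
  proof -
    obtain b' where b': "\<nu>' = parallel b' z" using normal_obtain_parallel[OF z \<nu>'] .
    have d: "y b differentiable (at z)" "parallel b differentiable (at z)" "q differentiable (at z)" "\<nu> differentiable (at z)" for b
      using smooth_on_imp_differentiable[OF _ z] y(1) smooth_parallel sq s\<nu> by blast+
    have "pd e \<nu> z = (\<Sum>b\<in>Basis. pd e (\<lambda>z. y b z *\<^sub>R parallel (flip b) z) z)"
      unfolding \<nu>_def by (rule pd_sum) (rule bounded_bilinear.differentiable_prod[OF bounded_bilinear_scaleR d(1,2)])
    also have "\<dots> = (\<Sum>b\<in>Basis. y b z *\<^sub>R pd e (parallel (flip b)) z - lor (pd e q z) (parallel b z) *\<^sub>R parallel (flip b) z)"
      by (simp add: bounded_bilinear.pd[OF bounded_bilinear_scaleR d(1,2)] y(2)[OF e z])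
    finally have "lor (pd e \<nu> z) \<nu>' = - (\<Sum>b\<in>Basis. lor (pd e q z) (parallel b z) * lor (parallel (flip b) z) \<nu>')"
      using pd_parallel_tangential(1)[OF z e \<nu>'] by (simp add: lor.sum_left lor_simps sum_negf)
    then show ?thesis
      using sum_parallel_dual_basis[OF z, of "pd e q z" b'] by (simp add: p_def pd_add[OF d(3,4)] lor_simps b')
  qed
  from potential_of_jet[OF sp f jp lapl tang] that[OF sp jp] show ?thesis by blast
qed

text \<open>A parallel normal section has the jet of the zero function, so it can serve as the constant coefficient:
it is annihilated by \<open>\<eta>\<close>, and the recursion starts from its potential.\<close>

lemma formal_solution:
  assumes w: "normal 0 w" "w \<noteq> 0"
  obtains P :: "nat \<Rightarrow> complex \<Rightarrow> 'n lorentz" where "\<And>k. smooth_on S (P k)" "P 0 0 \<noteq> 0"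
    "\<And>z. z \<in> S \<Longrightarrow> lor (\<sigma> z) (P 0 z) = 0" "\<And>z e. z \<in> S \<Longrightarrow> e \<in> dirs \<Longrightarrow> lor (pd e \<sigma> z) (P 0 z) = 0"
    "\<And>k z. z \<in> S \<Longrightarrow> pd 1 (P k) z = - wedge (\<sigma> z) (pd 1 \<sigma> z) (P (Suc k) z)"
    "\<And>k z. z \<in> S \<Longrightarrow> pd \<i> (P k) z = wedge (\<sigma> z) (pd \<i> \<sigma> z) (P (Suc k) z)"
proof -
  define p0 where "p0 = parallel w"
  have zero: "moutard_solution (\<lambda>z. 0)"
    by (auto simp: moutard_solution_def smooth_on_const pd_const[abs_def])
  have n0: "normal z (p0 z)" if "z \<in> S" for z unfolding p0_def by (rule normal_parallel[OF that])
  have j0: "jet p0 (\<lambda>z. 0)"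
    using n0 by (auto simp: jet_def normal_def pd_const)
  have lap0: "lor (lap z) (p0 z) = 0" if z: "z \<in> S" for z
  proof -
    have "lor (dual z) (p0 z) = 0" "lor (\<sigma> z) (p0 z) = 0"
      using n0[OF z] by (simp_all add: normal_def)
    then show ?thesis using lor_dual[of z "p0 z"] by simp
  qed
  obtain g0 where g0: "moutard_solution g0" "potential p0 g0"
  proof (rule potential_of_jet[OF _ zero j0])
    show "smooth_on S p0" unfolding p0_def by (rule smooth_parallel)
    show "lor (lap z) (p0 z) = pd 1 (pd 1 (\<lambda>z. 0)) z + pd \<i> (pd \<i> (\<lambda>z. 0)) z" if "z \<in> S" for z
      using lap0[OF that] by (simp add: pd_const[abs_def])
    show "lor (pd e p0 z) \<nu> = 0" if "z \<in> S" "e \<in> dirs" "normal z \<nu>" for z e \<nu>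
      unfolding p0_def by (rule pd_parallel_tangential(1)[OF that])
  qed blast
  define Q where "Q k x \<longleftrightarrow> smooth_on S (fst x) \<and> moutard_solution (snd x) \<and> potential (fst x) (snd x) \<and> (k = 0 \<longrightarrow> fst x = p0)"
    for k :: nat and x :: "(complex \<Rightarrow> 'n lorentz) \<times> (complex \<Rightarrow> real)"
  have "\<exists>x. \<forall>k. Q k (x k) \<and> jet (fst (x (Suc k))) (snd (x k))"
  proof (rule dependent_nat_choice)
    show "\<exists>x. Q 0 x" using g0 smooth_parallel[of w] by (intro exI[of _ "(p0, g0)"]) (simp add: Q_def p0_def)
    show "\<exists>x'. Q (Suc k) x' \<and> jet (fst x') (snd x)" if "Q k x" for k x
    proof -
      from that have "moutard_solution (snd x)" by (simp add: Q_def)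
      then obtain p g where "smooth_on S p" "jet p (snd x)" "moutard_solution g" "potential p g"
        by (rule jet_extension)
      then show ?thesis by (intro exI[of _ "(p, g)"]) (simp add: Q_def)
    qed
  qed
  then obtain x where x: "\<And>k. Q k (x k)" "\<And>k. jet (fst (x (Suc k))) (snd (x k))" by blast
  have x0: "fst (x 0) = p0" using x(1)[of 0] by (simp add: Q_def)
  have pot: "potential (fst (x k)) (snd (x k))" for k using x(1)[of k] by (simp add: Q_def)
  show ?thesis
  proof (rule that[of "\<lambda>k. fst (x k)"])
    show "smooth_on S (fst (x k))" for k using x(1)[of k] by (simp add: Q_def)
    show "fst (x 0) 0 \<noteq> 0" using w by (simp add: x0 p0_def parallel_def proj_normal \<Phi>_0)
    show "lor (\<sigma> z) (fst (x 0) z) = 0" "e \<in> dirs \<Longrightarrow> lor (pd e \<sigma> z) (fst (x 0) z) = 0" if "z \<in> S" for z e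
      using n0[OF that] by (auto simp: x0 normal_def)
    show "pd 1 (fst (x k)) z = - wedge (\<sigma> z) (pd 1 \<sigma> z) (fst (x (Suc k)) z)"
      "pd \<i> (fst (x k)) z = wedge (\<sigma> z) (pd \<i> \<sigma> z) (fst (x (Suc k)) z)" if "z \<in> S" for k z
      using pot[of k] x(2)[of k] that by (auto simp: potential_def jet_def wedge_apply)
  qed
qed

end

section \<open>The holomorphic quadratic differential and adapted coordinates\<close>

text \<open>The factor is \<open>\<rho>\<close> to the power \<open>-1/2\<close>. Derivatives of the factor only add multiples of the null
vector \<open>\<tau>\<close>, which is orthogonal to its own derivatives; so they do not affect the metric.\<close>

lemma flat_lift_normalise:
  assumes S: "open S" and smooth: "smooth_on S \<tau>" and null: "\<And>z. z \<in> S \<Longrightarrow> lor (\<tau> z) (\<tau> z) = 0"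
    and conformal: "\<And>z. z \<in> S \<Longrightarrow> \<exists>\<rho>>0. \<forall>v w. lor (pd v \<tau> z) (pd w \<tau> z) = \<rho> * (v \<bullet> w)"
  obtains \<mu> where "\<And>z. z \<in> S \<Longrightarrow> 0 < \<mu> z" "flat_lift S (\<lambda>z. \<mu> z *\<^sub>R \<tau> z)"
    "\<And>z. z \<in> S \<Longrightarrow> (\<mu> z)\<^sup>2 * lor (pd 1 \<tau> z) (pd 1 \<tau> z) = 1"
    "\<And>z v. z \<in> S \<Longrightarrow> \<exists>c. pd v (\<lambda>z. \<mu> z *\<^sub>R \<tau> z) z = \<mu> z *\<^sub>R pd v \<tau> z + c *\<^sub>R \<tau> z"
proof -
  define \<rho> where "\<rho> z = lor (pd 1 \<tau> z) (pd 1 \<tau> z)" for z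
  define \<mu> where "\<mu> z = \<rho> z powr (-1/2)" for z
  have conf: "\<rho> z > 0" "\<And>v w. lor (pd v \<tau> z) (pd w \<tau> z) = \<rho> z * (v \<bullet> w)" if "z \<in> S" for z
    using conformal[OF that] by (auto simp: \<rho>_def)
  have s\<rho>: "smooth_on S \<rho>" unfolding \<rho>_def[abs_def] by (intro lor.smooth_on smooth_on_pd smooth S)
  have s\<mu>: "smooth_on S \<mu>" unfolding \<mu>_def[abs_def] by (rule smooth_on_powr[OF s\<rho> S conf(1)])
  have pos: "0 < \<mu> z" if "z \<in> S" for z using conf(1)[OF that] by (simp add: \<mu>_def)
  have sq: "(\<mu> z)\<^sup>2 * \<rho> z = 1" if "z \<in> S" for z
  proof -
    have "(\<mu> z)\<^sup>2 = \<rho> z powr (-1)"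
      by (simp add: \<mu>_def power2_eq_square flip: powr_add)
    then show ?thesis using conf(1)[OF that] by (simp add: powr_minus)
  qed
  have d: "\<tau> differentiable (at z)" "\<mu> differentiable (at z)" if "z \<in> S" for z
    using smooth_on_imp_differentiable[OF smooth that] smooth_on_imp_differentiable[OF s\<mu> that] .
  have pd: "pd v (\<lambda>z. \<mu> z *\<^sub>R \<tau> z) z = \<mu> z *\<^sub>R pd v \<tau> z + pd v \<mu> z *\<^sub>R \<tau> z" if "z \<in> S" for v z
    by (rule bounded_bilinear.pd[OF bounded_bilinear_scaleR d(2)[OF that] d(1)[OF that]])
  have tan: "lor (\<tau> z) (pd v \<tau> z) = 0" if "z \<in> S" for v z
  proof -
    have "lor (pd v \<tau> z) (\<tau> z) = - lor (\<tau> z) (pd v \<tau> z)"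
      by (rule pd_lor_eq_const[OF S that d(1)[OF that] d(1)[OF that] null])
    then show ?thesis by (simp add: lor_commute)
  qed
  have "flat_lift S (\<lambda>z. \<mu> z *\<^sub>R \<tau> z)"
  proof
    show "smooth_on S (\<lambda>z. \<mu> z *\<^sub>R \<tau> z)"
      by (rule bounded_bilinear.smooth_on[OF bounded_bilinear_scaleR s\<mu> smooth S])
    show "lor (pd e (\<lambda>z. \<mu> z *\<^sub>R \<tau> z) z) (pd f (\<lambda>z. \<mu> z *\<^sub>R \<tau> z) z) = (if e = f then 1 else 0)"
      if z: "z \<in> S" and "e \<in> dirs" "f \<in> dirs" for z e f
    proof -
      have "lor (pd e (\<lambda>z. \<mu> z *\<^sub>R \<tau> z) z) (pd f (\<lambda>z. \<mu> z *\<^sub>R \<tau> z) z) = (\<mu> z)\<^sup>2 * \<rho> z * (e \<bullet> f)"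
        using tan[OF z] null[OF z] lor_commute[of "pd e \<tau> z" "\<tau> z"]
        by (simp add: pd[OF z] lor_simps conf(2)[OF z] power2_eq_square)
      also have "\<dots> = e \<bullet> f" by (simp add: sq[OF z])
      also have "\<dots> = (if e = f then 1 else 0)" using that(2,3) by (auto simp: dirs_def inner_complex_def)
      finally show ?thesis .
    qed
  qed (use S null in \<open>auto simp: lor_simps\<close>)
  with pos sq pd show ?thesis by (intro that[of \<mu>]) (auto simp: \<rho>_def)
qed

context flat_lift
begin

text \<open>Write \<open>\<eta> = \<sigma> \<and> \<omega>\<close>; the ambiguity of \<open>\<omega>\<close> by multiples of \<open>\<sigma>\<close> is fixed by requiring
\<open>(dual, \<omega>) = 0\<close>, which makes \<open>\<omega> = - \<eta>(dual)\<close> smooth. Closedness of \<open>\<eta>\<close> is the identity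
\<open>eq\<close> of skew operators. Its matrix entries with respect to the frame show in turn that \<open>\<omega>\<close> has no
normal part, that \<open>\<omega>\<close> is symmetric and trace-free with entries \<open>a\<close>, \<open>b\<close>, and that \<open>a - \<i> b\<close>
satisfies the Cauchy-Riemann equations. Then \<open>q dz\<^sup>2\<close> with \<open>q = a - \<i> b\<close> is the holomorphic quadratic
differential of the isothermic surface.\<close>

lemma hopf_differential:
  assumes s\<eta>: "smooth_on S \<eta>1" "smooth_on S \<eta>2"
    and val: "\<And>z. z \<in> S \<Longrightarrow> \<exists>\<omega>. lor (\<sigma> z) \<omega> = 0 \<and> \<eta>1 z = wedge (\<sigma> z) \<omega>"
      "\<And>z. z \<in> S \<Longrightarrow> \<exists>\<omega>. lor (\<sigma> z) \<omega> = 0 \<and> \<eta>2 z = wedge (\<sigma> z) \<omega>"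
    and closed: "\<And>z. z \<in> S \<Longrightarrow> pd 1 \<eta>2 z = pd \<i> \<eta>1 z"
  obtains q where "q holomorphic_on S"
    "\<And>z. z \<in> S \<Longrightarrow> \<eta>1 z = wedge (\<sigma> z) (pd (cnj (q z)) \<sigma> z)"
    "\<And>z. z \<in> S \<Longrightarrow> \<eta>2 z = wedge (\<sigma> z) (pd (cnj (q z * \<i>)) \<sigma> z)"
proof -
  have form: "lor (\<sigma> z) (- T (dual z)) = 0 \<and> lor (dual z) (- T (dual z)) = 0 \<and> T = wedge (\<sigma> z) (- T (dual z))"
    if z: "z \<in> S" and ex: "\<exists>\<omega>. lor (\<sigma> z) \<omega> = 0 \<and> T = wedge (\<sigma> z) \<omega>" for z T
  proof -
    obtain \<omega> where w: "lor (\<sigma> z) \<omega> = 0" "T = wedge (\<sigma> z) \<omega>" using ex by blast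
    have "- T (dual z) = \<omega> + lor \<omega> (dual z) *\<^sub>R \<sigma> z"
      by (simp add: w(2) wedge_apply frame_products[OF z])
    moreover have "wedge (\<sigma> z) (\<omega> + lor \<omega> (dual z) *\<^sub>R \<sigma> z) = wedge (\<sigma> z) \<omega>"
      by (rule blinfun_eqI) (simp add: wedge_apply lor_simps algebra_simps)
    ultimately show ?thesis
      using w frame_products[OF z] lor_commute[of "dual z" \<omega>] by (simp add: lor_simps)
  qed
  define \<omega>1 where "\<omega>1 = (\<lambda>z. - \<eta>1 z (dual z))"
  define \<omega>2 where "\<omega>2 = (\<lambda>z. - \<eta>2 z (dual z))"
  have W1: "lor (\<sigma> z) (\<omega>1 z) = 0" "lor (dual z) (\<omega>1 z) = 0" "\<eta>1 z = wedge (\<sigma> z) (\<omega>1 z)" if "z \<in> S" for z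
    using form[OF that val(1)[OF that]] by (simp_all add: \<omega>1_def)
  have W2: "lor (\<sigma> z) (\<omega>2 z) = 0" "lor (dual z) (\<omega>2 z) = 0" "\<eta>2 z = wedge (\<sigma> z) (\<omega>2 z)" if "z \<in> S" for z
    using form[OF that val(2)[OF that]] by (simp_all add: \<omega>2_def)
  have s\<omega>: "smooth_on S \<omega>1" "smooth_on S \<omega>2" unfolding \<omega>1_def \<omega>2_def
    by (intro smooth_on_minus bounded_bilinear.smooth_on[OF bounded_bilinear_blinfun_apply] s\<eta> smooth_dual open_S)+
  note d\<omega> = smooth_on_imp_differentiable[OF s\<omega>(1)] smooth_on_imp_differentiable[OF s\<omega>(2)]
  have eq: "wedge (pd 1 \<sigma> z) (\<omega>2 z) + wedge (\<sigma> z) (pd 1 \<omega>2 z) = wedge (pd \<i> \<sigma> z) (\<omega>1 z) + wedge (\<sigma> z) (pd \<i> \<omega>1 z)"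
    if z: "z \<in> S" for z
  proof -
    have "pd 1 \<eta>2 z = pd 1 (\<lambda>z. wedge (\<sigma> z) (\<omega>2 z)) z" by (rule pd_cong[OF open_S z W2(3)])
    moreover have "pd \<i> \<eta>1 z = pd \<i> (\<lambda>z. wedge (\<sigma> z) (\<omega>1 z)) z" by (rule pd_cong[OF open_S z W1(3)])
    ultimately show ?thesis
      using closed[OF z] by (simp add: wedge.pd[OF diffs(1)[OF z] d\<omega>(1)[OF z]] wedge.pd[OF diffs(1)[OF z] d\<omega>(2)[OF z]] add.commute)
  qed
  have E: "lor (pd 1 \<sigma> z) x * lor (\<omega>2 z) y - lor (\<omega>2 z) x * lor (pd 1 \<sigma> z) y
      + (lor (\<sigma> z) x * lor (pd 1 \<omega>2 z) y - lor (pd 1 \<omega>2 z) x * lor (\<sigma> z) y)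
    = lor (pd \<i> \<sigma> z) x * lor (\<omega>1 z) y - lor (\<omega>1 z) x * lor (pd \<i> \<sigma> z) y
      + (lor (\<sigma> z) x * lor (pd \<i> \<omega>1 z) y - lor (pd \<i> \<omega>1 z) x * lor (\<sigma> z) y)"
    if z: "z \<in> S" for x y z
    using arg_cong[OF eq[OF z], of "\<lambda>T. lor (T x) y"]
    by (simp add: blinfun.bilinear_simps wedge_apply lor_simps)
  define a where "a z = lor (\<omega>1 z) (pd 1 \<sigma> z)" for z
  define b where "b z = lor (\<omega>1 z) (pd \<i> \<sigma> z)" for z
  have sab: "smooth_on S a" "smooth_on S b" unfolding a_def[abs_def] b_def[abs_def]
    by (intro lor.smooth_on s\<omega> smooth_pd open_S)+
  have coords: "\<omega>1 z = a z *\<^sub>R pd 1 \<sigma> z + b z *\<^sub>R pd \<i> \<sigma> z" "\<omega>2 z = b z *\<^sub>R pd 1 \<sigma> z - a z *\<^sub>R pd \<i> \<sigma> z"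
    if z: "z \<in> S" for z
  proof -
    note fp = frame_products[OF z]
    have "lor (\<omega>1 z) \<nu> = 0 \<and> lor (\<omega>2 z) \<nu> = 0" if "normal z \<nu>" for \<nu>
      using E[OF z, of \<nu> "pd 1 \<sigma> z"] E[OF z, of \<nu> "pd \<i> \<sigma> z"] that by (simp add: normal_def fp)
    then have exp: "\<omega>1 z = lor (\<omega>1 z) (pd 1 \<sigma> z) *\<^sub>R pd 1 \<sigma> z + lor (\<omega>1 z) (pd \<i> \<sigma> z) *\<^sub>R pd \<i> \<sigma> z"
      "\<omega>2 z = lor (\<omega>2 z) (pd 1 \<sigma> z) *\<^sub>R pd 1 \<sigma> z + lor (\<omega>2 z) (pd \<i> \<sigma> z) *\<^sub>R pd \<i> \<sigma> z"
      using tangential_expand[OF z, of "\<omega>1 z"] tangential_expand[OF z, of "\<omega>2 z"] W1(1,2)[OF z] W2(1,2)[OF z]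
      by (simp_all add: lor_commute[of "\<omega>1 z"] lor_commute[of "\<omega>2 z"])
    have 2: "lor (\<omega>2 z) (pd \<i> \<sigma> z) = - a z"
      using E[OF z, of "pd 1 \<sigma> z" "pd \<i> \<sigma> z"] by (simp add: fp a_def)
    have "lor (pd 1 \<sigma> z) (\<omega>2 z) = - lor (\<sigma> z) (pd 1 \<omega>2 z)"
      by (rule pd_lor_eq_const[OF open_S z diffs(1)[OF z] d\<omega>(2)[OF z] W2(1)])
    moreover have "lor (pd \<i> \<sigma> z) (\<omega>1 z) = - lor (\<sigma> z) (pd \<i> \<omega>1 z)"
      by (rule pd_lor_eq_const[OF open_S z diffs(1)[OF z] d\<omega>(1)[OF z] W1(1)])
    moreover have "lor (\<sigma> z) (pd 1 \<omega>2 z) = lor (\<sigma> z) (pd \<i> \<omega>1 z)"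
      using E[OF z, of "dual z" "\<sigma> z"] W1(2)[OF z] W2(2)[OF z]
      by (simp add: fp lor_commute[of "\<omega>1 z" "dual z"] lor_commute[of "\<omega>2 z" "dual z"] lor_commute[of "pd _ _ z" "\<sigma> z"])
    ultimately have 1: "lor (\<omega>2 z) (pd 1 \<sigma> z) = b z"
      by (simp add: b_def lor_commute)
    show "\<omega>1 z = a z *\<^sub>R pd 1 \<sigma> z + b z *\<^sub>R pd \<i> \<sigma> z" using exp(1) by (simp add: a_def b_def)
    show "\<omega>2 z = b z *\<^sub>R pd 1 \<sigma> z - a z *\<^sub>R pd \<i> \<sigma> z" using exp(2) by (simp add: 1 2)
  qed
  have CR: "pd 1 b z = pd \<i> a z" "pd 1 a z = - pd \<i> b z" if z: "z \<in> S" for z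
  proof -
    note fp = frame_products[OF z]
    have lower: "lor (pd e \<omega> z) (pd f \<sigma> z) = pd e c z"
      if "smooth_on S \<omega>" "\<And>w. w \<in> S \<Longrightarrow> lor (\<omega> w) (pd f \<sigma> w) = c w" "e \<in> dirs" "f \<in> dirs"
        "\<omega> z = k *\<^sub>R pd 1 \<sigma> z + l *\<^sub>R pd \<i> \<sigma> z" for \<omega> e f c k l
    proof -
      have "pd e (\<lambda>w. lor (\<omega> w) (pd f \<sigma> w)) z = pd e c z" by (rule pd_cong[OF open_S z that(2)])
      then show ?thesis
        using lor.pd[OF smooth_on_imp_differentiable[OF that(1) z] diffs(2)[OF z], of e f]
        by (simp add: that(5) lor_simps lor_pd_pd2[OF z _ that(3,4)])
    qed
    have c2: "\<omega>2 z = b z *\<^sub>R pd 1 \<sigma> z + (- a z) *\<^sub>R pd \<i> \<sigma> z" using coords(2)[OF z] by simp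
    have X: "lor (pd 1 \<omega>2 z) y = lor (pd \<i> \<omega>1 z) y" if "lor (dual z) y = 0" "lor (\<sigma> z) y = 0" for y
      using E[OF z, of "dual z" y] that W1(2)[OF z] W2(2)[OF z]
      by (simp add: fp lor_commute[of "\<omega>1 z" "dual z"] lor_commute[of "\<omega>2 z" "dual z"])
    have "pd 1 b z = lor (pd 1 \<omega>2 z) (pd 1 \<sigma> z)"
      by (rule lower[symmetric, OF s\<omega>(2) _ _ _ c2]) (auto simp: coords(2) lor_simps frame_products)
    also have "\<dots> = lor (pd \<i> \<omega>1 z) (pd 1 \<sigma> z)" by (rule X) (simp_all add: fp)
    also have "\<dots> = pd \<i> a z"
      by (rule lower[OF s\<omega>(1) _ _ _ coords(1)[OF z]]) (auto simp: a_def)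
    finally show "pd 1 b z = pd \<i> a z" .
    have "pd 1 (\<lambda>z. - a z) z = lor (pd 1 \<omega>2 z) (pd \<i> \<sigma> z)"
      by (rule lower[symmetric, OF s\<omega>(2) _ _ _ c2]) (auto simp: coords(2) lor_simps frame_products)
    also have "\<dots> = lor (pd \<i> \<omega>1 z) (pd \<i> \<sigma> z)" by (rule X) (simp_all add: fp)
    also have "\<dots> = pd \<i> b z"
      by (rule lower[OF s\<omega>(1) _ _ _ coords(1)[OF z]]) (auto simp: b_def)
    finally show "pd 1 a z = - pd \<i> b z"
      using pd_minus[OF smooth_on_imp_differentiable[OF sab(1) z], of 1] by simp
  qed
  define q where "q z = Complex (a z) (- b z)" for z
  have "q holomorphic_on S"
    unfolding holomorphic_on_open[OF open_S]
  proof
    fix z assume z: "z \<in> S"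
    have da: "a differentiable (at z)" "b differentiable (at z)"
      using sab smooth_on_imp_differentiable z by blast+
    have "((\<lambda>w. of_real (a w) - \<i> * of_real (b w)) has_derivative (\<lambda>v. of_real (pd v a z) - \<i> * of_real (pd v b z))) (at z)"
      by (intro derivative_intros has_derivative_pd da)
    moreover have "of_real (pd v a z) - \<i> * of_real (pd v b z) = Complex (pd 1 a z) (- pd 1 b z) * v" for v
      using CR[OF z]
      by (simp add: pd_complex_expand[OF da(1), of v] pd_complex_expand[OF da(2), of v] complex_eq_iff algebra_simps)
    moreover have "q = (\<lambda>w. of_real (a w) - \<i> * of_real (b w))"
      by (rule ext) (simp add: q_def complex_eq_iff)
    ultimately show "\<exists>f'. (q has_field_derivative f') (at z)"
      unfolding has_field_derivative_def by (metis (no_types, lifting) ext)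
  qed
  moreover have "\<eta>1 z = wedge (\<sigma> z) (pd (cnj (q z)) \<sigma> z)" "\<eta>2 z = wedge (\<sigma> z) (pd (cnj (q z * \<i>)) \<sigma> z)"
    if z: "z \<in> S" for z
  proof -
    have "pd (cnj (q z)) \<sigma> z = \<omega>1 z" "pd (cnj (q z * \<i>)) \<sigma> z = \<omega>2 z"
      unfolding coords[OF z] pd_complex_expand[OF diffs(1)[OF z], of "cnj (q z)"]
        pd_complex_expand[OF diffs(1)[OF z], of "cnj (q z * \<i>)"]
      by (simp_all add: q_def)
    then show "\<eta>1 z = wedge (\<sigma> z) (pd (cnj (q z)) \<sigma> z)" "\<eta>2 z = wedge (\<sigma> z) (pd (cnj (q z * \<i>)) \<sigma> z)"
      using W1(3)[OF z] W2(3)[OF z] by simp_all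
  qed
  ultimately show ?thesis by (rule that)
qed

end

text \<open>The differential of \<open>\<sigma> \<and> (\<sigma>\<^sub>x dx - \<sigma>\<^sub>y dy)\<close> is \<open>- 2 \<sigma> \<and> \<sigma>\<^sub>x\<^sub>y dx \<and> dy\<close>.\<close>

lemma isothermic_liftI:
  assumes "flat_lift S \<sigma>"
    and closed: "\<And>z. z \<in> S \<Longrightarrow> pd 1 (\<lambda>z. wedge (\<sigma> z) (pd (- \<i>) \<sigma> z)) z = pd \<i> (\<lambda>z. wedge (\<sigma> z) (pd 1 \<sigma> z)) z"
  shows "isothermic_lift S \<sigma>"
proof -
  interpret flat_lift S \<sigma> by fact
  show ?thesis
  proof
    fix z assume z: "z \<in> S"
    have neg: "pd (- \<i>) \<sigma> w = - pd \<i> \<sigma> w" if "w \<in> S" for w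
      using linear_neg[OF linear_pd[OF diffs(1)[OF that]]] .
    have "pd 1 (\<lambda>z. wedge (\<sigma> z) (pd (- \<i>) \<sigma> z)) z = pd 1 (\<lambda>z. wedge (\<sigma> z) (- pd \<i> \<sigma> z)) z"
      by (rule pd_cong[OF open_S z]) (simp add: neg)
    also have "\<dots> = wedge (\<sigma> z) (pd 1 (\<lambda>z. - pd \<i> \<sigma> z) z) + wedge (pd 1 \<sigma> z) (- pd \<i> \<sigma> z)"
      by (rule wedge.pd[OF diffs(1)[OF z]
            smooth_on_imp_differentiable[OF smooth_on_minus[OF smooth_pd(1) open_S] z]])
    also have "\<dots> = - wedge (\<sigma> z) (pd 1 (pd \<i> \<sigma>) z) - wedge (pd 1 \<sigma> z) (pd \<i> \<sigma> z)"
      by (simp add: pd_minus[OF diffs(2)[OF z]] wedge.minus_right)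
    finally have eq: "- wedge (\<sigma> z) (pd 1 (pd \<i> \<sigma>) z) - wedge (pd 1 \<sigma> z) (pd \<i> \<sigma> z)
      = wedge (\<sigma> z) (pd 1 (pd \<i> \<sigma>) z) + wedge (pd \<i> \<sigma> z) (pd 1 \<sigma> z)"
      using closed[OF z] pd_commute_\<sigma>[OF z, of 1 \<i>] by (simp add: wedge.pd[OF diffs(1,2)[OF z]])
    define Y where "Y = pd 1 (pd \<i> \<sigma>) z + lor (pd 1 (pd \<i> \<sigma>) z) (dual z) *\<^sub>R \<sigma> z"
    have "(- wedge (\<sigma> z) (pd 1 (pd \<i> \<sigma>) z) - wedge (pd 1 \<sigma> z) (pd \<i> \<sigma> z)) (dual z) = Y"
      "(wedge (\<sigma> z) (pd 1 (pd \<i> \<sigma>) z) + wedge (pd \<i> \<sigma> z) (pd 1 \<sigma> z)) (dual z) = - Y"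
      by (simp_all add: blinfun.bilinear_simps wedge_apply frame_products[OF z] Y_def)
    then have "Y = - Y" using eq by simp
    then have "2 *\<^sub>R Y = 0" unfolding scaleR_2 by (metis add.right_inverse)
    then have "pd 1 (pd \<i> \<sigma>) z = (- lor (pd 1 (pd \<i> \<sigma>) z) (dual z)) *\<^sub>R \<sigma> z"
      by (simp add: Y_def eq_neg_iff_add_eq_0)
    then show "\<exists>u. pd 1 (pd \<i> \<sigma>) z = u *\<^sub>R \<sigma> z" ..
  qed
qed

text \<open>The coordinate \<open>k\<close> is a primitive of a square root of \<open>q\<close>, and \<open>h\<close> its local inverse; it turns
\<open>q dz\<^sup>2\<close> into \<open>dw\<^sup>2\<close>.\<close>

lemma square_root_coordinate:
  assumes q: "q holomorphic_on S" and S: "open S" "z0 \<in> S" and nz: "q z0 \<noteq> 0"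
  obtains r h k where "0 < r" "h holomorphic_on ball 0 r" "h 0 = z0" "h ` ball 0 r \<subseteq> S"
    "open (h ` ball 0 r)" "k holomorphic_on h ` ball 0 r" "\<And>w. w \<in> ball 0 r \<Longrightarrow> k (h w) = w"
    "\<And>w. w \<in> ball 0 r \<Longrightarrow> deriv k (h w) * deriv h w = 1"
    "\<And>w. w \<in> ball 0 r \<Longrightarrow> q (h w) * (deriv h w)\<^sup>2 = 1"
proof -
  have "open (S \<inter> q -` (- {0}))"
    by (rule continuous_open_preimage[OF holomorphic_on_imp_continuous_on[OF q] S(1)]) auto
  moreover have "z0 \<in> S \<inter> q -` (- {0})" using S(2) nz by auto
  ultimately obtain e where e: "e > 0" "ball z0 e \<subseteq> S \<inter> q -` (- {0})" using openE by blast
  define B where "B = ball z0 e"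
  have qB: "q holomorphic_on B" using q e(2) holomorphic_on_subset by (auto simp: B_def)
  have cB: "contractible B" by (simp add: B_def convex_imp_contractible)
  have "q z \<noteq> 0" if "z \<in> B" for z using e(2) that by (auto simp: B_def)
  then obtain g where g: "g holomorphic_on B" "\<And>z. z \<in> B \<Longrightarrow> q z = g z ^ 2"
    using contractible_imp_holomorphic_sqrt[OF qB cB] by blast
  obtain F0 where F0: "\<And>z. z \<in> B \<Longrightarrow> (F0 has_field_derivative g z) (at z within B)"
    using holomorphic_convex_primitive'[OF _ _ g(1)] by (auto simp: B_def)
  define F where "F z = F0 z - F0 z0" for z
  have z0B: "z0 \<in> B" using e(1) by (simp add: B_def)
  have dF: "(F has_field_derivative g z) (at z)" if "z \<in> B" for z
    using F0[OF that] that at_within_open[OF that] unfolding F_def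
    by (auto simp: B_def intro!: derivative_eq_intros)
  have F: "F holomorphic_on B" using dF unfolding B_def holomorphic_on_open[OF open_ball] by blast
  have derivF: "deriv F z = g z" if "z \<in> B" for z using dF[OF that] by (rule DERIV_imp_deriv)
  have gnz: "g z \<noteq> 0" if "z \<in> B" for z using g(2)[OF that] e(2) that by (auto simp: B_def)
  obtain d where d: "d > 0" "ball z0 d \<subseteq> B" "inj_on F (ball z0 d)"
    using has_complex_derivative_locally_injective[OF F z0B] derivF[OF z0B] gnz[OF z0B] by (auto simp: B_def)
  have FD: "F holomorphic_on ball z0 d" using F d(2) by (rule holomorphic_on_subset)
  obtain h where h: "h holomorphic_on F ` ball z0 d"
    "\<And>z. z \<in> ball z0 d \<Longrightarrow> deriv F z * deriv h (F z) = 1" "\<And>z. z \<in> ball z0 d \<Longrightarrow> h (F z) = z"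
    using holomorphic_has_inverse[OF FD open_ball d(3)] by blast
  have "open (F ` ball z0 d)" by (rule open_mapping_thm3[OF FD open_ball d(3)])
  moreover have "0 \<in> F ` ball z0 d" using d(1) by (force simp: F_def)
  ultimately obtain r where r: "r > 0" "ball 0 r \<subseteq> F ` ball z0 d" using openE by blast
  have pre: "h w \<in> ball z0 d \<and> F (h w) = w" if w: "w \<in> ball 0 r" for w
  proof -
    obtain z where "z \<in> ball z0 d" "w = F z" using r(2) w by blast
    then show ?thesis using h(3) by auto
  qed
  have inj: "inj_on h (ball 0 r)" by (rule inj_onI) (metis pre)
  have hol: "h holomorphic_on ball 0 r" using h(1) r(2) by (rule holomorphic_on_subset)
  show ?thesis
  proof (rule that[OF r(1) hol, of F])
    show "h 0 = z0" using h(3)[of z0] d(1) by (simp add: F_def)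
    show "h ` ball 0 r \<subseteq> S" using pre d(2) e(2) unfolding B_def by blast
    show "open (h ` ball 0 r)" by (rule open_mapping_thm3[OF hol open_ball inj])
    show "F holomorphic_on h ` ball 0 r" using pre d(2) by (intro holomorphic_on_subset[OF F]) blast
    fix w :: complex assume w: "w \<in> ball 0 r"
    show "F (h w) = w" using pre[OF w] by blast
    show 1: "deriv F (h w) * deriv h w = 1" using h(2)[of "h w"] pre[OF w] by simp
    have "h w \<in> B" using pre[OF w] d(2) by blast
    then show "q (h w) * (deriv h w)\<^sup>2 = 1"
      using 1 g(2) derivF by (simp flip: power_mult_distrib)
  qed
qed

text \<open>In the coordinate of the preceding lemma the quadratic differential is \<open>dw\<^sup>2\<close>. The pulled back lift
induces the metric \<open>\<bar>deriv h\<bar>\<^sup>2 \<bar>dw\<bar>\<^sup>2\<close> and has to be rescaled once more, and this rescaling is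
exactly what absorbs the coefficient of \<open>\<eta>\<close>.\<close>

lemma adapted_coordinate:
  fixes \<eta> :: "complex \<Rightarrow> complex \<Rightarrow>\<^sub>L ('n::finite lorentz \<Rightarrow>\<^sub>L 'n lorentz)"
  assumes "flat_lift S \<sigma>" and z0: "z0 \<in> S" and s\<eta>: "smooth_on S \<eta>"
    and val: "\<And>z v. z \<in> S \<Longrightarrow> \<exists>\<omega>. lor (\<sigma> z) \<omega> = 0 \<and> \<eta> z v = wedge (\<sigma> z) \<omega>"
    and closed: "\<And>z v w. z \<in> S \<Longrightarrow> pd v \<eta> z w = pd w \<eta> z v"
    and nz: "\<eta> z0 \<noteq> 0"
  obtains r h k \<sigma>' where "0 < r" "h holomorphic_on ball 0 r" "h 0 = z0" "h ` ball 0 r \<subseteq> S"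
    "open (h ` ball 0 r)" "k holomorphic_on h ` ball 0 r" "\<And>w. w \<in> ball 0 r \<Longrightarrow> k (h w) = w"
    "\<And>w. w \<in> ball 0 r \<Longrightarrow> deriv k (h w) * deriv h w = 1"
    "isothermic_lift (ball 0 r) \<sigma>'"
    "\<And>w v. w \<in> ball 0 r \<Longrightarrow> \<eta> (h w) (deriv h w * v) = wedge (\<sigma>' w) (pd (cnj v) \<sigma>' w)"
proof -
  interpret flat_lift S \<sigma> by fact
  have d\<eta>: "\<eta> differentiable (at z)" if "z \<in> S" for z by (rule smooth_on_imp_differentiable[OF s\<eta> that])
  have eval: "smooth_on S (\<lambda>z. \<eta> z v)" for v
    by (rule bounded_linear.smooth_on[OF blinfun.bounded_linear_left s\<eta> open_S])
  have pd_eval: "pd e (\<lambda>z. \<eta> z v) z = pd e \<eta> z v" if "z \<in> S" for e v z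
    by (rule bounded_linear.pd[OF blinfun.bounded_linear_left d\<eta>[OF that]])
  obtain q where q: "q holomorphic_on S" "\<And>z. z \<in> S \<Longrightarrow> \<eta> z 1 = wedge (\<sigma> z) (pd (cnj (q z)) \<sigma> z)"
    "\<And>z. z \<in> S \<Longrightarrow> \<eta> z \<i> = wedge (\<sigma> z) (pd (cnj (q z * \<i>)) \<sigma> z)"
    by (rule hopf_differential[OF eval[of 1] eval[of \<i>] val val]) (auto simp: pd_eval closed)
  have \<eta>q: "\<eta> z v = wedge (\<sigma> z) (pd (cnj (q z * v)) \<sigma> z)" if z: "z \<in> S" for z v
  proof -
    have v: "v = Re v *\<^sub>R 1 + Im v *\<^sub>R \<i>" by (simp add: complex_eq_iff)
    have "cnj (q z * v) = Re v *\<^sub>R cnj (q z) + Im v *\<^sub>R cnj (q z * \<i>)"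
      by (simp add: complex_eq_iff algebra_simps)
    then have "pd (cnj (q z * v)) \<sigma> z = Re v *\<^sub>R pd (cnj (q z)) \<sigma> z + Im v *\<^sub>R pd (cnj (q z * \<i>)) \<sigma> z"
      by (simp only: linear_add[OF linear_pd[OF diffs(1)[OF z]]] linear_scale[OF linear_pd[OF diffs(1)[OF z]]])
    moreover have "\<eta> z v = Re v *\<^sub>R \<eta> z 1 + Im v *\<^sub>R \<eta> z \<i>"
      by (subst v) (simp only: blinfun.add_right blinfun.scaleR_right)
    ultimately show ?thesis by (simp add: q(2,3)[OF z] wedge.add_right wedge.scaleR_right)
  qed
  have "q z0 \<noteq> 0"
  proof
    assume "q z0 = 0"
    then have "\<eta> z0 = 0"
      by (intro blinfun_eqI) (simp add: \<eta>q[OF z0] linear_0[OF linear_pd[OF diffs(1)[OF z0]]] wedge.zero_right)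
    with nz show False ..
  qed
  then obtain r h k where r: "0 < r" and h: "h holomorphic_on ball 0 r" "h 0 = z0" "h ` ball 0 r \<subseteq> S"
    "open (h ` ball 0 r)" and k: "k holomorphic_on h ` ball 0 r" "\<And>w. w \<in> ball 0 r \<Longrightarrow> k (h w) = w"
    "\<And>w. w \<in> ball 0 r \<Longrightarrow> deriv k (h w) * deriv h w = 1"
    and qh: "\<And>w. w \<in> ball 0 r \<Longrightarrow> q (h w) * (deriv h w)\<^sup>2 = 1"
    using square_root_coordinate[OF q(1) open_S z0] by metis
  define B where "B = ball (0::complex) r"
  have opB: "open B" by (simp add: B_def)
  have hB: "h holomorphic_on B" "\<And>w. w \<in> B \<Longrightarrow> h w \<in> S" using h by (auto simp: B_def)
  have hnz: "deriv h w \<noteq> 0" if "w \<in> B" for w using k(3)[of w] that by (auto simp: B_def)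
  define \<tau> where "\<tau> = (\<lambda>w. \<sigma> (h w))"
  have s\<tau>: "smooth_on B \<tau>" unfolding \<tau>_def
    by (rule smooth_on_compose_holomorphic[OF smooth hB(1) opB]) (use hB(2) in blast)
  have pd\<tau>: "pd v \<tau> w = pd (deriv h w * v) \<sigma> (h w)" if "w \<in> B" for v w
    unfolding \<tau>_def by (rule pd_compose_holomorphic[OF hB(1) opB that diffs(1)[OF hB(2)[OF that]]])
  have conf: "lor (pd v \<tau> w) (pd v' \<tau> w) = (cmod (deriv h w))\<^sup>2 * (v \<bullet> v')" if "w \<in> B" for v v' w
    unfolding pd\<tau>[OF that] lor_pd_pd[OF hB(2)[OF that]]
    by (simp add: inner_complex_def cmod_power2) (simp add: algebra_simps power2_eq_square)
  obtain \<mu> where \<mu>: "\<And>w. w \<in> B \<Longrightarrow> 0 < \<mu> w" "flat_lift B (\<lambda>w. \<mu> w *\<^sub>R \<tau> w)"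
    "\<And>w. w \<in> B \<Longrightarrow> (\<mu> w)\<^sup>2 * lor (pd 1 \<tau> w) (pd 1 \<tau> w) = 1"
    "\<And>w v. w \<in> B \<Longrightarrow> \<exists>c. pd v (\<lambda>w. \<mu> w *\<^sub>R \<tau> w) w = \<mu> w *\<^sub>R pd v \<tau> w + c *\<^sub>R \<tau> w"
  proof (rule flat_lift_normalise[OF opB s\<tau>])
    show "lor (\<tau> w) (\<tau> w) = 0" if "w \<in> B" for w using null[OF hB(2)[OF that]] by (simp add: \<tau>_def)
    show "\<exists>\<rho>>0. \<forall>v v'. lor (pd v \<tau> w) (pd v' \<tau> w) = \<rho> * (v \<bullet> v')" if "w \<in> B" for w
      using conf[OF that] hnz[OF that] by (intro exI[of _ "(cmod (deriv h w))\<^sup>2"]) simp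
  qed blast
  define \<sigma>' where "\<sigma>' = (\<lambda>w. \<mu> w *\<^sub>R \<tau> w)"
  have main: "\<eta> (h w) (deriv h w * v) = wedge (\<sigma>' w) (pd (cnj v) \<sigma>' w)" if w: "w \<in> B" for w v
  proof -
    define D where "D = deriv h w"
    have D: "D \<noteq> 0" using hnz[OF w] by (simp add: D_def)
    have m: "(\<mu> w)\<^sup>2 * (cmod D)\<^sup>2 = 1"
      using \<mu>(3)[OF w] conf[OF w, of 1 1] by (simp add: D_def inner_complex_def)
    have "D * cnj D = of_real ((cmod D)\<^sup>2)" by (rule complex_norm_square[symmetric])
    then have m': "of_real ((\<mu> w)\<^sup>2) * D * cnj D = (1::complex)"
      using arg_cong[OF m, of complex_of_real] by (simp add: mult.assoc)
    have qD: "q (h w) * D * D = 1" using qh[of w] w by (simp add: D_def B_def power2_eq_square mult.assoc)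
    have "cnj (q (h w) * D) * cnj D = of_real ((\<mu> w)\<^sup>2) * D * cnj D"
      using arg_cong[OF qD, of cnj] m' by simp
    then have "cnj (q (h w) * D) = of_real ((\<mu> w)\<^sup>2) * D" using D by simp
    then have c: "cnj (q (h w) * (D * v)) = (\<mu> w)\<^sup>2 *\<^sub>R (D * cnj v)"
      by (simp add: scaleR_conv_of_real mult.assoc)
    have "\<eta> (h w) (D * v) = wedge (\<tau> w) (pd ((\<mu> w)\<^sup>2 *\<^sub>R (D * cnj v)) \<sigma> (h w))"
      by (simp only: \<eta>q[OF hB(2)[OF w]] c \<tau>_def)
    also have "\<dots> = (\<mu> w)\<^sup>2 *\<^sub>R wedge (\<tau> w) (pd (cnj v) \<tau> w)"
      by (simp only: linear_scale[OF linear_pd[OF diffs(1)[OF hB(2)[OF w]]]] pd\<tau>[OF w] D_def wedge.scaleR_right)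
    also have "\<dots> = wedge (\<sigma>' w) (pd (cnj v) \<sigma>' w)"
    proof -
      obtain c where c: "pd (cnj v) \<sigma>' w = \<mu> w *\<^sub>R pd (cnj v) \<tau> w + c *\<^sub>R \<tau> w"
        using \<mu>(4)[OF w] unfolding \<sigma>'_def by blast
      have "wedge (\<tau> w) (\<tau> w) = 0" by (rule blinfun_eqI) (simp add: wedge_apply)
      then show ?thesis
        unfolding c by (simp add: \<sigma>'_def wedge.add_right wedge.scaleR_left wedge.scaleR_right power2_eq_square)
    qed
    finally show ?thesis by (simp add: D_def)
  qed
  have "isothermic_lift B \<sigma>'"
  proof (rule isothermic_liftI)
    show "flat_lift B \<sigma>'" using \<mu>(2) by (simp add: \<sigma>'_def)
    fix w assume w: "w \<in> B"
    have hol': "deriv h holomorphic_on B" by (intro holomorphic_deriv hB(1) opB)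
    \<comment> \<open>The second derivative of \<open>h\<close> enters symmetrically in \<open>d\<close> and \<open>e\<close>; hence the
    pull-back is closed.\<close>
    have pullback: "pd d (\<lambda>w. \<eta> (h w) (deriv h w * e)) w
      = \<eta> (h w) (deriv (deriv h) w * d * e) + pd (deriv h w * d) \<eta> (h w) (deriv h w * e)" for d e
    proof -
      have 1: "((\<lambda>w. \<eta> (h w)) has_derivative (\<lambda>v. pd (deriv h w * v) \<eta> (h w))) (at w)"
        by (rule has_derivative_compose_holomorphic[OF hB(1) opB w d\<eta>[OF hB(2)[OF w]]])
      have "(deriv h has_derivative (\<lambda>v. deriv (deriv h) w * v)) (at w)"
        using holomorphic_derivI[OF hol' opB w] by (simp add: has_field_derivative_def)
      then have 2: "((\<lambda>w. deriv h w * e) has_derivative (\<lambda>v. deriv (deriv h) w * v * e)) (at w)"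
        by (rule has_derivative_mult_left)
      show ?thesis
        by (rule pd_eqI[OF bounded_bilinear.FDERIV[OF bounded_bilinear_blinfun_apply 1 2]])
    qed
    have "pd 1 (\<lambda>w. wedge (\<sigma>' w) (pd (- \<i>) \<sigma>' w)) w = pd 1 (\<lambda>w. \<eta> (h w) (deriv h w * \<i>)) w"
      by (rule pd_cong[OF opB w]) (simp add: main)
    also have "\<dots> = pd \<i> (\<lambda>w. \<eta> (h w) (deriv h w * 1)) w"
      unfolding pullback using closed[OF hB(2)[OF w], of "deriv h w * 1" "deriv h w * \<i>"] by simp
    also have "\<dots> = pd \<i> (\<lambda>w. wedge (\<sigma>' w) (pd 1 \<sigma>' w)) w"
      by (rule pd_cong[OF opB w]) (use main[of _ 1] in simp)
    finally show "pd 1 (\<lambda>w. wedge (\<sigma>' w) (pd (- \<i>) \<sigma>' w)) w = pd \<i> (\<lambda>w. wedge (\<sigma>' w) (pd 1 \<sigma>' w)) w" .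
  qed
  with that[OF r h k] main show ?thesis by (simp add: B_def)
qed

section \<open>Transfer to the Riemann surface\<close>

lemma dmap_eq_pd: "dmap c f x v = pd v (coord_rep c f) (snd c x)"
  by (simp add: dmap_def pd_def)

context riemann_surface
begin

lemma chart_domain_subset: "c \<in> A \<Longrightarrow> fst c \<subseteq> topspace X"
  using cover by blast

lemma chart_homeomorphic:
  "c \<in> A \<Longrightarrow> homeomorphic_map (subtopology X (fst c)) (top_of_set (snd c ` fst c)) (snd c)"
  using charts by (simp add: is_chart_def)

lemma inj_on_chart: "c \<in> A \<Longrightarrow> inj_on (snd c) (fst c)"
  using homeomorphic_imp_injective_map[OF chart_homeomorphic] chart_domain_subset
  by (simp add: Int_absorb1)

lemma coord_rep_chart: "c \<in> A \<Longrightarrow> y \<in> fst c \<Longrightarrow> coord_rep c f (snd c y) = f y"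
  by (simp add: coord_rep_def inj_on_chart)

lemma open_chart_image:
  assumes c: "c \<in> A" and U: "openin X U"
  shows "open (snd c ` (fst c \<inter> U))"
proof -
  have "openin (subtopology X (fst c)) (fst c \<inter> U)" using U by (rule openin_subtopology_Int2)
  then have "openin (top_of_set (snd c ` fst c)) (snd c ` (fst c \<inter> U))"
    using homeomorphic_imp_open_map[OF chart_homeomorphic[OF c]] by (simp add: open_map_def)
  moreover have "open (snd c ` fst c)" using charts[OF c] by (simp add: is_chart_def)
  ultimately show ?thesis by (metis openin_open_eq)
qed

lemma chart_preimage:
  assumes c: "c \<in> A" and V: "open V" "V \<subseteq> snd c ` fst c"
  shows "openin X {y \<in> fst c. snd c y \<in> V}" and "connected V \<Longrightarrow> connectedin X {y \<in> fst c. snd c y \<in> V}"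
proof -
  have op: "openin X (fst c)" using charts[OF c] by (simp add: is_chart_def)
  have ts: "topspace (subtopology X (fst c)) = fst c"
    using chart_domain_subset[OF c] by (simp add: Int_absorb1)
  have "openin (top_of_set (snd c ` fst c)) V" using V by (simp add: open_subset)
  with homeomorphic_imp_continuous_map[OF chart_homeomorphic[OF c]]
  have "openin (subtopology X (fst c)) {y \<in> fst c. snd c y \<in> V}"
    unfolding continuous_map_def ts by blast
  then show "openin X {y \<in> fst c. snd c y \<in> V}" using op by (metis openin_trans_full)
  have img: "snd c ` {y \<in> fst c. snd c y \<in> V} = V" using V(2) by auto
  show "connectedin X {y \<in> fst c. snd c y \<in> V}" if "connected V"
    using homeomorphic_map_connectedness[OF chart_homeomorphic[OF c], of "{y \<in> fst c. snd c y \<in> V}"] that V(2)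
      order_trans[OF _ chart_domain_subset[OF c], of "{y \<in> fst c. snd c y \<in> V}"]
    by (simp add: ts img connectedin_subtopology connectedin_iff_connected)
qed

end

lemma span_null_vector:
  assumes "L \<in> proj_light_cone" "s \<in> L" "s \<noteq> 0"
  shows "lor s s = 0" "L = span {s}"
proof -
  obtain l where l: "l \<in> light_cone" "L = span {l}" using assms(1) by (auto simp: proj_light_cone_def)
  then obtain k where k: "s = k *\<^sub>R l" using assms(2) by (auto simp: span_singleton)
  then show "lor s s = 0" using l(1) by (simp add: light_cone_def lor_simps)
  have "k \<noteq> 0" using k assms(3) by auto
  have "a *\<^sub>R l \<in> range (\<lambda>a. a *\<^sub>R k *\<^sub>R l)" for a
    by (rule range_eqI[of _ _ "a / k"]) (use \<open>k \<noteq> 0\<close> in simp)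
  moreover have "a *\<^sub>R k *\<^sub>R l \<in> range (\<lambda>a. a *\<^sub>R l)" for a
    by (rule range_eqI[of _ _ "a * k"]) simp
  ultimately show "L = span {s}" unfolding l(2) k span_singleton by blast
qed

text \<open>When the first factor runs through a line, sums of wedges are again wedges.\<close>

lemma wedge_space_span_perp:
  assumes "T \<in> wedge_space (span {s}) (perp (span {s}))"
  shows "\<exists>\<omega>. lor s \<omega> = 0 \<and> T = wedge s \<omega>"
  using assms unfolding wedge_space_def
proof (induction rule: span_induct)
  case base
  have "subspace (wedge s ` {\<omega>. lor s \<omega> = 0})"
    by (intro linear_subspace_image bounded_linear.linear[OF wedge.bounded_linear_right]
        linear_subspace_kernel linear_lor)
  also have "wedge s ` {\<omega>. lor s \<omega> = 0} = {T. \<exists>\<omega>. lor s \<omega> = 0 \<and> T = wedge s \<omega>}" by blast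
  finally show ?case by simp
next
  case (step T)
  then obtain a v where av: "T = wedge a v" "a \<in> span {s}" "v \<in> perp (span {s})" by blast
  then obtain k where k: "a = k *\<^sub>R s" by (auto simp: span_singleton)
  have "lor s v = 0" using av(3) span_base[of s "{s}"] by (auto simp: perp_def)
  then show ?case
    by (intro exI[of _ "k *\<^sub>R v"]) (simp add: av(1) k lor_simps wedge.scaleR_left wedge.scaleR_right)
qed

theorem theorem2p5:
  fixes X :: "'a topology" and A :: "'a chart set"
    and \<Lambda> :: "'a \<Rightarrow> 'n::finite lorentz set"
    and \<eta> :: "('a, 'n lorentz \<Rightarrow>\<^sub>L 'n lorentz) form1"
    and x :: 'a
  assumes "riemann_surface X A"
    and "isothermic_surface X A \<Lambda> \<eta>"
    and "CARD('n) \<ge> 3"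
    and "x \<in> topspace X"
    and "form_nonzero_at A \<eta> x"
  shows "\<exists>U. openin X U \<and> connectedin X U \<and> x \<in> U \<and>
           (\<exists>p. formal_conserved_quantity A \<eta> U p)"
proof -
  interpret riemann_surface X A by fact
  have conf: "conformal_immersion X A \<Lambda>" and form: "one_form A \<eta>" and closed: "closed_form A \<eta>"
    and val: "\<And>c y v. c \<in> A \<Longrightarrow> y \<in> fst c \<Longrightarrow> \<eta> c y v \<in> wedge_space (\<Lambda> y) (perp (\<Lambda> y))"
    using assms(2) by (auto simp: isothermic_surface_def)
  have nlb: "null_line_bundle X A \<Lambda>" using conf by (simp add: conformal_immersion_def)
  obtain c where c: "c \<in> A" "x \<in> fst c" "\<eta> c x \<noteq> 0" using assms(5) by (auto simp: form_nonzero_at_def)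
  obtain U0 s where U0: "openin X U0" "x \<in> U0" and s: "lift A \<Lambda> U0 s"
    using nlb assms(4) by (auto simp: null_line_bundle_def)
  define Z where "Z = snd c ` (fst c \<inter> U0)"
  define \<tau> where "\<tau> = coord_rep c s"
  define N where "N = coord_rep c (\<eta> c)"
  have opZ: "open Z" unfolding Z_def by (rule open_chart_image[OF c(1) U0(1)])
  have ZE: "\<exists>y. y \<in> fst c \<and> y \<in> U0 \<and> z = snd c y \<and> \<tau> z = s y \<and> N z = \<eta> c y" if z: "z \<in> Z" for z
  proof -
    obtain y where "y \<in> fst c" "y \<in> U0" "z = snd c y" using z by (auto simp: Z_def)
    then show ?thesis by (intro exI[of _ y]) (simp add: \<tau>_def N_def coord_rep_chart[OF c(1)])
  qed
  have s\<tau>: "smooth_on Z \<tau>" using s c(1) by (auto simp: lift_def smooth_section_def Z_def \<tau>_def)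
  have sN: "smooth_on Z N"
  proof (rule smooth_on_subset)
    show "smooth_on (snd c ` fst c) N" using form c(1) by (auto simp: one_form_def smooth_section_def N_def)
  qed (auto simp: Z_def)
  have line: "lor (s y) (s y) = 0" "\<Lambda> y = span {s y}" if "y \<in> U0" for y
  proof -
    have "y \<in> topspace X" using U0(1) that openin_subset by blast
    then have "\<Lambda> y \<in> proj_light_cone" using nlb by (auto simp: null_line_bundle_def)
    then show "lor (s y) (s y) = 0" "\<Lambda> y = span {s y}"
      using span_null_vector[of "\<Lambda> y" "s y"] s that by (auto simp: lift_def)
  qed
  obtain \<mu> where \<mu>: "\<And>z. z \<in> Z \<Longrightarrow> 0 < \<mu> z" "flat_lift Z (\<lambda>z. \<mu> z *\<^sub>R \<tau> z)"
  proof (rule flat_lift_normalise[OF opZ s\<tau>])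
    show "lor (\<tau> z) (\<tau> z) = 0" if "z \<in> Z" for z using ZE[OF that] line by auto
    show "\<exists>\<rho>>0. \<forall>v w. lor (pd v \<tau> z) (pd w \<tau> z) = \<rho> * (v \<bullet> w)" if z: "z \<in> Z" for z
    proof -
      obtain y where y: "y \<in> fst c \<inter> U0" "z = snd c y" using ZE[OF z] by blast
      then have "\<exists>\<rho>>0. \<forall>v w. lor (dmap c s y v) (dmap c s y w) = \<rho> * (v \<bullet> w)"
        using conf U0(1) s c(1) unfolding conformal_immersion_def by blast
      then show ?thesis by (simp add: dmap_eq_pd y(2) \<tau>_def)
    qed
  qed blast
  define \<sigma> where "\<sigma> = (\<lambda>z. \<mu> z *\<^sub>R \<tau> z)"
  have z0: "snd c x \<in> Z" using c(2) U0(2) by (auto simp: Z_def)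
  have valN: "\<exists>\<omega>. lor (\<sigma> z) \<omega> = 0 \<and> N z v = wedge (\<sigma> z) \<omega>" if z: "z \<in> Z" for z v
  proof -
    obtain y where y: "y \<in> fst c" "y \<in> U0" "\<tau> z = s y" "N z = \<eta> c y" using ZE[OF z] by blast
    obtain \<omega> where "lor (s y) \<omega> = 0" "\<eta> c y v = wedge (s y) \<omega>"
      using wedge_space_span_perp val[OF c(1) y(1)] line(2)[OF y(2)] by metis
    then show ?thesis
      using \<mu>(1)[OF z] y
      by (intro exI[of _ "(1 / \<mu> z) *\<^sub>R \<omega>"]) (simp add: \<sigma>_def lor_simps wedge.scaleR_left wedge.scaleR_right)
  qed
  have closedN: "pd v N z w = pd w N z v" if z: "z \<in> Z" for z v w
  proof -
    obtain y where y: "y \<in> fst c" "z = snd c y" using ZE[OF z] by blast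
    then have "dmap c (\<eta> c) y v w - dmap c (\<eta> c) y w v = 0"
      using closed c(1) unfolding closed_form_def by blast
    then show ?thesis by (simp add: dmap_eq_pd y N_def)
  qed
  have nz: "N (snd c x) \<noteq> 0" using c by (simp add: N_def coord_rep_chart)
  obtain r h k \<sigma>' where r: "0 < r" and h: "h holomorphic_on ball 0 r" "h 0 = snd c x" "h ` ball 0 r \<subseteq> Z"
    "open (h ` ball 0 r)" and k: "k holomorphic_on h ` ball 0 r" "\<And>w. w \<in> ball 0 r \<Longrightarrow> k (h w) = w"
    "\<And>w. w \<in> ball 0 r \<Longrightarrow> deriv k (h w) * deriv h w = 1"
    and iso: "isothermic_lift (ball 0 r) \<sigma>'"
    and N: "\<And>w v. w \<in> ball 0 r \<Longrightarrow> N (h w) (deriv h w * v) = wedge (\<sigma>' w) (pd (cnj v) \<sigma>' w)"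
    using adapted_coordinate[OF \<mu>(2)[folded \<sigma>_def] z0 sN valN closedN nz] by metis
  interpret il: isothermic_lift "ball 0 r" \<sigma>' by (rule iso)
  obtain R \<Phi> where R: "ball 0 R \<subseteq> ball (0::complex) r" "isothermic_frame (ball 0 R) \<sigma>' R \<Phi>"
    using il.obtain_isothermic_frame r by auto
  interpret fr: isothermic_frame "ball 0 R" \<sigma>' R \<Phi> by (rule R(2))
  obtain w0 where w0: "fr.normal 0 w0" "w0 \<noteq> 0"
    using fr.exists_normal_vector[OF assms(3) fr.zero_in_S] .
  obtain P :: "nat \<Rightarrow> complex \<Rightarrow> 'n lorentz" where P: "\<And>m. smooth_on (ball 0 R) (P m)" "P 0 0 \<noteq> 0"
    "\<And>z. z \<in> ball 0 R \<Longrightarrow> lor (\<sigma>' z) (P 0 z) = 0" "\<And>z e. z \<in> ball 0 R \<Longrightarrow> e \<in> dirs \<Longrightarrow> lor (pd e \<sigma>' z) (P 0 z) = 0"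
    "\<And>m z. z \<in> ball 0 R \<Longrightarrow> pd 1 (P m) z = - wedge (\<sigma>' z) (pd 1 \<sigma>' z) (P (Suc m) z)"
    "\<And>m z. z \<in> ball 0 R \<Longrightarrow> pd \<i> (P m) z = wedge (\<sigma>' z) (pd \<i> \<sigma>' z) (P (Suc m) z)"
    using fr.formal_solution[OF w0] by metis
  have cnj_expand: "wedge (\<sigma>' w) (pd (cnj v) \<sigma>' w) y
      = Re v *\<^sub>R wedge (\<sigma>' w) (pd 1 \<sigma>' w) y - Im v *\<^sub>R wedge (\<sigma>' w) (pd \<i> \<sigma>' w) y"
    if "w \<in> ball 0 R" for v w y
    unfolding pd_complex_expand[OF fr.diffs(1)[OF that], of "cnj v"]
    by (simp add: wedge.add_right wedge.scaleR_right blinfun.bilinear_simps wedge.minus_right)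
  have P_eq: "pd v (P m) w + wedge (\<sigma>' w) (pd (cnj v) \<sigma>' w) (P (Suc m) w) = 0" if "w \<in> ball 0 R" for v m w
    unfolding pd_complex_expand[OF smooth_on_imp_differentiable[OF P(1) that], of v] cnj_expand[OF that] P(5,6)[OF that]
    by simp
  have P0_eq: "wedge (\<sigma>' w) (pd (cnj v) \<sigma>' w) (P 0 w) = 0" if "w \<in> ball 0 R" for v w
    unfolding cnj_expand[OF that] using P(3,4)[OF that] by (simp add: wedge_apply)
  define V where "V = h ` ball 0 R"
  have hR: "h holomorphic_on ball 0 R" using h(1) R(1) by (rule holomorphic_on_subset)
  have injR: "inj_on h (ball 0 R)" using k(2) R(1) by (metis inj_onI subsetD)
  have opV: "open V" unfolding V_def by (rule open_mapping_thm3[OF hR open_ball injR])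
  have VZ: "V \<subseteq> Z" using h(3) R(1) by (auto simp: V_def)
  have Vc: "V \<subseteq> snd c ` fst c" using VZ by (auto simp: Z_def)
  have kV: "k holomorphic_on V" using k(1) R(1) by (auto simp: V_def intro: holomorphic_on_subset)
  have kball: "k z \<in> ball 0 R" "h (k z) = z" "deriv h (k z) * deriv k z = 1" if "z \<in> V" for z
    using that k(2,3) R(1) by (auto simp: V_def subset_iff mult.commute)
  define U where "U = {y \<in> fst c. snd c y \<in> V}"
  have U_open: "openin X U" unfolding U_def by (rule chart_preimage(1)[OF c(1) opV Vc])
  have "connected V" unfolding V_def
    by (intro connected_continuous_image holomorphic_on_imp_continuous_on hR connected_ball)
  then have U_conn: "connectedin X U" unfolding U_def by (rule chart_preimage(2)[OF c(1) opV Vc])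
  have x0: "snd c x = h 0" "0 \<in> ball 0 R" using h(2) fr.zero_in_S by auto
  have xU: "x \<in> U" using c(2) x0 by (auto simp: U_def V_def)
  \<comment> \<open>The coefficient of \<open>t\<^sup>i\<close>, for \<open>i \<le> 0\<close>, is the term of index \<open>- i\<close> of the
    sequence built in the coordinate \<open>w = k \<circ> snd c\<close>.\<close>
  define p where "p i y = (if i > 0 then 0 else P (nat (- i)) (k (snd c y)))" for i :: int and y
  \<comment> \<open>The coordinate \<open>w\<close> is related to every chart of the atlas by a holomorphic map
    \<open>\<psi>\<close>, so the chain rule and the transformation law of \<open>\<eta>\<close> carry the equations over.\<close>
  have local_chart: "smooth_on (snd d ` (fst d \<inter> U)) (coord_rep d (p i)) \<and>
    (\<forall>y\<in>fst d \<inter> U. \<forall>v. dmap d (p i) y v + \<eta> d y v (p (i - 1) y) = 0)" if d: "d \<in> A" for d i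
  proof -
    define T where "T = snd d ` (fst d \<inter> U)"
    have opT: "open T" unfolding T_def by (rule open_chart_image[OF d U_open])
    define g where "g = coord_rep d (snd c)"
    have gy: "g (snd d y) = snd c y" if "y \<in> fst d" for y
      unfolding g_def by (rule coord_rep_chart[OF d that])
    have gT: "g holomorphic_on T"
      unfolding g_def
      by (rule holomorphic_on_subset[OF transition[OF d c(1)]]) (auto simp: T_def U_def)
    have gV: "g ` T \<subseteq> V" using gy by (auto simp: T_def U_def)
    define \<psi> where "\<psi> = (\<lambda>\<zeta>. k (g \<zeta>))"
    have \<psi>T: "\<psi> holomorphic_on T"
      using holomorphic_on_compose_gen[OF gT kV gV] by (simp add: \<psi>_def o_def)
    have \<psi>R: "\<psi> ` T \<subseteq> ball 0 R" using gV kball(1) by (auto simp: \<psi>_def)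
    have rep: "coord_rep d (p i) \<zeta> = (if i > 0 then 0 else P (nat (- i)) (\<psi> \<zeta>))" if \<zeta>: "\<zeta> \<in> T" for \<zeta>
    proof -
      obtain y where "y \<in> fst d" "\<zeta> = snd d y" using \<zeta> by (auto simp: T_def)
      then show ?thesis using gy by (simp add: coord_rep_chart[OF d] p_def \<psi>_def)
    qed
    have smoothP: "smooth_on T (\<lambda>\<zeta>. P m (\<psi> \<zeta>))" for m
      by (rule smooth_on_compose_holomorphic[OF P(1) \<psi>T opT \<psi>R])
    have "smooth_on T (\<lambda>\<zeta>. if i > 0 then 0 else P (nat (- i)) (\<psi> \<zeta>))"
      using smoothP smooth_on_const by (cases "i > 0") auto
    then have sm: "smooth_on T (coord_rep d (p i))"
      by (rule smooth_on_cong[OF _ opT]) (simp add: rep)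
    moreover have "dmap d (p i) y v + \<eta> d y v (p (i - 1) y) = 0" if y: "y \<in> fst d" "y \<in> U" for y v
    proof -
      define \<zeta> where "\<zeta> = snd d y"
      have \<zeta>T: "\<zeta> \<in> T" using y by (auto simp: T_def \<zeta>_def)
      have \<psi>\<zeta>: "\<psi> \<zeta> \<in> ball 0 R" using \<psi>R \<zeta>T by blast
      have g\<zeta>: "g \<zeta> = snd c y" "g \<zeta> \<in> V" using gy y by (auto simp: \<zeta>_def U_def)
      have yc: "y \<in> fst c" using y by (simp add: U_def)
      define v' where "v' = deriv \<psi> \<zeta> * v"
      have dg: "(g has_field_derivative deriv g \<zeta>) (at \<zeta>)" by (rule holomorphic_derivI[OF gT opT \<zeta>T])
      have dk: "(k has_field_derivative deriv k (g \<zeta>)) (at (g \<zeta>))" by (rule holomorphic_derivI[OF kV opV g\<zeta>(2)])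
      have "deriv \<psi> \<zeta> = deriv k (g \<zeta>) * deriv g \<zeta>"
        using DERIV_chain2[OF dk dg] unfolding \<psi>_def by (rule DERIV_imp_deriv)
      then have hv: "deriv h (\<psi> \<zeta>) * v' = deriv g \<zeta> * v"
        using kball(3)[OF g\<zeta>(2)] by (simp add: v'_def \<psi>_def mult.assoc[symmetric])
      have "\<eta> d y v = \<eta> c y (dmap d (snd c) y v)"
        using form d c(1) y(1) yc unfolding one_form_def by blast
      also have "dmap d (snd c) y v = deriv g \<zeta> * v"
        using dg unfolding dmap_eq_pd g_def[symmetric] \<zeta>_def[symmetric] has_field_derivative_def by (rule pd_eqI)
      also have "\<eta> c y = N (h (\<psi> \<zeta>))"
        using kball(2)[OF g\<zeta>(2)] by (simp add: N_def \<psi>_def g\<zeta>(1) coord_rep_chart[OF c(1) yc])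
      also have "N (h (\<psi> \<zeta>)) (deriv g \<zeta> * v) = wedge (\<sigma>' (\<psi> \<zeta>)) (pd (cnj v') \<sigma>' (\<psi> \<zeta>))"
        unfolding hv[symmetric] by (rule N) (use \<psi>\<zeta> R(1) in blast)
      finally have \<eta>y: "\<eta> d y v = wedge (\<sigma>' (\<psi> \<zeta>)) (pd (cnj v') \<sigma>' (\<psi> \<zeta>))" .
      have py: "p j y = (if j > 0 then 0 else P (nat (- j)) (\<psi> \<zeta>))" for j
        by (simp add: p_def \<psi>_def g\<zeta>(1))
      show ?thesis
      proof (cases "i > 0")
        case True
        have "dmap d (p i) y v = pd v (\<lambda>\<zeta>. 0) \<zeta>"
          unfolding dmap_eq_pd \<zeta>_def[symmetric] by (rule pd_cong[OF opT \<zeta>T]) (simp add: rep True)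
        moreover have "\<eta> d y v (p (i - 1) y) = 0"
          using True P0_eq[OF \<psi>\<zeta>] by (cases "i = 1") (auto simp: \<eta>y py blinfun.zero_right)
        ultimately show ?thesis by (simp add: pd_const)
      next
        case False
        have "dmap d (p i) y v = pd v (\<lambda>\<zeta>. P (nat (- i)) (\<psi> \<zeta>)) \<zeta>"
          unfolding dmap_eq_pd \<zeta>_def[symmetric] by (rule pd_cong[OF opT \<zeta>T]) (simp add: rep False)
        also have "\<dots> = pd v' (P (nat (- i))) (\<psi> \<zeta>)"
          unfolding v'_def
          by (rule pd_compose_holomorphic[OF \<psi>T opT \<zeta>T smooth_on_imp_differentiable[OF P(1) \<psi>\<zeta>]])
        finally show ?thesis
          using P_eq[OF \<psi>\<zeta>, of v' "nat (- i)"] False by (simp add: \<eta>y py nat_diff_distrib Suc_nat_eq_nat_zadd1)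
      qed
    qed
    ultimately show ?thesis by (simp add: T_def)
  qed
  have "p 0 x \<noteq> 0" using P(2) x0 k(2)[of 0] r by (simp add: p_def)
  then have "formal_conserved_quantity A \<eta> U p"
    unfolding formal_conserved_quantity_def smooth_section_def using local_chart xU by (auto simp: p_def)
  then show ?thesis using U_open U_conn xU by blast
qed

end
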